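(* Let $n \geq 3$ and let $F \in \mathbb{Z}[x_1,\dots,x_n]$ be a non-singular homogeneous polynomial of degree $k \geq 3$. For any $\gamma \in [0, k - n/(n-1))$ put \[ \theta = \theta(n,k,\gamma) = (n-2)\left(\frac{n}{n-1}\right)^{(n-1)/(n-2)}(k-\gamma)^{-1/(n-2)}. \] Then for any $\varepsilon > 0$ there is a positive integer $D$, depending only on $k$, $\gamma$ and $\varepsilon$, such that for every $B \geq 1$ there is a collection of $O_F(B^{\theta+\varepsilon})$ forms $A_i \in \mathbb{Z}[x_1,\dots,x_n]$ of degree $D$ such that every $\mathbf{x} \in S_\gamma(F,B)$ satisfies $A_i(\mathbf{x}) = 0$ for at least one $i$. Moreover, the coefficients of each $A_i$ may be chosen as coprime integers of absolute value $O(B^c)$, where $c$ and the implied constant depend only on $k$, $\gamma$ and $\varepsilon$.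
   Context: A form $F \in \mathbb{Z}[x_1,\dots,x_n]$ is non-singular if $\nabla F(\mathbf{x}) \neq \mathbf{0}$ for all non-zero $\mathbf{x} \in \overline{\mathbb{Q}}^n$. For $B \ge 1$, $S_\gamma(F,B)$ denotes the set of integer vectors $\mathbf{x} \in \mathbb{Z}^n$ satisfying $|F(x_1,\dots,x_n)| \leq B^\gamma$ and $B/2 < \max_{1\le i\le n} |x_i| \leq B$. *)

theory Defs
  imports
    "HOL-Analysis.Analysis"
    "HOL-Computational_Algebra.Polynomial"
    "HOL-Library.Poly_Mapping"
    "HOL-Library.FuncSet"
begin

text \<open>
  Integer polynomials in the variables \<open>x 0, x 1, \<dots>\<close>: finitely supported maps from exponent
  vectors to coefficients. Ring operations are those of the library type. The ring
  \<open>\<int>[x\<^sub>1, \<dots>, x\<^sub>n]\<close> consists of the polynomials using only variables of index less than \<open>n\<close>.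
\<close>

type_synonym monomial = "nat \<Rightarrow>\<^sub>0 nat"
type_synonym int_mpoly = "monomial \<Rightarrow>\<^sub>0 int"

definition int_polys :: "nat \<Rightarrow> int_mpoly set" where
  "int_polys n = {P. \<forall>m \<in> Poly_Mapping.keys P. Poly_Mapping.keys m \<subseteq> {..<n}}"

definition mon_degree :: "monomial \<Rightarrow> nat" where
  "mon_degree m = (\<Sum>i \<in> Poly_Mapping.keys m. Poly_Mapping.lookup m i)"

definition homogeneous :: "nat \<Rightarrow> int_mpoly \<Rightarrow> bool" where
  "homogeneous d P \<longleftrightarrow> (\<forall>m \<in> Poly_Mapping.keys P. mon_degree m = d)"

text \<open>The zero polynomial is excluded, so a form of degree \<open>d\<close> has degree exactly \<open>d\<close>.\<close>

definition forms :: "nat \<Rightarrow> nat \<Rightarrow> int_mpoly set" where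
  "forms n d = {P \<in> int_polys n. homogeneous d P \<and> P \<noteq> 0}"

definition eval :: "(nat \<Rightarrow> 'a::comm_ring_1) \<Rightarrow> int_mpoly \<Rightarrow> 'a" where
  "eval x P = (\<Sum>m \<in> Poly_Mapping.keys P. of_int (Poly_Mapping.lookup P m) *
                 (\<Prod>i \<in> Poly_Mapping.keys m. x i ^ Poly_Mapping.lookup m i))"

text \<open>
  Subtraction of exponent vectors truncates, but only where the coefficient produced is \<open>0\<close>.
\<close>

definition partial_deriv :: "nat \<Rightarrow> int_mpoly \<Rightarrow> int_mpoly" where
  "partial_deriv i P = (\<Sum>m \<in> Poly_Mapping.keys P.
     Poly_Mapping.single (m - Poly_Mapping.single i 1)
       (int (Poly_Mapping.lookup m i) * Poly_Mapping.lookup P m))"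

text \<open>\<open>\<rat>\<close>-bar is taken to be the field of algebraic complex numbers.\<close>

definition nonsingular :: "nat \<Rightarrow> int_mpoly \<Rightarrow> bool" where
  "nonsingular n F \<longleftrightarrow>
     (\<forall>x :: nat \<Rightarrow> complex. (\<forall>i<n. algebraic (x i)) \<and> (\<exists>i<n. x i \<noteq> 0) \<longrightarrow>
        (\<exists>i<n. eval x (partial_deriv i F) \<noteq> 0))"

text \<open>
  A vector in \<open>\<int>\<^sup>n\<close> is an extensional function on \<open>{..<n}\<close>. Real powers use \<open>powr\<close>; the base
  \<open>B\<close> will be at least \<open>1\<close>.
\<close>

definition S_set :: "real \<Rightarrow> nat \<Rightarrow> int_mpoly \<Rightarrow> real \<Rightarrow> (nat \<Rightarrow> int) set" where
  "S_set \<gamma> n F B = {x \<in> {..<n} \<rightarrow>\<^sub>E UNIV.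
     real_of_int \<bar>eval x F\<bar> \<le> B powr \<gamma> \<and>
     B / 2 < real_of_int (Max ((\<lambda>i. \<bar>x i\<bar>) ` {..<n})) \<and>
     real_of_int (Max ((\<lambda>i. \<bar>x i\<bar>) ` {..<n})) \<le> B}"

definition theta :: "nat \<Rightarrow> nat \<Rightarrow> real \<Rightarrow> real" where
  "theta n k \<gamma> = (real n - 2) * (real n / (real n - 1)) powr ((real n - 1) / (real n - 2))
                    * (real k - \<gamma>) powr (- 1 / (real n - 2))"

definition coprime_coeffs :: "int_mpoly \<Rightarrow> bool" where
  "coprime_coeffs A \<longleftrightarrow> Gcd (Poly_Mapping.lookup A ` Poly_Mapping.keys A) = 1"

end

theory Submission
  imports Defs "HOL-Computational_Algebra.Fundamental_Theorem_Algebra"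
begin

text \<open>
  This is a real-analytic determinant method, carried out as a pigeonhole argument. Dividing by a
  coordinate of maximal absolute value turns \<open>x \<in> S_\<gamma>(F, B)\<close> into an affine point \<open>u\<close> with
  \<open>F(u) = O(B\<^sup>-\<^sup>\<beta>)\<close>, where \<open>\<beta> = k - \<gamma>\<close>. A real singular zero of \<open>F\<close> would specialize to an algebraic
  one, so by compactness some partial derivative \<open>\<partial>\<^sub>i F\<close> is bounded below at \<open>u\<close>, and \<open>F\<close> can
  replace \<open>u\<^sub>i\<close> as a local coordinate. Cut the remaining \<open>n - 2\<close> coordinates into cubes of side
  \<open>B\<^sup>-\<^sup>\<alpha>\<close>, which gives \<open>O(B\<^sup>(\<^sup>n\<^sup>-\<^sup>2\<^sup>)\<^sup>\<alpha>)\<close> patches. On a patch every monomial of degree \<open>D\<close> expands in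
  monomials of local coordinates of weights \<open>\<alpha>\<close> (\<open>n - 2\<close> times) and \<open>\<beta>\<close> (once). The pigeonhole
  principle yields integer coefficients of size at most \<open>B\<^sup>T\<^sup>-\<^sup>D\<^sup>-\<^sup>1\<close>, not all zero, for which every
  expansion coefficient of weight \<open>w < T\<close> is \<open>O(B\<^sup>w\<^sup>-\<^sup>D\<^sup>-\<^sup>1)\<close>; the resulting form has integer values
  of absolute value less than 1 at the points of the patch, so it vanishes there. With \<open>T = n D / (n - 1)\<close>
  there are few enough boxes for large \<open>D\<close> as soon as \<open>\<alpha>\<^sup>n\<^sup>-\<^sup>2 \<beta> > (n / (n - 1))\<^sup>n\<^sup>-\<^sup>1\<close>, that is,
  \<open>(n - 2) \<alpha> > \<theta>\<close>. The degree can be chosen independently of \<open>n\<close> because \<open>\<theta> \<ge> 2\<close> once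
  \<open>n \<ge> 2 k + 2\<close>, where the forms \<open>a x\<^sub>1 - b x\<^sub>0\<close>, multiplied by a power of \<open>x\<^sub>0\<close>, suffice.
\<close>

text \<open>Write T = tau * D and let P = \<alpha>^(n-2) \<beta> be the product of the weights. To
  leading order in D, the number of boxes against the number of coefficient vectors compares tau^n /
  (n! P) with (tau - 1) / (n - 1)!, so P > tau^n / (n (tau - 1)) is wanted. The right side is least
  at tau = n / (n - 1), where it equals (n / (n - 1))^(n-1); this is the origin of T and of the base
  in \<theta>. The hypothesis \<beta> > n / (n - 1) places the critical \<alpha> below \<beta>, so
  that on a patch the variation of F is dominated by the side B^(-\<alpha>) of the cubes. In the
  coefficient size B^(T-D-1), clearing denominators costs B^D, truncation gains B^(-T), and one
  spare factor B absorbs every constant once B is large; smaller B are left to the family of forms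
  in two variables. Non-singularity speaks of algebraic points only, whereas compactness produces a
  real one. Bridging this gap is what the commutative algebra is for.\<close>

abbreviation (input) "lookup \<equiv> Poly_Mapping.lookup"
abbreviation (input) "keys \<equiv> Poly_Mapping.keys"
abbreviation (input) "single \<equiv> Poly_Mapping.single"

section \<open>Specializing points of rings to algebraic points\<close>

definition is_subring :: "'a::comm_ring_1 set \<Rightarrow> bool" where
  "is_subring R \<longleftrightarrow> 1 \<in> R \<and> (\<forall>a\<in>R. \<forall>b\<in>R. a + b \<in> R \<and> a * b \<in> R \<and> - a \<in> R)"

lemma is_subringD:
  assumes "is_subring R"
  shows "1 \<in> R" "0 \<in> R" "a \<in> R \<Longrightarrow> b \<in> R \<Longrightarrow> a + b \<in> R" "a \<in> R \<Longrightarrow> b \<in> R \<Longrightarrow> a * b \<in> R"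
    "a \<in> R \<Longrightarrow> - a \<in> R" "a \<in> R \<Longrightarrow> b \<in> R \<Longrightarrow> a - b \<in> R"
proof -
  show 1: "1 \<in> R" using assms by (auto simp: is_subring_def)
  show a: "a \<in> R \<Longrightarrow> b \<in> R \<Longrightarrow> a + b \<in> R" and "a \<in> R \<Longrightarrow> b \<in> R \<Longrightarrow> a * b \<in> R"
    and u: "a \<in> R \<Longrightarrow> - a \<in> R" for a b
    using assms by (auto simp: is_subring_def)
  show "0 \<in> R" using a[OF 1 u[OF 1]] by simp
  show "a \<in> R \<Longrightarrow> b \<in> R \<Longrightarrow> a - b \<in> R" for a b
    using a[of a "- b"] u[of b] by simp
qed

lemma is_subring_sum: "is_subring R \<Longrightarrow> (\<And>i. i \<in> A \<Longrightarrow> f i \<in> R) \<Longrightarrow> sum f A \<in> R"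
  by (induction A rule: infinite_finite_induct) (auto simp: is_subringD)

lemma is_subring_prod: "is_subring R \<Longrightarrow> (\<And>i. i \<in> A \<Longrightarrow> f i \<in> R) \<Longrightarrow> prod f A \<in> R"
  by (induction A rule: infinite_finite_induct) (auto simp: is_subringD)

lemma is_subring_power: "is_subring R \<Longrightarrow> a \<in> R \<Longrightarrow> a ^ n \<in> R"
  by (induction n) (auto simp: is_subringD)

lemma is_subring_of_nat: "is_subring R \<Longrightarrow> of_nat n \<in> R"
  by (induction n) (auto simp: is_subringD)

lemma is_subring_of_int: "is_subring R \<Longrightarrow> of_int n \<in> R"
  by (cases n rule: int_cases2) (auto simp: is_subringD is_subring_of_nat)

definition polys_over :: "'a::comm_ring_1 set \<Rightarrow> 'a poly set" where
  "polys_over R = {p. \<forall>i. coeff p i \<in> R}"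

lemma polys_over_subring:
  assumes "is_subring R"
  shows "is_subring (polys_over R)"
  unfolding is_subring_def polys_over_def
  by (auto simp: coeff_mult coeff_1 intro!: is_subring_sum[OF assms] is_subringD[OF assms])

lemma polys_over_const: "is_subring R \<Longrightarrow> c \<in> R \<Longrightarrow> [:c:] \<in> polys_over R"
  by (auto simp: polys_over_def coeff_pCons is_subringD split: nat.splits)

lemma polys_over_monom: "is_subring R \<Longrightarrow> c \<in> R \<Longrightarrow> monom c n \<in> polys_over R"
  by (auto simp: polys_over_def is_subringD)

lemma polys_over_smult: "is_subring R \<Longrightarrow> c \<in> R \<Longrightarrow> p \<in> polys_over R \<Longrightarrow> smult c p \<in> polys_over R"
  by (auto simp: polys_over_def is_subringD)

lemma polys_over_coeff: "p \<in> polys_over R \<Longrightarrow> coeff p i \<in> R"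
  by (auto simp: polys_over_def)

definition adjoin :: "'a::comm_ring_1 set \<Rightarrow> 'a \<Rightarrow> 'a set" where
  "adjoin R t = (\<lambda>p. poly p t) ` polys_over R"

lemma adjoin_subring:
  assumes "is_subring R"
  shows "is_subring (adjoin R t)"
proof -
  note D = is_subringD[OF polys_over_subring[OF assms]]
  have "\<exists>r\<in>polys_over R. poly p t + poly q t = poly r t" 
    "\<exists>r\<in>polys_over R. poly p t * poly q t = poly r t" "\<exists>r\<in>polys_over R. - poly p t = poly r t"
    if "p \<in> polys_over R" "q \<in> polys_over R" for p q
    using that D(3,4,5)[of p] by (metis poly_add, metis poly_mult, metis poly_minus)
  moreover have "\<exists>r\<in>polys_over R. 1 = poly r t" by (auto intro!: bexI[of _ 1] D)
  ultimately show ?thesis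
    unfolding is_subring_def adjoin_def image_iff ball_simps by blast
qed

lemma subset_adjoin:
  assumes "is_subring R"
  shows "R \<subseteq> adjoin R t"
proof
  fix c assume "c \<in> R"
  thus "c \<in> adjoin R t"
    unfolding adjoin_def
    by (intro image_eqI[where x = "[:c:]"] polys_over_const assms) auto
qed

lemma in_adjoin:
  assumes "is_subring R"
  shows "t \<in> adjoin R t"
  unfolding adjoin_def
  by (intro image_eqI[where x = "monom 1 1"] polys_over_monom assms is_subringD[OF assms])
     (auto simp: poly_monom)

text \<open>One step of pseudo-division. The leading coefficient of \<open>g\<close> may have no
  inverse in \<open>R\<close>, so \<open>p\<close> is multiplied by it instead. All Euclidean
  descents over subrings iterate this step.\<close>

lemma cancel_lead:
  assumes R: "is_subring R" and p: "p \<in> polys_over R" and g: "g \<in> polys_over R"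
    and deg: "degree g \<le> degree p" "degree p > 0"
  defines "p' \<equiv> smult (lead_coeff g) p - monom (lead_coeff p) (degree p - degree g) * g"
  shows "p' \<in> polys_over R" "degree p' < degree p"
proof -
  note D = is_subringD[OF polys_over_subring[OF R]]
  show "p' \<in> polys_over R"
    unfolding p'_def using p g by (intro D polys_over_smult polys_over_monom R polys_over_coeff)
  have "degree p' \<le> degree p"
    unfolding p'_def
    by (intro degree_diff_le order.trans[OF degree_smult_le] order.trans[OF degree_mult_le])
       (use deg degree_monom_le[of "lead_coeff p" "degree p - degree g"] in auto)
  moreover have "coeff p' (degree p) = 0"
    unfolding p'_def using deg by (simp add: coeff_monom_mult)
  ultimately show "degree p' < degree p"
    using deg by (metis degree_0 le_neq_implies_less leading_coeff_0_iff)
qed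

section \<open>Ring homomorphisms given on a subring\<close>

definition hom_on :: "'a::comm_ring_1 set \<Rightarrow> ('a \<Rightarrow> 'b::comm_ring_1) \<Rightarrow> bool" where
  "hom_on R \<phi> \<longleftrightarrow> \<phi> 1 = 1 \<and> (\<forall>a\<in>R. \<forall>b\<in>R. \<phi> (a + b) = \<phi> a + \<phi> b \<and> \<phi> (a * b) = \<phi> a * \<phi> b)"

lemma hom_onD:
  assumes "hom_on R \<phi>" "is_subring R"
  shows "\<phi> 1 = 1" "\<phi> 0 = 0" "a \<in> R \<Longrightarrow> b \<in> R \<Longrightarrow> \<phi> (a + b) = \<phi> a + \<phi> b"
    "a \<in> R \<Longrightarrow> b \<in> R \<Longrightarrow> \<phi> (a * b) = \<phi> a * \<phi> b" "a \<in> R \<Longrightarrow> \<phi> (- a) = - \<phi> a"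
proof -
  note D = is_subringD[OF assms(2)]
  show "\<phi> 1 = 1" using assms by (auto simp: hom_on_def)
  show add: "a \<in> R \<Longrightarrow> b \<in> R \<Longrightarrow> \<phi> (a + b) = \<phi> a + \<phi> b"
    and "a \<in> R \<Longrightarrow> b \<in> R \<Longrightarrow> \<phi> (a * b) = \<phi> a * \<phi> b" for a b
    using assms by (auto simp: hom_on_def)
  show z: "\<phi> 0 = 0" using add[of 0 0] D by simp
  show "a \<in> R \<Longrightarrow> \<phi> (- a) = - \<phi> a" for a
    using add[of a "- a"] z D by (simp add: eq_neg_iff_add_eq_0 add.commute)
qed

lemma hom_on_sum:
  assumes "hom_on R \<phi>" "is_subring R" "\<And>i. i \<in> A \<Longrightarrow> f i \<in> R"
  shows "\<phi> (sum f A) = (\<Sum>i\<in>A. \<phi> (f i))"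
  using assms(3)
  by (induction A rule: infinite_finite_induct)
     (auto simp: hom_onD[OF assms(1,2)] is_subring_sum[OF assms(2)])

lemma hom_on_prod:
  assumes "hom_on R \<phi>" "is_subring R" "\<And>i. i \<in> A \<Longrightarrow> f i \<in> R"
  shows "\<phi> (prod f A) = (\<Prod>i\<in>A. \<phi> (f i))"
  using assms(3)
  by (induction A rule: infinite_finite_induct)
     (auto simp: hom_onD[OF assms(1,2)] is_subring_prod[OF assms(2)])

lemma hom_on_power:
  assumes "hom_on R \<phi>" "is_subring R" "a \<in> R"
  shows "\<phi> (a ^ n) = \<phi> a ^ n"
  using assms(3)
  by (induction n) (auto simp: hom_onD[OF assms(1,2)] is_subring_power[OF assms(2)])

lemma hom_on_of_int:
  assumes "hom_on R \<phi>" "is_subring R"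
  shows "\<phi> (of_int m) = of_int m"
proof -
  have n: "\<phi> (of_nat k) = of_nat k" for k
    by (induction k) (auto simp: hom_onD[OF assms] is_subring_of_nat[OF assms(2)] is_subringD[OF assms(2)])
  show ?thesis
    by (cases m rule: int_cases2)
       (auto simp: n hom_onD[OF assms] is_subring_of_nat[OF assms(2)])
qed

lemma hom_on_map_poly:
  assumes "hom_on R \<phi>" "is_subring R"
  shows "hom_on (polys_over R) (map_poly \<phi>)"
proof -
  note H = hom_onD[OF assms]
  have "map_poly \<phi> (p * q) = map_poly \<phi> p * map_poly \<phi> q"
    if p: "p \<in> polys_over R" and q: "q \<in> polys_over R" for p q
  proof (rule poly_eqI)
    fix n
    have "coeff (map_poly \<phi> (p * q)) n = \<phi> (\<Sum>i\<le>n. coeff p i * coeff q (n - i))"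
      by (simp add: coeff_map_poly H coeff_mult)
    also have "\<dots> = (\<Sum>i\<le>n. \<phi> (coeff p i * coeff q (n - i)))"
      using p q by (intro hom_on_sum[OF assms]) (auto simp: polys_over_def is_subringD[OF assms(2)])
    also have "\<dots> = (\<Sum>i\<le>n. \<phi> (coeff p i) * \<phi> (coeff q (n - i)))"
      using p q by (intro sum.cong) (auto simp: polys_over_def H)
    finally show "coeff (map_poly \<phi> (p * q)) n = coeff (map_poly \<phi> p * map_poly \<phi> q) n"
      by (simp add: coeff_map_poly H coeff_mult)
  qed
  thus ?thesis
    unfolding hom_on_def
    by (auto simp: H poly_eq_iff coeff_map_poly polys_over_def)
qed

section \<open>Number fields inside the complex numbers\<close>

interpretation QC: vector_space "\<lambda>(q::rat) (z::complex). of_rat q * z"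
  by unfold_locales (auto simp: algebra_simps of_rat_add of_rat_mult)

text \<open>These are the number fields in the complex numbers: closure under inverses follows from
  finite dimension. Finiteness is phrased through a finite spanning set, which may reach outside
  \<open>L\<close>, so that no basis has to be exhibited.\<close>

definition finite_algebra :: "complex set \<Rightarrow> bool" where
  "finite_algebra L \<longleftrightarrow> is_subring L \<and> range of_rat \<subseteq> L \<and> (\<exists>S. finite S \<and> L \<subseteq> QC.span S)"

text \<open>One more power of \<open>x\<close> than there are spanning vectors forces a rational
  linear relation among the powers.\<close>

lemma finite_algebra_algebraic:
  assumes "finite_algebra L" "x \<in> L"
  shows "algebraic x"
proof -
  from assms obtain S where S: "finite S" "L \<subseteq> QC.span S" and L: "is_subring L"
    by (auto simp: finite_algebra_def)
  let ?N = "card S"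
  show ?thesis
  \<comment> \<open>Linear dependence concerns the set of powers, so coinciding powers are treated
    apart; they give the polynomial X^a - X^b directly.\<close>
  proof (cases "inj_on (\<lambda>j. x ^ j) {..?N}")
    case False
    then obtain a b where ab: "a \<noteq> b" "x ^ a = x ^ b" by (auto simp: inj_on_def)
    show ?thesis
    proof (rule algebraicI')
      show "coeff (monom 1 a - monom 1 b) i \<in> \<rat>" for i :: nat by (auto)
      show "monom 1 a - monom 1 b \<noteq> (0 :: complex poly)"
        using ab(1) by (auto simp: poly_eq_iff)
      show "poly (monom 1 a - monom 1 b) x = 0" using ab by (simp add: poly_monom)
    qed
  next
    case inj: True
    let ?P = "(\<lambda>j. x ^ j) ` {..?N}"
    have "card ?P = Suc ?N" using inj by (simp add: card_image)
    moreover have "?P \<subseteq> QC.span S"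
      using S is_subring_power[OF L assms(2)] by auto
    ultimately have "QC.dependent ?P"
      using QC.independent_span_bound[OF S(1), of ?P] by auto
    then obtain u where u: "\<exists>v\<in>?P. u v \<noteq> 0" "(\<Sum>v\<in>?P. of_rat (u v) * v) = 0"
      using QC.dependent_finite[of ?P] by auto
    define p :: "complex poly" where "p = (\<Sum>j\<le>?N. monom (of_rat (u (x ^ j))) j)"
    have c: "coeff p i = (if i \<le> ?N then of_rat (u (x ^ i)) else 0)" for i
      by (auto simp: p_def coeff_sum if_distrib sum.delta)
    show ?thesis
    proof (rule algebraicI')
      show "coeff p i \<in> \<rat>" for i by (auto simp: c)
      show "p \<noteq> 0" using u(1) c by (auto simp: poly_eq_iff) 
      show "poly p x = 0"
        using u(2) by (simp add: p_def poly_sum poly_monom sum.reindex[OF inj])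
    qed
  qed
qed

text \<open>If c + X q(X) is a rational polynomial that vanishes at \<open>x\<close> and has c
  nonzero, then - q(x) / c is the inverse, and it is visibly in \<open>L\<close>.\<close>

lemma finite_algebra_inverse:
  assumes "finite_algebra L" "x \<in> L"
  shows "inverse x \<in> L"
proof (cases "x = 0")
  case False
  have L: "is_subring L" and Q: "range of_rat \<subseteq> L" using assms by (auto simp: finite_algebra_def)
  obtain p' where p': "coeff p' 0 \<noteq> 0" "poly (map_poly of_int p') x = 0"
    using algebraicE'_nonzero[OF finite_algebra_algebraic[OF assms] False] by metis
  define p :: "complex poly" where "p = map_poly of_int p'"
  have p: "\<And>i. coeff p i \<in> \<rat>" "coeff p 0 \<noteq> 0" "poly p x = 0"
    using p' by (auto simp: p_def coeff_map_poly)
  obtain c q where pq: "p = pCons c q" by (cases p)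
  have c0: "c \<noteq> 0" using p(2) pq by simp
  have q: "coeff q i \<in> L" for i
    using p(1)[of "Suc i"] Q unfolding pq by (auto simp: Rats_def)
  have "c \<in> \<rat>" using p(1)[of 0] pq by simp
  hence "inverse c \<in> \<rat>" by simp
  hence c: "inverse c \<in> L" using Q by (auto simp: Rats_def)
  have "poly q x \<in> L"
    unfolding poly_altdef
    by (intro is_subring_sum L is_subringD(4)[OF L] is_subring_power q assms)
  hence "- (poly q x * inverse c) \<in> L" using c by (intro is_subringD[OF L])
  moreover have "x * (- (poly q x * inverse c)) = 1"
  proof -
    have "x * poly q x = - c" using p(3) pq by (simp add: eq_neg_iff_add_eq_0 add.commute)
    moreover have "x * (- (poly q x * inverse c)) = - (x * poly q x) * inverse c" by simp
    ultimately show ?thesis using c0 by simp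
  qed
  hence "- (poly q x * inverse c) = inverse x"
    by (metis inverse_unique)
  ultimately show ?thesis by simp
qed (use assms is_subringD in \<open>auto simp: finite_algebra_def\<close>)

lemma span_times:
  assumes "x \<in> QC.span S" 
  shows "x * y \<in> QC.span ((\<lambda>b. b * y) ` S)"
  using assms
proof (induction rule: QC.span_induct_alt)
  case base
  show ?case using QC.span_zero by simp
next
  case (step c b z)
  have "b * y \<in> QC.span ((\<lambda>b. b * y) ` S)" using step by (intro QC.span_base) auto
  hence "of_rat c * (b * y) + z * y \<in> QC.span ((\<lambda>b. b * y) ` S)"
    using step by (intro QC.span_add QC.span_scale)
  thus ?case by (simp add: algebra_simps)
qed

text \<open>The products b s^j with b in a spanning set of \<open>L\<close> and j < deg g span the
  extension. Reduction modulo \<open>g\<close> keeps its coefficients in \<open>L\<close> because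
  \<open>L\<close> is closed under inverses.\<close>

lemma finite_algebra_adjoin:
  assumes L: "finite_algebra L" and g: "g \<in> polys_over L" "degree g > 0" "poly g s = 0"
  shows "finite_algebra (adjoin L s)"
proof -
  from L obtain S where S: "finite S" "L \<subseteq> QC.span S" and R: "is_subring L" and Q: "range of_rat \<subseteq> L"
    by (auto simp: finite_algebra_def)
  define d where "d = degree g"
  let ?S = "\<Union>j<d. (\<lambda>b. b * s ^ j) ` S"
  have low: "poly p s \<in> QC.span ?S" if p: "p \<in> polys_over L" "degree p < d" for p
  proof -
    have "coeff p i * s ^ i \<in> QC.span ?S" if "i \<le> degree p" for i
    proof -
      have "coeff p i * s ^ i \<in> QC.span ((\<lambda>b. b * s ^ i) ` S)"
        using p S by (intro span_times) (auto simp: polys_over_def)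
      moreover have "QC.span ((\<lambda>b. b * s ^ i) ` S) \<subseteq> QC.span ?S"
        using that p by (intro QC.span_mono) fastforce
      ultimately show ?thesis by (rule subsetD[rotated])
    qed
    thus ?thesis unfolding poly_altdef by (intro QC.span_sum) auto
  qed
  have "poly p s \<in> QC.span ?S" if p: "p \<in> polys_over L" for p
    using p
  proof (induction "degree p" arbitrary: p rule: less_induct)
    case less
    show ?case
    proof (cases "degree p < d")
      case False
      let ?p = "smult (lead_coeff g) p - monom (lead_coeff p) (degree p - degree g) * g"
      let ?q = "smult (inverse (lead_coeff g)) ?p"
      have deg: "degree g \<le> degree p" "degree p > 0" using False g by (auto simp: d_def)
      note c = cancel_lead[OF R less.prems g(1) deg]
      have "?q \<in> polys_over L"
        by (intro polys_over_smult R c finite_algebra_inverse[OF L] polys_over_coeff g)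
      moreover have "degree ?q < degree p" using c(2) by (metis degree_smult_le order.strict_trans1)
      ultimately have "poly ?q s \<in> QC.span ?S" using less.hyps by blast
      moreover have "lead_coeff g \<noteq> 0" using g(2) by auto
      hence "poly ?q s = poly p s" using g(3) by simp
      ultimately show ?thesis by simp
    qed (use low[OF less.prems] in simp)
  qed
  hence "adjoin L s \<subseteq> QC.span ?S" by (auto simp: adjoin_def)
  moreover have "finite ?S" using S by auto
  ultimately show ?thesis
    unfolding finite_algebra_def
    using adjoin_subring[OF R] order.trans[OF Q subset_adjoin[OF R, of s]]
    by (intro conjI exI[of _ ?S])
qed

text \<open>The homomorphism may depend on the element \<open>h\<close> that has to survive. This
  freedom is what makes the property pass to \<open>adjoin R t\<close>: survival of an element there
  is reduced to survival of a suitable non-zero element of \<open>R\<close>.\<close>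

definition specializable :: "complex set \<Rightarrow> bool" where
  "specializable R \<longleftrightarrow> is_subring R \<and>
     (\<forall>h\<in>R. h \<noteq> 0 \<longrightarrow> (\<exists>\<phi> L. finite_algebra L \<and> \<phi> ` R \<subseteq> L \<and> hom_on R \<phi> \<and> \<phi> h \<noteq> 0))"

text \<open>The universal property of a simple extension: \<open>t\<close> may be sent to
  \<open>s\<close> once \<open>s\<close> satisfies the images of all relations of \<open>t\<close>
  over \<open>R\<close>.\<close>

lemma hom_adjoin:
  assumes R: "is_subring R" and \<phi>: "hom_on R \<phi>"
    and ker: "\<And>p. p \<in> polys_over R \<Longrightarrow> poly p t = 0 \<Longrightarrow> poly (map_poly \<phi> p) s = 0"
  obtains \<psi> where "hom_on (adjoin R t) \<psi>"
    "\<And>p. p \<in> polys_over R \<Longrightarrow> \<psi> (poly p t) = poly (map_poly \<phi> p) s"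
proof -
  note D = is_subringD[OF polys_over_subring[OF R]]
  note H = hom_onD[OF hom_on_map_poly[OF \<phi> R] polys_over_subring[OF R]]
  \<comment> \<open>An element has many representations \<open>poly p t\<close>; an arbitrary one is
    chosen, and \<open>ker\<close>, applied to a difference of two, shows that the choice is
    immaterial.\<close>
  define \<psi> where "\<psi> x = poly (map_poly \<phi> (SOME p. p \<in> polys_over R \<and> poly p t = x)) s" for x
  have *: "\<psi> (poly p t) = poly (map_poly \<phi> p) s" if p: "p \<in> polys_over R" for p
  proof -
    define q where "q = (SOME q. q \<in> polys_over R \<and> poly q t = poly p t)"
    have q: "q \<in> polys_over R \<and> poly q t = poly p t"
      unfolding q_def by (rule someI[of _ p]) (use p in auto)
    have "poly (map_poly \<phi> (q + - p)) s = 0"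
      using p q by (intro ker D) auto
    hence "poly (map_poly \<phi> q) s = poly (map_poly \<phi> p) s"
      using p q by (simp add: H D del: add_uminus_conv_diff) simp
    thus ?thesis by (simp add: \<psi>_def q_def)
  qed
  have "hom_on (adjoin R t) \<psi>"
    unfolding hom_on_def
  proof (intro conjI ballI)
    show "\<psi> 1 = 1" using *[of 1] D H by (metis poly_1)
  next
    fix a b assume "a \<in> adjoin R t" "b \<in> adjoin R t"
    then obtain p q where pq: "p \<in> polys_over R" "q \<in> polys_over R" "a = poly p t" "b = poly q t"
      by (auto simp: adjoin_def)
    show "\<psi> (a + b) = \<psi> a + \<psi> b" 
      using *[of "p + q"] pq * by (simp add: D H)
    show "\<psi> (a * b) = \<psi> a * \<psi> b" 
      using *[of "p * q"] pq * by (simp add: D H)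
  qed
  with * show ?thesis using that by blast
qed

text \<open>There are no relations to respect, so \<open>t\<close> may go anywhere. A homomorphism
  that keeps one coefficient of \<open>h\<close> leaves a non-zero polynomial, and some integer
  avoids its finitely many roots. An integer value keeps the image inside \<open>L\<close>.\<close>

lemma specializable_adjoin_transcendental:
  assumes "specializable R" "\<And>p. p \<in> polys_over R \<Longrightarrow> poly p t = 0 \<Longrightarrow> p = 0"
  shows "specializable (adjoin R t)"
proof -
  have R: "is_subring R" using assms by (auto simp: specializable_def)
  have "\<exists>\<psi> L. finite_algebra L \<and> \<psi> ` adjoin R t \<subseteq> L \<and> hom_on (adjoin R t) \<psi> \<and> \<psi> h \<noteq> 0"
    if h: "h \<in> adjoin R t" "h \<noteq> 0" for h
  proof -
    obtain q where q: "q \<in> polys_over R" "h = poly q t" using h by (auto simp: adjoin_def)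
    hence "q \<noteq> 0" using h by auto
    then obtain j where j: "coeff q j \<noteq> 0" by (auto simp: poly_eq_iff)
    obtain \<phi> L where \<phi>: "finite_algebra L" "\<phi> ` R \<subseteq> L" "hom_on R \<phi>" "\<phi> (coeff q j) \<noteq> 0"
      using assms j polys_over_coeff[OF q(1), of j] unfolding specializable_def by metis
    have L: "is_subring L" using \<phi> by (auto simp: finite_algebra_def)
    note H = hom_onD[OF \<phi>(3) R]
    have "map_poly \<phi> q \<noteq> 0" using \<phi>(4) by (auto simp: poly_eq_iff coeff_map_poly H)
    hence "finite {x. poly (map_poly \<phi> q) x = 0}" by (rule poly_roots_finite)
    moreover have "infinite (range (of_int :: int \<Rightarrow> complex))"
      using finite_imageD[of "of_int :: int \<Rightarrow> complex" UNIV] infinite_UNIV_int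
      by (auto simp: inj_on_def)
    ultimately have "\<not> range (of_int :: int \<Rightarrow> complex) \<subseteq> {x. poly (map_poly \<phi> q) x = 0}"
      using finite_subset by blast
    then obtain s :: int where s: "poly (map_poly \<phi> q) (of_int s) \<noteq> 0" by auto
    obtain \<psi> where \<psi>: "hom_on (adjoin R t) \<psi>"
      "\<And>p. p \<in> polys_over R \<Longrightarrow> \<psi> (poly p t) = poly (map_poly \<phi> p) (of_int s)"
      using hom_adjoin[OF R \<phi>(3), of t "of_int s"] assms(2) by (metis map_poly_0 poly_0)
    have "poly (map_poly \<phi> p) (of_int s) \<in> L" if "p \<in> polys_over R" for p
      unfolding poly_altdef using that \<phi>(2)
      by (intro is_subring_sum L is_subringD(4)[OF L] is_subring_power is_subring_of_int)
         (auto simp: coeff_map_poly H polys_over_def)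
    hence "\<psi> ` adjoin R t \<subseteq> L" using \<psi>(2) by (auto simp: adjoin_def)
    thus ?thesis using \<phi>(1) \<psi> q s by metis
  qed
  thus ?thesis using adjoin_subring[OF R] by (auto simp: specializable_def)
qed

text \<open>A Euclidean descent towards degree \<open>0\<close>: a nonzero \<open>r \<in> R[X]\<close> of least degree such that
  \<open>r(t)\<close> is a nonzero multiple of \<open>h\<close> must be constant.\<close>

lemma algebraic_multiple_in_base:
  fixes R :: "complex set"
  assumes R: "is_subring R" and g: "g \<in> polys_over R" "g \<noteq> 0" "poly g t = 0"
    and gmin: "\<And>p. p \<in> polys_over R \<Longrightarrow> poly p t = 0 \<Longrightarrow> degree p < degree g \<Longrightarrow> p = 0"
    and h: "h \<in> adjoin R t" "h \<noteq> 0"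
  obtains w v where "w \<in> R" "w \<noteq> 0" "v \<in> adjoin R t" "v * h = w"
proof -
  note D = is_subringD[OF polys_over_subring[OF R]]
  note A = is_subringD[OF adjoin_subring[OF R, of t]]
  define P where "P r \<longleftrightarrow> r \<in> polys_over R \<and> poly r t \<noteq> 0 \<and> (\<exists>v\<in>adjoin R t. poly r t = v * h)" for r
  have inA: "poly p t \<in> adjoin R t" if "p \<in> polys_over R" for p using that by (auto simp: adjoin_def)
  obtain q where q: "q \<in> polys_over R" "h = poly q t" using h by (auto simp: adjoin_def)
  have "P q" unfolding P_def using q h A(1) by (auto intro!: bexI[of _ 1])
  then obtain r where r: "P r" "\<And>r'. P r' \<Longrightarrow> degree r \<le> degree r'"
    using ex_has_least_nat[of P q degree] by auto
  then obtain v where v: "v \<in> adjoin R t" "poly r t = v * h" and rR: "r \<in> polys_over R" "poly r t \<noteq> 0"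
    by (auto simp: P_def)
  have "degree r = 0"
  proof (rule ccontr)
    assume dr: "degree r \<noteq> 0"
    \<comment> \<open>Otherwise a pseudo-division step by \<open>g\<close> would lower the degree:
      it multiplies the value at \<open>t\<close> by the non-zero leading coefficient of
      \<open>g\<close>, so the new value is still a non-zero multiple of \<open>h\<close>.\<close>
    have lt: "degree r < degree g"
    proof (rule ccontr)
      assume "\<not> degree r < degree g"
      hence dg: "degree g \<le> degree r" "degree r > 0" using dr by auto
      let ?r = "smult (lead_coeff g) r - monom (lead_coeff r) (degree r - degree g) * g"
      have 1: "poly ?r t = lead_coeff g * poly r t" using g by simp
      note c = cancel_lead[OF R rR(1) g(1) dg]
      have "P ?r"
        unfolding P_def 1
      proof (intro conjI bexI[of _ "lead_coeff g * v"])
        show "lead_coeff g * v \<in> adjoin R t"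
          using v subset_adjoin[OF R, of t] polys_over_coeff[OF g(1)] by (intro A) auto
      qed (use c v g rR in auto)
      thus False using r(2)[of ?r] c by simp
    qed
    \<comment> \<open>Complete pseudo-division by \<open>r\<close>; the factor \<open>c\<close>
      collects the powers of its leading coefficient.\<close>
    have red: "\<exists>c\<in>R. \<exists>a\<in>polys_over R. \<exists>e\<in>polys_over R. c \<noteq> 0 \<and> smult c p = a * r + e \<and> degree e < degree r"
      if "p \<in> polys_over R" for p
      using that
    proof (induction "degree p" arbitrary: p rule: less_induct)
      case less
      show ?case
      proof (cases "degree p < degree r")
        case True
        thus ?thesis using less.prems D is_subringD[OF R]
          by (intro bexI[of _ 1] bexI[of _ 0] bexI[of _ p]) auto
      next
        case False
        let ?m = "monom (lead_coeff p) (degree p - degree r)"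
        let ?p = "smult (lead_coeff r) p - ?m * r"
        have deg: "degree r \<le> degree p" "degree p > 0" using False dr by auto
        note c = cancel_lead[OF R less.prems rR(1) deg]
        obtain c a e where cae: "c \<in> R" "a \<in> polys_over R" "e \<in> polys_over R" "c \<noteq> 0"
          "smult c ?p = a * r + e" "degree e < degree r"
          using less.hyps[OF c(2,1)] by blast
        have "smult (c * lead_coeff r) p = (a + smult c ?m) * r + e"
          using cae(5) by (simp add: algebra_simps smult_diff_right) 
        moreover have "c * lead_coeff r \<noteq> 0" using cae rR by auto
        moreover have "c * lead_coeff r \<in> R" using cae polys_over_coeff[OF rR(1)] is_subringD[OF R] by auto
        moreover have "a + smult c ?m \<in> polys_over R"
          using cae polys_over_coeff[OF less.prems] by (intro D polys_over_smult polys_over_monom R) auto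
        ultimately show ?thesis using cae by blast
      qed
    qed
    \<comment> \<open>The remainder \<open>e\<close> has value a multiple of \<open>h\<close> at
      \<open>t\<close>, so minimality of \<open>r\<close> makes that value 0 and minimality of
      \<open>g\<close> makes \<open>e\<close> itself 0. Then \<open>a * r\<close> is a multiple of
      \<open>g\<close>, hence \<open>a\<close> vanishes at \<open>t\<close> with degree below that
      of \<open>g\<close>, which is impossible.\<close>
    obtain c a e where cae: "c \<in> R" "a \<in> polys_over R" "e \<in> polys_over R" "c \<noteq> 0"
      "smult c g = a * r + e" "degree e < degree r"
      using red[OF g(1)] by blast
    have e: "poly e t = - poly a t * v * h"
      using arg_cong[OF cae(5), of "\<lambda>p. poly p t"] g v by (simp add: eq_neg_iff_add_eq_0 algebra_simps)
    have e0: "poly e t = 0"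
    proof (rule ccontr)
      assume "poly e t \<noteq> 0"
      moreover have "- poly a t * v \<in> adjoin R t" using v inA cae by (intro A) auto
      ultimately have "P e" using e cae unfolding P_def by blast
      thus False using r(2)[of e] cae by simp
    qed
    hence "e = 0" using gmin[of e] cae lt by simp
    hence ar: "smult c g = a * r" using cae by simp
    have "poly a t = 0" using e e0 v rR by auto
    moreover have "a \<noteq> 0" using ar g cae by auto
    moreover have "degree a < degree g"
    proof -
      have "degree g = degree a + degree r"
        using arg_cong[OF ar, of degree] cae(4) g \<open>a \<noteq> 0\<close> rR degree_mult_eq[of a r] by fastforce
      thus ?thesis using dr by simp
    qed
    ultimately show False using gmin[of a] cae by auto
  qed
  then obtain w where w: "r = [:w:]" by (metis degree_eq_zeroE)
  show ?thesis
  proof (rule that)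
    show "w \<in> R" "w \<noteq> 0" using polys_over_coeff[OF rR(1), of 0] rR(2) by (auto simp: w)
    show "v \<in> adjoin R t" by (fact v)
    show "v * h = w" using v(2) by (simp add: w)
  qed
qed

text \<open>\<open>t\<close> is sent to a complex root of the image of a relation \<open>g\<close>
  of least degree. Two elements of \<open>R\<close> must survive: the leading coefficient of
  \<open>g\<close>, so that a root exists, and a non-zero multiple \<open>w\<close> of
  \<open>h\<close> lying in \<open>R\<close>, so that \<open>h\<close> survives with it.\<close>

lemma specializable_adjoin_algebraic:
  assumes "specializable R" "\<exists>p \<in> polys_over R. p \<noteq> 0 \<and> poly p t = 0"
  shows "specializable (adjoin R t)"
proof -
  have R: "is_subring R" using assms by (auto simp: specializable_def)
  obtain g where g: "g \<in> polys_over R" "g \<noteq> 0" "poly g t = 0"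
    and gmin: "\<And>p. p \<in> polys_over R \<and> p \<noteq> 0 \<and> poly p t = 0 \<Longrightarrow> degree g \<le> degree p"
    using ex_has_least_nat[of "\<lambda>p. p \<in> polys_over R \<and> p \<noteq> 0 \<and> poly p t = 0" _ degree] assms(2) by metis
  have gmin': "p = 0" if "p \<in> polys_over R" "poly p t = 0" "degree p < degree g" for p
    using gmin[of p] that by auto
  have dg: "degree g > 0"
    using g by (auto intro!: gr0I elim!: degree_eq_zeroE)
  define l where "l = lead_coeff g"
  have l: "l \<noteq> 0" "l \<in> R" using g polys_over_coeff[OF g(1)] by (auto simp: l_def)
  have "\<exists>\<psi> L. finite_algebra L \<and> \<psi> ` adjoin R t \<subseteq> L \<and> hom_on (adjoin R t) \<psi> \<and> \<psi> h \<noteq> 0"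
    if h: "h \<in> adjoin R t" "h \<noteq> 0" for h
  proof -
    obtain w v where wv: "w \<in> R" "w \<noteq> 0" "v \<in> adjoin R t" "v * h = w"
      by (rule algebraic_multiple_in_base[OF R g gmin' h])
    have "l * w \<in> R" "l * w \<noteq> 0" using l wv is_subringD[OF R] by auto
    then obtain \<phi> L where \<phi>: "finite_algebra L" "\<phi> ` R \<subseteq> L" "hom_on R \<phi>" "\<phi> (l * w) \<noteq> 0"
      using assms(1) unfolding specializable_def by blast
    note H = hom_onD[OF \<phi>(3) R]
    note HP = hom_onD[OF hom_on_map_poly[OF \<phi>(3) R] polys_over_subring[OF R]]
    have lw: "\<phi> l \<noteq> 0" "\<phi> w \<noteq> 0" using \<phi>(4) H(4)[OF l(2) wv(1)] by auto
    have over: "map_poly \<phi> p \<in> polys_over L" if "p \<in> polys_over R" for p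
      using that \<phi>(2) by (auto simp: polys_over_def coeff_map_poly H)
    have "degree g \<le> degree (map_poly \<phi> g)"
      using lw(1) by (intro le_degree) (simp add: coeff_map_poly H l_def)
    hence dg': "degree (map_poly \<phi> g) > 0" using dg by simp
    then obtain s where s: "poly (map_poly \<phi> g) s = 0"
      using fundamental_theorem_of_algebra[of "map_poly \<phi> g"] by (auto simp: constant_degree)
    have L': "finite_algebra (adjoin L s)"
      by (rule finite_algebra_adjoin[OF \<phi>(1) over[OF g(1)] dg' s])
    \<comment> \<open>\<open>g\<close> need not divide \<open>p\<close> over \<open>R\<close>, but
      it divides \<open>p\<close> up to a power of \<open>l\<close>, and the image of
      \<open>l\<close> can be cancelled because it is non-zero.\<close>
    have ker: "poly (map_poly \<phi> p) s = 0" if "p \<in> polys_over R" "poly p t = 0" for p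
      using that
    proof (induction "degree p" arbitrary: p rule: less_induct)
      case less
      show ?case
      proof (cases "degree p < degree g")
        case False
        let ?m = "monom (lead_coeff p) (degree p - degree g)"
        let ?p = "smult l p - ?m * g"
        have deg: "degree g \<le> degree p" "degree p > 0" using False dg by auto
        note c = cancel_lead[OF R less.prems(1) g(1) deg, folded l_def]
        have in1: "[:l:] \<in> polys_over R" "?m \<in> polys_over R"
          using l polys_over_coeff[OF less.prems(1)] by (auto intro!: polys_over_const polys_over_monom R)
        have "poly ?p t = 0" using less.prems g by simp
        hence "poly (map_poly \<phi> ?p) s = 0" using less.hyps[OF c(2,1)] by simp
        moreover have "map_poly \<phi> ?p = smult (\<phi> l) (map_poly \<phi> p) - map_poly \<phi> ?m * map_poly \<phi> g"
        proof -
          have in2: "[:l:] * p \<in> polys_over R" "?m * g \<in> polys_over R"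
            using in1 less.prems(1) g(1) is_subringD(4)[OF polys_over_subring[OF R]] by blast+
          have "map_poly \<phi> ?p = map_poly \<phi> ([:l:] * p + - (?m * g))" by simp
          also have "\<dots> = map_poly \<phi> ([:l:] * p) + map_poly \<phi> (- (?m * g))"
            by (intro HP in2 is_subringD(5)[OF polys_over_subring[OF R]])
          also have "\<dots> = map_poly \<phi> [:l:] * map_poly \<phi> p - map_poly \<phi> ?m * map_poly \<phi> g"
            by (simp only: HP(4)[OF in1(1) less.prems(1)] HP(4)[OF in1(2) g(1)] HP(5)[OF in2(2)]
                diff_conv_add_uminus)
          finally show ?thesis by (simp add: map_poly_pCons H)
        qed
        ultimately show ?thesis using s lw by simp
      qed (use gmin'[OF less.prems] in simp)
    qed
    obtain \<psi> where \<psi>: "hom_on (adjoin R t) \<psi>"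
      "\<And>p. p \<in> polys_over R \<Longrightarrow> \<psi> (poly p t) = poly (map_poly \<phi> p) s"
      using hom_adjoin[OF R \<phi>(3) ker] by metis
    have "\<psi> ` adjoin R t \<subseteq> adjoin L s" using \<psi>(2) over by (auto simp: adjoin_def)
    moreover have "\<psi> h \<noteq> 0"
    proof
      assume "\<psi> h = 0"
      hence "\<psi> w = 0"
        using hom_onD(4)[OF \<psi>(1) adjoin_subring[OF R] wv(3) h(1)] wv by simp
      moreover have "\<psi> w = \<phi> w"
        using \<psi>(2)[of "[:w:]"] polys_over_const[OF R wv(1)] by (simp add: map_poly_pCons H)
      ultimately show False using lw by simp
    qed
    ultimately show ?thesis using L' \<psi>(1) by blast
  qed
  thus ?thesis using adjoin_subring[OF R] by (auto simp: specializable_def)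
qed

lemma specializable_adjoin: "specializable R \<Longrightarrow> specializable (adjoin R t)"
  by (cases "\<exists>p \<in> polys_over R. p \<noteq> 0 \<and> poly p t = 0")
     (simp add: specializable_adjoin_algebraic, rule specializable_adjoin_transcendental, auto)

lemma specializable_Rats: "specializable (range of_rat)"
proof -
  let ?Q = "range (of_rat :: rat \<Rightarrow> complex)"
  have R: "is_subring ?Q"
    unfolding is_subring_def
  proof (intro conjI ballI)
    show "1 \<in> ?Q" by (rule range_eqI[of _ _ 1]) simp
    fix a b :: complex assume "a \<in> ?Q" "b \<in> ?Q"
    then obtain p q where "a = of_rat p" "b = of_rat q" by auto
    hence "a + b = of_rat (p + q)" "a * b = of_rat (p * q)" "- a = of_rat (- p)"
      by (simp_all only: of_rat_add of_rat_mult of_rat_minus)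
    thus "a + b \<in> ?Q" "a * b \<in> ?Q" "- a \<in> ?Q" by (simp_all only: rangeI)
  qed
  have "of_rat q \<in> QC.span {1}" for q
    using QC.span_scale[OF QC.span_base[of 1 "{1}"], of q] by simp
  hence "?Q \<subseteq> QC.span {1}" by blast
  hence fin: "finite_algebra ?Q"
    unfolding finite_algebra_def by (intro conjI R exI[of _ "{1}"] order.refl) simp_all
  have "hom_on ?Q id" unfolding hom_on_def by (simp only: id_apply simp_thms ball_simps)
  hence "\<exists>\<phi> L. finite_algebra L \<and> \<phi> ` ?Q \<subseteq> L \<and> hom_on ?Q \<phi> \<and> \<phi> h \<noteq> 0" if "h \<noteq> 0" for h :: complex
    using fin that by (intro exI[of _ id] exI[of _ ?Q]) (simp only: image_id id_apply order.refl simp_thms)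
  thus ?thesis
    unfolding specializable_def using R by blast
qed

lemma exists_specializable:
  fixes t :: "nat \<Rightarrow> complex"
  shows "\<exists>R. specializable R \<and> (\<forall>i<n. t i \<in> R)"
proof (induction n)
  case 0
  thus ?case using specializable_Rats by auto
next
  case (Suc n)
  then obtain R where R: "specializable R" "\<forall>i<n. t i \<in> R" by auto
  have "is_subring R" using R by (auto simp: specializable_def)
  thus ?case
    using specializable_adjoin[OF R(1), of "t n"] R(2) subset_adjoin[of R "t n"] in_adjoin[of R "t n"]
    by (intro exI[of _ "adjoin R (t n)"]) (auto simp: less_Suc_eq)
qed

lemma hom_on_eval:
  assumes "hom_on R \<phi>" "is_subring R" "\<And>i. t i \<in> R"
  shows "\<phi> (eval t P) = eval (\<lambda>i. \<phi> (t i)) P"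
proof -
  have 1: "(\<Prod>i\<in>A. t i ^ f i) \<in> R" for A :: "nat set" and f
    using assms by (intro is_subring_prod is_subring_power) auto
  have 2: "\<phi> (\<Prod>i\<in>A. t i ^ f i) = (\<Prod>i\<in>A. \<phi> (t i) ^ f i)" for A :: "nat set" and f
    using assms by (subst hom_on_prod[OF assms(1,2)]) (auto simp: hom_on_power is_subring_power)
  show ?thesis
    unfolding eval_def using assms 1
    by (subst hom_on_sum[OF assms(1,2)])
       (auto simp: hom_onD[OF assms(1,2)] hom_on_of_int 2 is_subring_of_int is_subringD)
qed

text \<open>Only finitely many coordinates are non-zero, so one specializable ring contains them
  all. A homomorphism into a number field preserves every relation with integer coefficients, and it
  is chosen so as not to kill \<open>t i\<close>.\<close>

lemma algebraic_specialization:
  fixes t :: "nat \<Rightarrow> complex"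
  assumes "i < n" "t i \<noteq> 0" "\<And>j. j \<ge> n \<Longrightarrow> t j = 0"
  shows "\<exists>s :: nat \<Rightarrow> complex. (\<forall>j. algebraic (s j)) \<and> s i \<noteq> 0 \<and> (\<forall>P. eval t P = 0 \<longrightarrow> eval s P = 0)"
proof -
  obtain R where R: "specializable R" "\<forall>i<n. t i \<in> R" using exists_specializable by blast
  have sub: "is_subring R" using R by (auto simp: specializable_def)
  have tR: "t j \<in> R" for j using R assms(3)[of j] is_subringD(2)[OF sub] by (cases "j < n") auto
  obtain \<phi> L where \<phi>: "finite_algebra L" "\<phi> ` R \<subseteq> L" "hom_on R \<phi>" "\<phi> (t i) \<noteq> 0"
    using R(1) assms(2) tR[of i] unfolding specializable_def by blast
  have "algebraic (\<phi> (t j))" for j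
    using finite_algebra_algebraic[OF \<phi>(1)] \<phi>(2) tR[of j] by blast
  moreover have "eval (\<lambda>j. \<phi> (t j)) P = 0" if "eval t P = 0" for P
    using hom_on_eval[of R \<phi> t P] \<phi>(3) sub tR hom_onD(2)[OF \<phi>(3) sub] that by simp
  ultimately show ?thesis using \<phi>(4) by (intro exI[of _ "\<lambda>j. \<phi> (t j)"]) simp
qed

section \<open>Forms, Euler identity and the gradient\<close>

lemma eval_superset:
  assumes "keys P \<subseteq> A" "finite A"
  shows "eval x P = (\<Sum>m\<in>A. of_int (lookup P m) *
           (\<Prod>i\<in>keys m. x i ^ lookup m i))"
  unfolding eval_def using assms
  by (intro sum.mono_neutral_left) (auto simp: not_in_keys_iff_lookup_eq_zero)

lemma prod_keys_lessThan:
  fixes x :: "nat \<Rightarrow> 'a::comm_ring_1"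
  assumes "keys m \<subseteq> {..<n}"
  shows "(\<Prod>i\<in>keys m. x i ^ lookup m i) = (\<Prod>i<n. x i ^ lookup m i)"
  using assms by (intro prod.mono_neutral_left) (auto simp: in_keys_iff)

lemma eval_lessThan:
  fixes x :: "nat \<Rightarrow> 'a::comm_ring_1"
  assumes "P \<in> int_polys n" "keys P \<subseteq> A" "finite A"
  shows "eval x P = (\<Sum>m\<in>A. of_int (lookup P m) * (\<Prod>i<n. x i ^ lookup m i))"
  unfolding eval_superset[OF assms(2,3)]
proof (intro sum.cong refl)
  fix m
  show "of_int (lookup P m) * (\<Prod>i\<in>keys m. x i ^ lookup m i) =
        of_int (lookup P m) * (\<Prod>i<n. x i ^ lookup m i)"
  proof (cases "m \<in> keys P")
    case True
    thus ?thesis using assms(1) by (subst prod_keys_lessThan) (auto simp: int_polys_def)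
  qed (simp add: not_in_keys_iff_lookup_eq_zero)
qed

lemma eval_keys:
  fixes x :: "nat \<Rightarrow> 'a::comm_ring_1"
  assumes "P \<in> int_polys n"
  shows "eval x P = (\<Sum>m\<in>keys P. of_int (lookup P m) * (\<Prod>i<n. x i ^ lookup m i))"
  by (rule eval_lessThan[OF assms]) auto

lemma eval_cong:
  assumes "P \<in> int_polys n" "\<And>i. i < n \<Longrightarrow> x i = y i"
  shows "eval x P = eval y P"
  unfolding eval_keys[OF assms(1)] using assms(2) by (intro sum.cong arg_cong2[of _ _ _ _ "(*)"] prod.cong) auto

lemma eval_zero [simp]: "eval x 0 = 0"
  by (simp add: eval_def)

lemma eval_add:
  fixes x :: "nat \<Rightarrow> 'a::comm_ring_1"
  shows "eval x (P + Q) = eval x P + eval x Q"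
proof -
  let ?A = "keys P \<union> keys Q"
  have "keys (P + Q) \<subseteq> ?A" by (rule keys_add)
  thus ?thesis
    by (simp add: eval_superset[of _ ?A] lookup_add algebra_simps sum.distrib)
qed

lemma eval_sum: "eval x (sum f A) = (\<Sum>a\<in>A. eval x (f a))"
  by (induction A rule: infinite_finite_induct) (auto simp: eval_add)

lemma eval_single:
  "eval x (single m c) = of_int c * (\<Prod>i\<in>keys m. x i ^ lookup m i)"
  by (subst eval_superset[of _ "{m}"]) auto

lemma keys_minus_single:
  "keys (m - single i (1::nat)) \<subseteq> keys m"
  by (auto simp: in_keys_iff lookup_minus)

lemma eval_partial_deriv:
  fixes x :: "nat \<Rightarrow> 'a::comm_ring_1"
  assumes "P \<in> int_polys n" "i < n"
  shows "eval x (partial_deriv i P) =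
    (\<Sum>m\<in>keys P. of_int (lookup P m) * (of_nat (lookup m i) *
       x i ^ (lookup m i - 1) * (\<Prod>l\<in>{..<n} - {i}. x l ^ lookup m l)))"
  unfolding partial_deriv_def eval_sum
proof (rule sum.cong[OF refl])
  fix m assume m: "m \<in> keys P"
  hence "keys m \<subseteq> {..<n}" using assms by (auto simp: int_polys_def)
  hence k: "keys (m - single i 1) \<subseteq> {..<n}"
    by (rule order.trans[OF keys_minus_single])
  have "(\<Prod>l<n. x l ^ lookup (m - single i 1) l) =
     x i ^ (lookup m i - 1) * (\<Prod>l\<in>{..<n} - {i}. x l ^ lookup m l)"
  proof (subst prod.remove[of _ i])
    show "finite {..<n}" "i \<in> {..<n}" using assms(2) by auto
    have "lookup (m - single i 1) i = lookup m i - 1"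
      by (simp add: lookup_minus)
    moreover have "(\<Prod>l\<in>{..<n} - {i}. x l ^ lookup (m - single i 1) l) =
      (\<Prod>l\<in>{..<n} - {i}. x l ^ lookup m l)"
      by (intro prod.cong refl) (simp add: lookup_minus lookup_single)
    ultimately show "x i ^ lookup (m - single i 1) i *
      (\<Prod>l\<in>{..<n} - {i}. x l ^ lookup (m - single i 1) l) =
      x i ^ (lookup m i - 1) * (\<Prod>l\<in>{..<n} - {i}. x l ^ lookup m l)"
      by (simp only:)
  qed
  thus "eval x (single (m - single i 1)
          (int (lookup m i) * lookup P m)) =
        of_int (lookup P m) * (of_nat (lookup m i) *
       x i ^ (lookup m i - 1) * (\<Prod>l\<in>{..<n} - {i}. x l ^ lookup m l))"
    unfolding eval_single prod_keys_lessThan[OF k] by (simp add: mult_ac del: One_nat_def)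
qed

lemma mon_degree_lessThan:
  assumes "keys m \<subseteq> {..<n}"
  shows "mon_degree m = (\<Sum>l<n. lookup m l)"
  unfolding mon_degree_def
  using assms by (intro sum.mono_neutral_left) (auto simp: in_keys_iff)

lemma form_keysD:
  assumes "F \<in> forms n k" "m \<in> keys F"
  shows "(\<Sum>l<n. lookup m l) = k" "keys m \<subseteq> {..<n}"
proof -
  show "keys m \<subseteq> {..<n}" using assms by (auto simp: forms_def int_polys_def)
  moreover have "mon_degree m = k" using assms by (auto simp: forms_def homogeneous_def)
  ultimately show "(\<Sum>l<n. lookup m l) = k"
    using mon_degree_lessThan[of m n] by simp
qed

lemma form_lookup_le:
  assumes "F \<in> forms n k" "m \<in> keys F" "l < n"
  shows "lookup m l \<le> k"
  using form_keysD(1)[OF assms(1,2)] member_le_sum[of l "{..<n}" "lookup m"] assms(3) by simp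

lemma forms_int_polys: "F \<in> forms n k \<Longrightarrow> F \<in> int_polys n"
  by (simp add: forms_def)

lemma euler_identity:
  fixes x :: "nat \<Rightarrow> 'a::comm_ring_1"
  assumes "F \<in> forms n k"
  shows "(\<Sum>i<n. x i * eval x (partial_deriv i F)) = of_nat k * eval x F"
proof -
  note P = forms_int_polys[OF assms]
  have summand: "x i * (of_nat (lookup m i) *
       x i ^ (lookup m i - 1) * (\<Prod>l\<in>{..<n} - {i}. x l ^ lookup m l))
       = of_nat (lookup m i) * (\<Prod>l<n. x l ^ lookup m l)"
    if "i < n" for i and m :: monomial
  proof (cases "lookup m i")
    case (Suc q)
    have "(\<Prod>l<n. x l ^ lookup m l) = x i ^ Suc q * (\<Prod>l\<in>{..<n} - {i}. x l ^ lookup m l)"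
      using that Suc by (subst prod.remove[of _ i]) auto
    thus ?thesis using Suc by (simp add: algebra_simps)
  qed auto
  have "(\<Sum>i<n. x i * eval x (partial_deriv i F)) =
    (\<Sum>i<n. \<Sum>m\<in>keys F. of_int (lookup F m) *
       (of_nat (lookup m i) * (\<Prod>l<n. x l ^ lookup m l)))"
  proof (rule sum.cong[OF refl])
    fix i assume "i \<in> {..<n}"
    hence i: "i < n" by simp
    show "x i * eval x (partial_deriv i F) = (\<Sum>m\<in>keys F. of_int (lookup F m) *
       (of_nat (lookup m i) * (\<Prod>l<n. x l ^ lookup m l)))"
      unfolding eval_partial_deriv[OF P i] sum_distrib_left summand[OF i, symmetric]
      by (intro sum.cong refl) (simp only: mult.left_commute)
  qed
  also have "\<dots> = (\<Sum>m\<in>keys F. of_int (lookup F m) *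
       (of_nat (\<Sum>i<n. lookup m i) * (\<Prod>l<n. x l ^ lookup m l)))"
    by (subst sum.swap) (simp add: sum_distrib_left sum_distrib_right)
  also have "\<dots> = of_nat k * eval x F"
    unfolding eval_keys[OF P] sum_distrib_left
    by (intro sum.cong refl) (simp add: form_keysD(1)[OF assms] mult.left_commute)
  finally show ?thesis .
qed

lemma eval_scale:
  fixes x :: "nat \<Rightarrow> 'a::comm_ring_1"
  assumes "F \<in> forms n k"
  shows "eval (\<lambda>l. c * x l) F = c ^ k * eval x F"
proof -
  have "(\<Prod>l<n. (c * x l) ^ lookup m l) = c ^ k * (\<Prod>l<n. x l ^ lookup m l)"
    if "m \<in> keys F" for m
    using form_keysD(1)[OF assms that] by (simp add: power_mult_distrib prod.distrib flip: power_sum)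
  thus ?thesis
    unfolding eval_keys[OF forms_int_polys[OF assms]] sum_distrib_left
    by (intro sum.cong refl) (simp add: mult.left_commute)
qed

lemma eval_of_real: "eval (\<lambda>l. of_real (x l)) P = of_real (eval x P)"
  by (simp add: eval_def)

lemma eval_of_int: "eval (\<lambda>l. of_int (x l)) P = of_int (eval x P)"
  by (simp add: eval_def)

lemma partial_deriv_int_polys:
  assumes "P \<in> int_polys n"
  shows "partial_deriv i P \<in> int_polys n"
proof -
  have "keys (partial_deriv i P) \<subseteq>
    (\<Union>m\<in>keys P. keys (single (m - single i 1)
       (int (lookup m i) * lookup P m)))"
    unfolding partial_deriv_def
    by (rule order.trans[OF keys_sum]) auto
  also have "\<dots> \<subseteq> (\<lambda>m. m - single i 1) ` keys P"
    by auto
  finally have sub: "keys (partial_deriv i P) \<subseteq> (\<lambda>m. m - single i 1) ` keys P" .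
  show ?thesis
    unfolding int_polys_def
  proof (rule CollectI, rule ballI)
    fix m assume "m \<in> keys (partial_deriv i P)"
    then obtain m' where m': "m' \<in> keys P" "m = m' - single i 1"
      using sub by blast
    thus "keys m \<subseteq> {..<n}"
      using assms keys_minus_single[of m' i] unfolding int_polys_def by blast
  qed
qed

lemma nonsingular_real:
  fixes t :: "nat \<Rightarrow> real"
  assumes "nonsingular n F" "F \<in> int_polys n" "i < n" "t i \<noteq> 0"
  shows "\<exists>j<n. eval t (partial_deriv j F) \<noteq> 0"
proof (rule ccontr)
  assume "\<not> ?thesis"
  hence z: "eval t (partial_deriv j F) = 0" if "j < n" for j using that by blast
  \<comment> \<open>The coordinates from \<open>n\<close> on are arbitrary reals; they are set to 0
    so that the point lies in a finitely generated ring.\<close>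
  define t' :: "nat \<Rightarrow> complex" where "t' j = (if j < n then of_real (t j) else 0)" for j
  have z': "eval t' (partial_deriv j F) = 0" if "j < n" for j
  proof -
    have "eval t' (partial_deriv j F) = eval (\<lambda>l. complex_of_real (t l)) (partial_deriv j F)"
      by (rule eval_cong[OF partial_deriv_int_polys[OF assms(2)]]) (simp add: t'_def)
    thus ?thesis using z[OF that] by (simp add: eval_of_real)
  qed
  have "\<exists>s :: nat \<Rightarrow> complex. (\<forall>j. algebraic (s j)) \<and> s i \<noteq> 0 \<and> (\<forall>P. eval t' P = 0 \<longrightarrow> eval s P = 0)"
    using assms(3,4) by (intro algebraic_specialization[of i n]) (auto simp: t'_def)
  then obtain s :: "nat \<Rightarrow> complex" where s: "\<forall>j. algebraic (s j)" "s i \<noteq> 0"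
    "\<forall>P. eval t' P = 0 \<longrightarrow> eval s P = 0"
    by (elim exE conjE)
  have "\<exists>j<n. eval s (partial_deriv j F) \<noteq> 0"
    using assms(1,3) s(1,2) unfolding nonsingular_def by metis
  thus False using s(3) z' by metis
qed

section \<open>Compactness on the affine charts\<close>

lemma continuous_on_eval: "continuous_on A (\<lambda>x :: nat \<Rightarrow> real. eval x P)"
  unfolding eval_def
  by (intro continuous_intros continuous_on_subset[OF continuous_on_product_coordinates]) auto

lemma compact_PiE_UNIV:
  fixes S :: "'i \<Rightarrow> 'a::topological_space set"
  assumes "\<And>i. compact (S i)"
  shows "compact (PiE UNIV S)"
proof -
  have "compactin (product_topology (\<lambda>_. euclidean) UNIV) (PiE UNIV S)"
    using assms by (subst compactin_PiE) auto
  thus ?thesis by (simp add: euclidean_product_topology)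
qed

text \<open>On the chart u_j = 1 the derivative in direction \<open>j\<close> is of no use, since
  that coordinate is frozen. It can be left out: where F and all other derivatives vanish, the Euler
  identity makes it vanish too.\<close>

lemma gradient_lower_bound:
  assumes F: "F \<in> forms n k" "nonsingular n F" and j: "j < n"
  shows "\<exists>c>0. \<forall>u :: nat \<Rightarrow> real. u j = 1 \<and> (\<forall>l<n. \<bar>u l\<bar> \<le> 1) \<longrightarrow>
           c \<le> \<bar>eval u F\<bar> \<or> (\<exists>i<n. i \<noteq> j \<and> c \<le> \<bar>eval u (partial_deriv i F)\<bar>)"
proof -
  note P = forms_int_polys[OF F(1)]
  \<comment> \<open>Points are functions on all naturals, so the coordinates outside the chart are
    pinned to 0 to keep the product compact.\<close>
  define S where "S l = (if l = j then {1} else if l < n then {-1..1} else {0::real})" for l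
  define G where "G u = \<bar>eval u F\<bar> + (\<Sum>i\<in>{..<n}-{j}. \<bar>eval u (partial_deriv i F)\<bar>)" for u :: "nat \<Rightarrow> real"
  have "compact (PiE UNIV S)" by (rule compact_PiE_UNIV) (auto simp: S_def)
  moreover have "PiE UNIV S \<noteq> {}" by (simp add: PiE_eq_empty_iff S_def)
  moreover have "continuous_on (PiE UNIV S) G"
    unfolding G_def by (intro continuous_intros continuous_on_eval)
  ultimately obtain v where v: "v \<in> PiE UNIV S" "\<And>u. u \<in> PiE UNIV S \<Longrightarrow> G v \<le> G u"
    using continuous_attains_inf[of "PiE UNIV S" G] by blast
  have vj: "v j = 1" using v(1) by (auto simp: PiE_iff S_def split: if_splits)
  have "G v \<ge> 0" by (auto simp: G_def intro!: add_nonneg_nonneg sum_nonneg)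
  moreover have "G v \<noteq> 0"
  proof
    assume "G v = 0"
    hence z: "eval v F = 0" "\<And>i. i < n \<Longrightarrow> i \<noteq> j \<Longrightarrow> eval v (partial_deriv i F) = 0"
      unfolding G_def by (auto simp: add_nonneg_eq_0_iff sum_nonneg sum_nonneg_eq_0_iff)
    have "(\<Sum>i<n. v i * eval v (partial_deriv i F)) = v j * eval v (partial_deriv j F)"
      using j z(2) by (subst sum.remove[of _ j]) (auto intro!: sum.neutral)
    hence "eval v (partial_deriv j F) = 0"
      using euler_identity[OF F(1), of v] z(1) vj by simp
    hence "eval v (partial_deriv i F) = 0" if "i < n" for i using z(2) that by (cases "i = j") auto
    thus False using nonsingular_real[OF F(2) P j, of v] vj by auto
  qed
  ultimately have pos: "G v > 0" by simp
  \<comment> \<open>\<open>G\<close> is a sum of n terms, |F| and n - 1 derivatives, so one of them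
    is at least G / n.\<close>
  define c where "c = G v / real n"
  have n: "n > 0" using j by simp
  have "c \<le> \<bar>eval u F\<bar> \<or> (\<exists>i<n. i \<noteq> j \<and> c \<le> \<bar>eval u (partial_deriv i F)\<bar>)"
    if u: "u j = 1" "\<forall>l<n. \<bar>u l\<bar> \<le> 1" for u :: "nat \<Rightarrow> real"
  proof (rule ccontr)
    assume neg: "\<not> ?thesis"
    define u' where "u' l = (if l < n then u l else 0)" for l
    have "u' \<in> PiE UNIV S" using u j by (auto simp: PiE_iff S_def u'_def abs_le_iff)
    hence "G v \<le> G u'" by (rule v(2))
    also have "G u' = G u"
      unfolding G_def
      by (intro arg_cong2[of _ _ _ _ "(+)"] sum.cong refl arg_cong[of _ _ abs] eval_cong[OF P]
          eval_cong[OF partial_deriv_int_polys[OF P]]) (auto simp: u'_def)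
    also have "G u < c + (\<Sum>i\<in>{..<n}-{j}. c)"
      unfolding G_def using neg by (intro add_less_le_mono sum_mono) (auto simp: not_le)
    also have "\<dots> = G v" using j by (simp add: c_def of_nat_diff field_simps)
    finally show False by simp
  qed
  moreover have "c > 0" using pos n by (simp add: c_def)
  ultimately show ?thesis by blast
qed

section \<open>Local expansions\<close>

text \<open>A common upper limit \<open>k\<close> for all exponents lets a product of such sums run
  over one box of exponent vectors; the added terms have binomial coefficient 0.\<close>

lemma binomial_ring_bounded:
  fixes z q :: real
  assumes "m \<le> k"
  shows "(z + q) ^ m = (\<Sum>t\<le>k. (of_nat (m choose t) * q ^ (m - t)) * z ^ t)"
proof -
  have "(z + q) ^ m = (\<Sum>t\<le>m. (of_nat (m choose t) * q ^ (m - t)) * z ^ t)"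
    unfolding binomial_ring by (intro sum.cong) (auto simp: mult_ac)
  also have "\<dots> = (\<Sum>t\<le>k. (of_nat (m choose t) * q ^ (m - t)) * z ^ t)"
    using assms by (intro sum.mono_neutral_left) (auto simp: binomial_eq_0)
  finally show ?thesis .
qed

text \<open>Taylor expansion at \<open>p\<close> within the slice where coordinate \<open>j\<close>
  is fixed. Only the constant and linear coefficients are identified, because solving for a
  coordinate divides by a linear one; the others enter through the bound \<open>A\<close>
  alone.\<close>

abbreviation taylor_coeffs :: "nat set \<Rightarrow> nat \<Rightarrow> nat \<Rightarrow> int_mpoly \<Rightarrow> real \<Rightarrow> (nat \<Rightarrow> real) \<Rightarrow> ((nat \<Rightarrow> nat) \<Rightarrow> real) \<Rightarrow> bool" where
  "taylor_coeffs V j k F A p h \<equiv> (\<forall>e\<in>PiE V (\<lambda>_. {..k}). \<bar>h e\<bar> \<le> A) \<and> h (\<lambda>l\<in>V. 0) = eval p F \<and>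
      (\<forall>i\<in>V. h (\<lambda>l\<in>V. if l = i then 1 else 0) = eval p (partial_deriv i F)) \<and>
      (\<forall>u. u j = p j \<longrightarrow> eval u F = (\<Sum>e\<in>PiE V (\<lambda>_. {..k}). h e * (\<Prod>l\<in>V. (u l - p l) ^ e l)))"

lemma taylor_expansion_form:
  assumes F: "F \<in> forms n k" and j: "j < n"
  defines "V \<equiv> {..<n} - {j}"
  shows "\<exists>A\<ge>0. \<forall>p :: nat \<Rightarrow> real. (\<forall>l<n. \<bar>p l\<bar> \<le> 1) \<longrightarrow>
    (\<exists>h. taylor_coeffs V j k F A p h)"
proof -
  note P = forms_int_polys[OF F]
  \<comment> \<open>Each binomial coefficient is at most 2^k, one for every variable of
    \<open>V\<close>, and the powers of the p_l are at most 1. Hence the bound does not depend on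
    \<open>p\<close>.\<close>
  define A where "A = (\<Sum>m\<in>keys F. \<bar>real_of_int (lookup F m)\<bar> * (2 ^ k) ^ card V)"
  have V: "finite V" "insert j V = {..<n}" "j \<notin> V" using j by (auto simp: V_def)
  have prod_n: "(\<Prod>l<n. f l) = f j * (\<Prod>l\<in>V. f l)" for f :: "nat \<Rightarrow> real"
    using V by (metis prod.insert)
  show ?thesis
  proof (intro exI[of _ A] conjI allI impI)
    show "A \<ge> 0" unfolding A_def by (intro sum_nonneg) auto
    fix p :: "nat \<Rightarrow> real" assume p: "\<forall>l<n. \<bar>p l\<bar> \<le> 1"
    define g where "g m e l = of_nat (lookup m l choose e l) * p l ^ (lookup m l - e l)"
      for m :: monomial and e :: "nat \<Rightarrow> nat" and l
    define h where "h e = (\<Sum>m\<in>keys F. of_int (lookup F m) *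
       (p j ^ lookup m j * (\<Prod>l\<in>V. g m e l)))" for e
    have pow: "\<bar>p l\<bar> ^ q \<le> 1" if "l < n" for l q using p that by (simp add: power_le_one)
    have "\<bar>h e\<bar> \<le> A" for e
    proof -
      have "\<bar>h e\<bar> \<le> (\<Sum>m\<in>keys F. \<bar>of_int (lookup F m) *
         (p j ^ lookup m j * (\<Prod>l\<in>V. g m e l))\<bar>)"
        unfolding h_def by (rule sum_abs)
      also have "\<dots> \<le> A"
        unfolding A_def abs_mult
      proof (intro sum_mono mult_left_mono)
        fix m assume m: "m \<in> keys F"
        have "\<bar>g m e l\<bar> \<le> 2 ^ k" if "l \<in> V" for l
        proof -
          have "l < n" using that by (simp add: V_def)
          have "lookup m l choose e l \<le> 2 ^ lookup m l" by (rule binomial_le_pow2)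
          also have "\<dots> \<le> 2 ^ k" using form_lookup_le[OF F m \<open>l < n\<close>] by simp
          finally have "real (lookup m l choose e l) \<le> real (2 ^ k)" by (rule of_nat_mono)
          hence "real (lookup m l choose e l) * \<bar>p l\<bar> ^ (lookup m l - e l) \<le> 2 ^ k * 1"
            using pow[OF \<open>l < n\<close>] by (intro mult_mono) auto
          thus ?thesis by (simp add: g_def abs_mult power_abs)
        qed
        hence "(\<Prod>l\<in>V. \<bar>g m e l\<bar>) \<le> (\<Prod>l\<in>V. 2 ^ k)" by (intro prod_mono) auto
        hence "\<bar>\<Prod>l\<in>V. g m e l\<bar> \<le> (2 ^ k) ^ card V" by (simp add: abs_prod)
        thus "\<bar>p j ^ lookup m j\<bar> * \<bar>\<Prod>l\<in>V. g m e l\<bar> \<le> (2 ^ k) ^ card V"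
          using mult_mono[OF pow[OF j, of "lookup m j"]] by (simp add: power_abs)
      qed simp
      finally show ?thesis .
    qed
    moreover have "h (\<lambda>l\<in>V. 0) = eval p F"
      unfolding h_def eval_keys[OF P]
      by (intro sum.cong refl) (auto simp: g_def prod_n intro!: prod.cong)
    moreover have "h (\<lambda>l\<in>V. if l = i then 1 else 0) = eval p (partial_deriv i F)" if i: "i \<in> V" for i
    proof -
      have i': "i < n" "i \<noteq> j" using i by (auto simp: V_def)
      have 1: "{..<n} - {i} = insert j (V - {i})" "j \<notin> V - {i}" using V i by auto
      have "p j ^ lookup m j * (\<Prod>l\<in>V. g m (\<lambda>l\<in>V. if l = i then 1 else 0) l) =
        of_nat (lookup m i) * p i ^ (lookup m i - 1) *
          (\<Prod>l\<in>{..<n} - {i}. p l ^ lookup m l)" for m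
      proof -
        have "(\<Prod>l\<in>V. g m (\<lambda>l\<in>V. if l = i then 1 else 0) l) =
          g m (\<lambda>l\<in>V. if l = i then 1 else 0) i * (\<Prod>l\<in>V-{i}. g m (\<lambda>l\<in>V. if l = i then 1 else 0) l)"
          by (rule prod.remove[OF V(1) i])
        also have "(\<Prod>l\<in>V-{i}. g m (\<lambda>l\<in>V. if l = i then 1 else 0) l) = (\<Prod>l\<in>V-{i}. p l ^ lookup m l)"
          by (intro prod.cong refl) (auto simp: g_def)
        also have "g m (\<lambda>l\<in>V. if l = i then 1 else 0) i = of_nat (lookup m i) * p i ^ (lookup m i - 1)"
          using i by (simp add: g_def)
        finally have eq: "(\<Prod>l\<in>V. g m (\<lambda>l\<in>V. if l = i then 1 else 0) l) =
          of_nat (lookup m i) * p i ^ (lookup m i - 1) *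
          (\<Prod>l\<in>V-{i}. p l ^ lookup m l)" .
        have "(\<Prod>l\<in>{..<n} - {i}. p l ^ lookup m l) =
          p j ^ lookup m j * (\<Prod>l\<in>V-{i}. p l ^ lookup m l)"
          unfolding 1(1) using V(1) 1(2) by (intro prod.insert) auto
        thus ?thesis unfolding eq by (simp only: mult_ac)
      qed
      thus ?thesis unfolding h_def eval_partial_deriv[OF P i'(1)] by simp
    qed
    moreover have "eval u F = (\<Sum>e\<in>PiE V (\<lambda>_. {..k}). h e * (\<Prod>l\<in>V. (u l - p l) ^ e l))"
      if u: "u j = p j" for u
    proof -
      have mon: "(\<Prod>l<n. u l ^ lookup m l) = (\<Sum>e\<in>PiE V (\<lambda>_. {..k}).
         (p j ^ lookup m j * (\<Prod>l\<in>V. g m e l)) * (\<Prod>l\<in>V. (u l - p l) ^ e l))"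
        if m: "m \<in> keys F" for m
      proof -
        have "(\<Prod>l\<in>V. u l ^ lookup m l) =
          (\<Prod>l\<in>V. \<Sum>t\<le>k. (of_nat (lookup m l choose t) * p l ^ (lookup m l - t)) * (u l - p l) ^ t)"
        proof (intro prod.cong refl)
          fix l assume "l \<in> V"
          hence "lookup m l \<le> k" using form_lookup_le[OF F m] by (simp add: V_def)
          from binomial_ring_bounded[OF this, of "u l - p l" "p l"]
          show "u l ^ lookup m l = (\<Sum>t\<le>k. (of_nat (lookup m l choose t) * p l ^ (lookup m l - t)) * (u l - p l) ^ t)"
            by simp
        qed
        also have "\<dots> = (\<Sum>e\<in>PiE V (\<lambda>_. {..k}). \<Prod>l\<in>V. g m e l * (u l - p l) ^ e l)"
          unfolding g_def by (rule prod_sum_PiE) (auto simp: V(1))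
        finally show ?thesis
          unfolding prod_n u by (simp add: prod.distrib sum_distrib_left mult.assoc)
      qed
      have "eval u F = (\<Sum>m\<in>keys F. \<Sum>e\<in>PiE V (\<lambda>_. {..k}). of_int (lookup F m) *
         (p j ^ lookup m j * (\<Prod>l\<in>V. g m e l)) * (\<Prod>l\<in>V. (u l - p l) ^ e l))"
        unfolding eval_keys[OF P] by (intro sum.cong refl) (simp add: mon sum_distrib_left mult.assoc)
      also have "\<dots> = (\<Sum>e\<in>PiE V (\<lambda>_. {..k}). h e * (\<Prod>l\<in>V. (u l - p l) ^ e l))"
        unfolding h_def by (subst sum.swap) (simp add: sum_distrib_right)
      finally show ?thesis .
    qed
    ultimately show "\<exists>h. taylor_coeffs V j k F A p h"
      by (intro exI[of _ h]) simp
  qed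
qed

section \<open>Monomials in local coordinates and the elimination of one coordinate\<close>

definition mon_val :: "'i set \<Rightarrow> ('i \<Rightarrow> nat) \<Rightarrow> ('i \<Rightarrow> real) \<Rightarrow> real" where
  "mon_val V e z = (\<Prod>l\<in>V. z l ^ e l)"

lemma mon_val_add: "mon_val V (\<lambda>l. e l + g l) z = mon_val V e z * mon_val V g z"
  by (simp add: mon_val_def power_add prod.distrib)

lemma mon_val_cong: "(\<And>l. l \<in> V \<Longrightarrow> e l = e' l) \<Longrightarrow> (\<And>l. l \<in> V \<Longrightarrow> z l = z' l) \<Longrightarrow> mon_val V e z = mon_val V e' z'"
  by (simp add: mon_val_def)

lemma mon_val_bound:
  assumes "\<And>l. l \<in> V \<Longrightarrow> \<bar>z l\<bar> \<le> C * s l" "\<And>l. l \<in> V \<Longrightarrow> 0 \<le> C * s l"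
  shows "\<bar>mon_val V e z\<bar> \<le> C ^ (\<Sum>l\<in>V. e l) * (\<Prod>l\<in>V. s l ^ e l)"
proof -
  have "\<bar>mon_val V e z\<bar> = (\<Prod>l\<in>V. \<bar>z l\<bar> ^ e l)"
    by (simp add: mon_val_def abs_prod power_abs)
  also have "\<dots> \<le> (\<Prod>l\<in>V. (C * s l) ^ e l)"
    using assms by (intro prod_mono conjI power_mono) auto
  also have "\<dots> = C ^ (\<Sum>l\<in>V. e l) * (\<Prod>l\<in>V. s l ^ e l)"
    by (simp add: power_mult_distrib prod.distrib power_sum)
  finally show ?thesis .
qed

text \<open>Eliminating the coordinate \<open>i\<close>: it satisfies a relation \<open>z\<^sub>i = \<Sum> h\<^sub>g z\<^sup>g\<close> all of whose terms
  either have order at least \<open>2\<close> or do not involve \<open>z\<^sub>i\<close>. Substituting it into a monomial raises the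
  order or lowers the exponent of \<open>z\<^sub>i\<close>, so this replaces the implicit function theorem.\<close>

lemma eliminate_coordinate:
  fixes V :: "'i set" and ex :: "'g \<Rightarrow> 'i \<Rightarrow> nat" and C A :: real and N :: nat
  assumes V: "finite V" "i \<in> V" and G: "finite G"
    "\<And>g. g \<in> G \<Longrightarrow> 2 \<le> (\<Sum>l\<in>V. ex g l) \<or> ((\<Sum>l\<in>V. ex g l) = 1 \<and> ex g i = 0)"
    and pos: "C \<ge> 0" "A \<ge> 0"
  defines "I \<equiv> PiE (V - {i}) (\<lambda>_. {..<N})"
  shows "\<exists>K\<ge>0. \<forall>X r h. 0 < r \<and> r \<le> 1 \<and> (\<forall>z\<in>X. \<forall>l\<in>V. \<bar>z l\<bar> \<le> C * r) \<and> (\<forall>g\<in>G. \<bar>h g\<bar> \<le> A) \<and>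
     (\<forall>z\<in>X. z i = (\<Sum>g\<in>G. h g * mon_val V (ex g) z)) \<longrightarrow>
     (\<exists>c. (\<forall>e'\<in>I. \<bar>c e'\<bar> \<le> K) \<and>
        (\<forall>z\<in>X. \<bar>mon_val V e z - (\<Sum>e'\<in>I. c e' * mon_val (V - {i}) e' z)\<bar> \<le> K * r ^ N))"
    (is "\<exists>K\<ge>0. ?P e K")
\<comment> \<open>Lexicographic descent: first the order of the monomial approaches
  \<open>N\<close>, then the exponent of z_i falls. The constant \<open>K\<close> is produced before
  \<open>X\<close>, \<open>r\<close> and \<open>h\<close> are given, so it is uniform in
  them.\<close>
proof (induction e rule: wf_induct_rule[OF wf_measures, of "[\<lambda>e. N - (\<Sum>l\<in>V. e l), \<lambda>e. e i]"])
  case (1 e)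
  let ?hyp = "\<lambda>X r h. 0 < r \<and> r \<le> 1 \<and> (\<forall>z\<in>X. \<forall>l\<in>V. \<bar>z l\<bar> \<le> C * r) \<and> (\<forall>g\<in>G. \<bar>h g\<bar> \<le> A) \<and>
        (\<forall>z\<in>X. z i = (\<Sum>g\<in>G. h g * mon_val V (ex g) z))"
  let ?concl = "\<lambda>e K X r. \<exists>c. (\<forall>e'\<in>I. \<bar>c e'\<bar> \<le> K) \<and>
          (\<forall>z\<in>X. \<bar>mon_val V e z - (\<Sum>e'\<in>I. c e' * mon_val (V - {i}) e' z)\<bar> \<le> K * r ^ N)"
  have I: "finite I" using V by (auto simp: I_def intro!: finite_PiE)
  \<comment> \<open>Order at least \<open>N\<close> is swallowed by the error term; a monomial free
    of z_i is already of the target form; otherwise one factor z_i is replaced by its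
    relation.\<close>
  consider "N \<le> (\<Sum>l\<in>V. e l)" | "(\<Sum>l\<in>V. e l) < N" "e i = 0" | "(\<Sum>l\<in>V. e l) < N" "e i > 0"
    by linarith
  thus ?case
  proof cases
    case 1
    let ?s = "\<Sum>l\<in>V. e l"
    show ?thesis
    proof (intro exI[of _ "C ^ ?s"] conjI allI impI)
      show "0 \<le> C ^ ?s" using pos by simp
      fix X :: "('i \<Rightarrow> real) set" and r :: real and h :: "'g \<Rightarrow> real"
      assume *: "?hyp X r h"
      have "\<bar>mon_val V e z\<bar> \<le> C ^ ?s * r ^ N" if "z \<in> X" for z
      proof -
        have "\<bar>mon_val V e z\<bar> \<le> C ^ ?s * (\<Prod>l\<in>V. r ^ e l)"
          using * that pos by (intro mon_val_bound) auto
        also have "(\<Prod>l\<in>V. r ^ e l) = r ^ ?s" by (simp add: power_sum)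
        also have "C ^ ?s * r ^ ?s \<le> C ^ ?s * r ^ N"
          using * pos 1 by (intro mult_left_mono power_decreasing) auto
        finally show ?thesis .
      qed
      thus "?concl e (C ^ ?s) X r"
        using pos by (intro exI[of _ "\<lambda>_. 0"]) simp
    qed
  next
    case 2
    \<comment> \<open>Members of \<open>I\<close> are extensional on \<open>V - {i}\<close>, so the
      exponent vector must be restricted to become one of them.\<close>
    let ?e = "restrict e (V - {i})"
    have "e l < N" if "l \<in> V" for l
      using 2(1) member_le_sum[OF that, of e] V(1) by simp
    hence eI: "?e \<in> I" unfolding I_def by (intro restrict_PiE_iff[THEN iffD2]) simp
    have eq: "mon_val V e z = mon_val (V - {i}) ?e z" for z
    proof -
      have "mon_val V e z = z i ^ e i * (\<Prod>l\<in>V-{i}. z l ^ e l)"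
        unfolding mon_val_def by (rule prod.remove[OF V])
      thus ?thesis using 2(2) by (simp add: mon_val_def)
    qed
    show ?thesis
    proof (intro exI[of _ 1] conjI allI impI)
      show "0 \<le> (1::real)" by simp
      fix X :: "('i \<Rightarrow> real) set" and r :: real and h :: "'g \<Rightarrow> real"
      assume *: "?hyp X r h"
      have "(\<Sum>e'\<in>I. (if e' = ?e then 1 else 0) * mon_val (V - {i}) e' z) = mon_val V e z" for z
        unfolding eq using I eI by (simp add: if_distrib[of "\<lambda>x. x * _"] cong: if_cong)
      thus "?concl e 1 X r"
        using * by (intro exI[of _ "\<lambda>e'. if e' = ?e then 1 else 0"]) auto
    qed
  next
    case 3
    \<comment> \<open>\<open>e0\<close> is what remains after one factor z_i is taken out;
      \<open>next_e g\<close> is the exponent vector after the term \<open>g\<close> of the relation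
      is put in its place.\<close>
    define e0 where "e0 = e(i := e i - 1)"
    define next_e where "next_e g = (\<lambda>l. e0 l + ex g l)" for g
    have sum0: "(\<Sum>l\<in>V. e l) = Suc (\<Sum>l\<in>V. e0 l)"
      using 3(2) V by (simp add: sum.remove[OF V] e0_def)
    have mon0: "mon_val V e z = z i * mon_val V e0 z" for z
    proof -
      have "z i ^ e i = z i * z i ^ (e i - 1)" using 3(2) by (cases "e i") auto
      thus ?thesis using V by (simp add: mon_val_def prod.remove[OF V] e0_def)
    qed
    have "\<exists>K\<ge>0. ?P (next_e g) K" if g: "g \<in> G" for g
    proof (rule "1.IH")
      have s: "(\<Sum>l\<in>V. next_e g l) = (\<Sum>l\<in>V. e0 l) + (\<Sum>l\<in>V. ex g l)"
        by (simp add: next_e_def sum.distrib)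
      from G(2)[OF g] show "(next_e g, e) \<in> measures [\<lambda>e. N - (\<Sum>l\<in>V. e l), \<lambda>e. e i]"
      proof
        assume "2 \<le> (\<Sum>l\<in>V. ex g l)"
        hence "(\<Sum>l\<in>V. next_e g l) > (\<Sum>l\<in>V. e l)" using s sum0 by simp
        hence "N - (\<Sum>l\<in>V. next_e g l) < N - (\<Sum>l\<in>V. e l)" using 3(1) by linarith
        thus ?thesis by simp
      next
        assume a: "(\<Sum>l\<in>V. ex g l) = 1 \<and> ex g i = 0"
        hence "(\<Sum>l\<in>V. next_e g l) = (\<Sum>l\<in>V. e l)" using s sum0 by simp
        moreover have "next_e g i < e i" using a 3(2) by (simp add: next_e_def e0_def)
        ultimately show ?thesis by simp
      qed
    qed
    hence "\<forall>g\<in>G. \<exists>K. K \<ge> 0 \<and> ?P (next_e g) K" by (rule ballI)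
    from bchoice[OF this] obtain K where K': "\<forall>g\<in>G. K g \<ge> 0 \<and> ?P (next_e g) (K g)" by (elim exE)
    have K: "K g \<ge> 0" "?P (next_e g) (K g)" if "g \<in> G" for g
      using bspec[OF K' that] by (rule conjunct1, rule conjunct2)
    let ?K = "\<Sum>g\<in>G. A * K g"
    show ?thesis
    proof (intro exI[of _ ?K] conjI allI impI)
      show "0 \<le> ?K" using pos K by (intro sum_nonneg) auto
      fix X :: "('i \<Rightarrow> real) set" and r :: real and h :: "'g \<Rightarrow> real"
      assume *: "?hyp X r h"
      have "?concl (next_e g) (K g) X r"
        if "g \<in> G" for g
        using K(2)[OF that, rule_format, OF *] .
      hence "\<forall>g\<in>G. ?concl (next_e g) (K g) X r"
        by (rule ballI)
      from bchoice[OF this] obtain c where c: "\<And>g e'. g \<in> G \<Longrightarrow> e' \<in> I \<Longrightarrow> \<bar>c g e'\<bar> \<le> K g"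
        "\<And>g z. g \<in> G \<Longrightarrow> z \<in> X \<Longrightarrow> \<bar>mon_val V (next_e g) z - (\<Sum>e'\<in>I. c g e' * mon_val (V - {i}) e' z)\<bar> \<le> K g * r ^ N"
        by blast
      define c' where "c' e' = (\<Sum>g\<in>G. h g * c g e')" for e'
      have "\<bar>c' e'\<bar> \<le> ?K" if "e' \<in> I" for e'
        unfolding c'_def using * c(1)[OF _ that]
        by (intro order.trans[OF sum_abs] sum_mono) (auto simp: abs_mult intro!: mult_mono pos)
      moreover have "\<bar>mon_val V e z - (\<Sum>e'\<in>I. c' e' * mon_val (V - {i}) e' z)\<bar> \<le> ?K * r ^ N"
        if z: "z \<in> X" for z
      proof -
        have zi: "z i = (\<Sum>g\<in>G. h g * mon_val V (ex g) z)" using * z by blast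
        have "mon_val V e z = (\<Sum>g\<in>G. h g * mon_val V (next_e g) z)"
          unfolding mon0 zi sum_distrib_right next_e_def mon_val_add by (simp add: mult_ac)
        moreover have "(\<Sum>e'\<in>I. c' e' * mon_val (V - {i}) e' z) =
          (\<Sum>g\<in>G. h g * (\<Sum>e'\<in>I. c g e' * mon_val (V - {i}) e' z))"
          unfolding c'_def sum_distrib_right sum_distrib_left by (subst sum.swap) (simp add: mult_ac)
        ultimately have "mon_val V e z - (\<Sum>e'\<in>I. c' e' * mon_val (V - {i}) e' z) =
          (\<Sum>g\<in>G. h g * (mon_val V (next_e g) z - (\<Sum>e'\<in>I. c g e' * mon_val (V - {i}) e' z)))"
          by (simp add: right_diff_distrib sum_subtractf)
        also have "\<bar>\<dots>\<bar> \<le> (\<Sum>g\<in>G. A * (K g * r ^ N))"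
          using * c(2)[OF _ z]
          by (intro order.trans[OF sum_abs] sum_mono) (auto simp: abs_mult intro!: mult_mono pos)
        finally show ?thesis by (simp add: sum_distrib_right mult.assoc)
      qed
      ultimately show "?concl e ?K X r"
        by blast
    qed
  qed
qed

text \<open>The dichotomy that permits solving for z_i: each remaining term either contains another
  coordinate or is at least quadratic in z_i.\<close>

lemma exponent_cases:
  assumes "e \<in> PiE V (\<lambda>_. {..k::nat})" "e \<noteq> (\<lambda>l\<in>V. 0)" "e \<noteq> (\<lambda>l\<in>V. if l = i then 1 else 0)" "i \<in> V"
  shows "(\<exists>l\<in>V - {i}. e l > 0) \<or> e i \<ge> 2"
proof (rule ccontr)
  assume neg: "\<not> ?thesis"
  hence z: "e l = 0" if "l \<in> V" "l \<noteq> i" for l using that by auto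
  have outside: "e l = undefined" if "l \<notin> V" for l using assms(1) that by (auto simp: PiE_iff extensional_def)
  have "e i = 0 \<or> e i = 1" using neg by auto
  thus False
  proof
    assume "e i = 0"
    hence "e = (\<lambda>l\<in>V. 0)" using z outside by (intro ext) (metis restrict_apply)
    thus False using assms by simp
  next
    assume "e i = 1"
    hence "e = (\<lambda>l\<in>V. if l = i then 1 else 0)" using z outside by (intro ext) (simp add: restrict_def)
    thus False using assms by simp
  qed
qed

lemma mon_val_delta:
  assumes "finite V" "i \<in> V"
  shows "mon_val V (\<lambda>l\<in>V. if l = i then 1 else 0) z = z i"
proof -
  have "mon_val V (\<lambda>l\<in>V. if l = i then 1 else 0) z = (\<Prod>l\<in>V. if l = i then z l else 1)"
    unfolding mon_val_def by (intro prod.cong) auto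
  thus ?thesis using assms by (simp add: prod.delta)
qed

lemma mon_val_zero: "mon_val V (\<lambda>l\<in>V. 0) z = 1"
  by (simp add: mon_val_def)

text \<open>\<open>Higher\<close> is relative to solving for coordinate \<open>i\<close>: linear
  exponents in the other coordinates remain in this set.\<close>

definition higher_exps :: "nat set \<Rightarrow> nat \<Rightarrow> nat \<Rightarrow> (nat \<Rightarrow> nat) set" where
  "higher_exps V i k = PiE V (\<lambda>_. {..k}) - {\<lambda>l\<in>V. 0, \<lambda>l\<in>V. if l = i then 1 else 0}"

lemma finite_higher_exps: "finite V \<Longrightarrow> finite (higher_exps V i k)"
  unfolding higher_exps_def by (intro finite_Diff finite_PiE) auto

abbreviation split_coeffs :: "nat set \<Rightarrow> nat \<Rightarrow> nat \<Rightarrow> nat \<Rightarrow> int_mpoly \<Rightarrow> real \<Rightarrow> (nat \<Rightarrow> real) \<Rightarrow> ((nat \<Rightarrow> nat) \<Rightarrow> real) \<Rightarrow> bool" where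
  "split_coeffs V i j k F A p h \<equiv> (\<forall>e\<in>higher_exps V i k. \<bar>h e\<bar> \<le> A) \<and>
      (\<forall>u. u j = p j \<longrightarrow> eval u F - eval p F = eval p (partial_deriv i F) * (u i - p i) +
        (\<Sum>e\<in>higher_exps V i k. h e * mon_val V e (\<lambda>l. u l - p l)))"

lemma taylor_split:
  assumes F: "F \<in> forms n k" "k > 0" and ij: "i < n" "j < n" "i \<noteq> j"
  defines "V \<equiv> {..<n} - {j}"
  shows "\<exists>A\<ge>0. \<forall>p :: nat \<Rightarrow> real. (\<forall>l<n. \<bar>p l\<bar> \<le> 1) \<longrightarrow>
    (\<exists>h. split_coeffs V i j k F A p h)"
proof -
  have V: "finite V" "i \<in> V" using ij by (auto simp: V_def)
  obtain A where A: "A \<ge> 0" "\<forall>p :: nat \<Rightarrow> real. (\<forall>l<n. \<bar>p l\<bar> \<le> 1) \<longrightarrow>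
    (\<exists>h. taylor_coeffs V j k F A p h)"
    using taylor_expansion_form[OF F(1) ij(2)] unfolding V_def by blast
  let ?E = "PiE V (\<lambda>_. {..k})" and ?o = "\<lambda>l\<in>V. 0::nat" and ?d = "\<lambda>l\<in>V. if l = i then 1 else 0::nat"
  \<comment> \<open>\<open>k > 0\<close> puts the unit exponent vector inside the box, so it can be
    split off.\<close>
  have E: "finite ?E" "?o \<in> ?E" "?d \<in> ?E" "?o \<noteq> ?d" using V F(2) by (auto simp: fun_eq_iff intro!: finite_PiE)
  show ?thesis
  proof (intro exI[of _ A] conjI A(1) allI impI)
    fix p :: "nat \<Rightarrow> real" assume "\<forall>l<n. \<bar>p l\<bar> \<le> 1"
    then obtain h where h: "\<forall>e\<in>?E. \<bar>h e\<bar> \<le> A" "h ?o = eval p F" "\<forall>i\<in>V. h (\<lambda>l\<in>V. if l = i then 1 else 0) = eval p (partial_deriv i F)"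
      "\<forall>u. u j = p j \<longrightarrow> eval u F = (\<Sum>e\<in>?E. h e * (\<Prod>l\<in>V. (u l - p l) ^ e l))"
      using A(2) by blast
    have "eval u F - eval p F = eval p (partial_deriv i F) * (u i - p i) +
        (\<Sum>e\<in>higher_exps V i k. h e * mon_val V e (\<lambda>l. u l - p l))" if "u j = p j" for u
    proof -
      let ?f = "\<lambda>e. h e * mon_val V e (\<lambda>l. u l - p l)"
      have "eval u F = sum ?f ?E" using h(4) that by (simp add: mon_val_def)
      also have "\<dots> = ?f ?o + sum ?f (?E - {?o})" by (rule sum.remove[OF E(1,2)])
      also have "sum ?f (?E - {?o}) = ?f ?d + sum ?f (?E - {?o} - {?d})"
        using E by (intro sum.remove) auto
      also have "?E - {?o} - {?d} = higher_exps V i k" unfolding higher_exps_def by blast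
      also have "?f ?o = eval p F" by (simp add: mon_val_zero h(2))
      also have "?f ?d = eval p (partial_deriv i F) * (u i - p i)"
        using h(3) V by (simp only: mon_val_delta[OF V])
      finally show ?thesis by simp
    qed
    moreover have "\<forall>e\<in>higher_exps V i k. \<bar>h e\<bar> \<le> A" using h(1) by (auto simp: higher_exps_def)
    ultimately show "\<exists>h. split_coeffs V i j k F A p h"
      by blast
  qed
qed

lemma mon_val_le_factor:
  assumes "finite V" "l \<in> V" "\<And>l. l \<in> V \<Longrightarrow> \<bar>z l\<bar> \<le> 1" "q \<le> e l"
  shows "\<bar>mon_val V e z\<bar> \<le> \<bar>z l\<bar> ^ q"
proof -
  have "\<bar>mon_val V e z\<bar> = \<bar>z l\<bar> ^ e l * (\<Prod>l\<in>V - {l}. \<bar>z l\<bar> ^ e l)"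
    unfolding mon_val_def abs_prod power_abs by (rule prod.remove[OF assms(1,2)])
  also have "\<dots> \<le> \<bar>z l\<bar> ^ q * 1"
    using assms by (intro mult_mono power_decreasing prod_le_1) (auto simp: power_le_one prod_nonneg)
  finally show ?thesis by simp
qed

text \<open>A quantitative substitute for the implicit function theorem. With s = |u_i - p_i|, the
  terms other than the linear one in u_i contribute at most M (r + r0 s), and for small r0 the part
  M r0 s is absorbed by the linear term of size at least c s. The a priori bound s \<le>
  \<open>r0\<close> keeps \<open>u\<close> on the same local branch as \<open>p\<close>.\<close>

lemma dependent_coordinate_bound:
  assumes F: "F \<in> forms n k" "k > 0" and ij: "i < n" "j < n" "i \<noteq> j" and c: "c > 0" and C: "C \<ge> 0"
  shows "\<exists>r0 C'. 0 < r0 \<and> r0 \<le> 1 \<and> 1 \<le> C' \<and>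
    (\<forall>(p :: nat \<Rightarrow> real) u r. (\<forall>l<n. \<bar>p l\<bar> \<le> 1) \<and> c \<le> \<bar>eval p (partial_deriv i F)\<bar> \<and> u j = p j \<and> 0 < r \<and>
      (\<forall>l<n. l \<noteq> i \<longrightarrow> \<bar>u l - p l\<bar> \<le> r) \<and> \<bar>u i - p i\<bar> \<le> r0 \<and> \<bar>eval u F - eval p F\<bar> \<le> C * r \<longrightarrow>
      \<bar>u i - p i\<bar> \<le> C' * r)"
proof -
  define V where "V = {..<n} - {j}"
  have V: "finite V" "i \<in> V" using ij by (auto simp: V_def)
  obtain A where A: "A \<ge> 0" "\<forall>p :: nat \<Rightarrow> real. (\<forall>l<n. \<bar>p l\<bar> \<le> 1) \<longrightarrow>
    (\<exists>h. split_coeffs V i j k F A p h)"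
    using taylor_split[OF F ij] unfolding V_def by blast
  define M where "M = real (card (higher_exps V i k)) * A"
  have M: "M \<ge> 0" using A by (simp add: M_def)
  \<comment> \<open>Chosen so that M r0 \<le> c / 2, with M + 1 in the denominator because M may be
    0.\<close>
  define r0 where "r0 = min 1 (c / (2 * (M + 1)))"
  \<comment> \<open>Solves c s \<le> C r + M r + (c / 2) s for s; the maximum with 1 serves the
    trivial case s \<le> r.\<close>
  define C' where "C' = max 1 (2 * (C + M) / c)"
  have r0: "0 < r0" "r0 \<le> 1" "M * r0 \<le> c / 2"
  proof -
    show "0 < r0" "r0 \<le> 1" using c M by (auto simp: r0_def)
    have "M * r0 \<le> (M + 1) * (c / (2 * (M + 1)))"
      using M c by (intro mult_mono) (auto simp: r0_def)
    also have "\<dots> = c / 2" using M by (simp add: field_simps)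
    finally show "M * r0 \<le> c / 2" .
  qed
  show ?thesis
  proof (rule exI[of _ r0], rule exI[of _ C'], intro conjI r0 allI impI)
    show "1 \<le> C'" by (simp add: C'_def)
    fix p u :: "nat \<Rightarrow> real" and r :: real
    assume hyp: "(\<forall>l<n. \<bar>p l\<bar> \<le> 1) \<and> c \<le> \<bar>eval p (partial_deriv i F)\<bar> \<and> u j = p j \<and> 0 < r \<and>
      (\<forall>l<n. l \<noteq> i \<longrightarrow> \<bar>u l - p l\<bar> \<le> r) \<and> \<bar>u i - p i\<bar> \<le> r0 \<and> \<bar>eval u F - eval p F\<bar> \<le> C * r"
    let ?s = "\<bar>u i - p i\<bar>" and ?z = "\<lambda>l. u l - p l"
    show "?s \<le> C' * r"
    \<comment> \<open>In the remaining case r < s \<le> r0 \<le> 1, so all displacements are at most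
      1 and a monomial is bounded by any of its factors.\<close>
    proof (cases "?s \<le> r")
      case True
      also have "r \<le> C' * r" using hyp \<open>1 \<le> C'\<close> by simp
      finally show ?thesis .
    next
      case False
      have r1: "r \<le> 1" using False hyp r0 by linarith
      have z1: "\<bar>?z l\<bar> \<le> 1" if "l \<in> V" for l
      proof -
        have "\<bar>?z l\<bar> \<le> max r r0" using that hyp by (cases "l = i") (auto simp: V_def le_max_iff_disj)
        thus ?thesis using r1 r0 by linarith
      qed
      obtain h where h: "\<forall>e\<in>higher_exps V i k. \<bar>h e\<bar> \<le> A"
        "\<forall>u. u j = p j \<longrightarrow> eval u F - eval p F = eval p (partial_deriv i F) * (u i - p i) +
        (\<Sum>e\<in>higher_exps V i k. h e * mon_val V e (\<lambda>l. u l - p l))"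
        using A(2) hyp by blast
      have mon: "\<bar>mon_val V e ?z\<bar> \<le> r + r0 * ?s" if e: "e \<in> higher_exps V i k" for e
      proof -
        have "(\<exists>l\<in>V - {i}. e l > 0) \<or> e i \<ge> 2"
          using e exponent_cases[of e V k i] V(2) unfolding higher_exps_def by blast
        thus ?thesis
        proof
          assume "\<exists>l\<in>V - {i}. e l > 0"
          then obtain l where l: "l \<in> V" "l \<noteq> i" "e l > 0" by auto
          have "\<bar>mon_val V e ?z\<bar> \<le> \<bar>?z l\<bar> ^ 1"
            using l V z1 by (intro mon_val_le_factor[of V l ?z 1 e]) auto
          moreover have "\<bar>?z l\<bar> \<le> r" using l hyp by (auto simp: V_def)
          moreover have "r0 * ?s \<ge> 0" using r0 by simp
          ultimately show ?thesis by simp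
        next
          assume "e i \<ge> 2"
          hence "\<bar>mon_val V e ?z\<bar> \<le> ?s ^ 2"
            using V z1 by (intro mon_val_le_factor[of V i ?z 2 e]) auto
          also have "\<dots> \<le> r0 * ?s" using hyp unfolding power2_eq_square by (intro mult_right_mono) auto
          finally show ?thesis using hyp by linarith
        qed
      qed
      have "\<bar>\<Sum>e\<in>higher_exps V i k. h e * mon_val V e ?z\<bar> \<le> (\<Sum>e\<in>higher_exps V i k. A * (r + r0 * ?s))"
        using h(1) mon A(1) by (intro order.trans[OF sum_abs] sum_mono) (auto simp: abs_mult intro!: mult_mono)
      also have "\<dots> = M * r + M * r0 * ?s" by (simp add: M_def algebra_simps)
      also have "\<dots> \<le> M * r + c / 2 * ?s" using r0(3) by (intro add_left_mono mult_right_mono) auto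
      finally have rest: "\<bar>\<Sum>e\<in>higher_exps V i k. h e * mon_val V e ?z\<bar> \<le> M * r + c / 2 * ?s" .
      have eq: "eval u F - eval p F = eval p (partial_deriv i F) * (u i - p i) +
        (\<Sum>e\<in>higher_exps V i k. h e * mon_val V e ?z)" using h(2) hyp by blast
      have "c * ?s \<le> \<bar>eval p (partial_deriv i F) * (u i - p i)\<bar>"
        unfolding abs_mult using hyp by (intro mult_right_mono) auto
      also have "\<dots> \<le> C * r + (M * r + c / 2 * ?s)" using eq rest hyp by linarith
      finally have "c * ?s \<le> 2 * (C + M) * r" by (simp add: algebra_simps)
      hence "?s \<le> 2 * (C + M) / c * r" using c by (simp add: field_simps)
      also have "\<dots> \<le> C' * r" using hyp by (intro mult_right_mono) (auto simp: C'_def)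
      finally show ?thesis .
    qed
  qed
qed

definition local_coords :: "nat \<Rightarrow> int_mpoly \<Rightarrow> (nat \<Rightarrow> real) \<Rightarrow> (nat \<Rightarrow> real) \<Rightarrow> nat \<Rightarrow> real" where
  "local_coords n F p u = (\<lambda>l. u l - p l)(n := eval u F - eval p F)"

text \<open>Near a point where \<open>\<partial>\<^sub>i F \<noteq> 0\<close>, the value of \<open>F\<close> can serve as a coordinate in place of \<open>x\<^sub>i\<close>;
  it carries the index \<open>n\<close>.\<close>

lemma local_expansion:
  fixes N :: nat
  assumes F: "F \<in> forms n k" "k > 0" and P: "P \<in> forms n D" and ij: "i < n" "j < n" "i \<noteq> j"
    and c: "c > 0" and C: "C \<ge> 0"
  defines "W \<equiv> insert n ({..<n} - {i, j})"
  defines "I \<equiv> PiE W (\<lambda>_. {..<N})"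
  shows "\<exists>K\<ge>0. \<forall>(p :: nat \<Rightarrow> real) X r. (\<forall>l<n. \<bar>p l\<bar> \<le> 1) \<and> c \<le> \<bar>eval p (partial_deriv i F)\<bar> \<and> 0 < r \<and> r \<le> 1 \<and>
    (\<forall>u\<in>X. u j = p j \<and> (\<forall>l<n. \<bar>u l - p l\<bar> \<le> C * r) \<and> \<bar>eval u F - eval p F\<bar> \<le> C * r) \<longrightarrow>
    (\<exists>b. (\<forall>e\<in>I. \<bar>b e\<bar> \<le> K) \<and>
       (\<forall>u\<in>X. \<bar>eval u P - (\<Sum>e\<in>I. b e * mon_val W e (local_coords n F p u))\<bar> \<le> K * r ^ N))"
proof -
  define V where "V = {..<n} - {j}"
  \<comment> \<open>\<open>n\<close> is a fresh index for the displacement of F. Replacing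
    \<open>i\<close> by \<open>n\<close> turns \<open>V\<close> into \<open>W\<close>.\<close>
  define V' where "V' = insert n V"
  have V: "finite V" "i \<in> V" "n \<notin> V" using ij by (auto simp: V_def)
  have V': "finite V'" "i \<in> V'" "V' - {i} = W" using V ij by (auto simp: V'_def W_def V_def)
  have finI: "finite I" using V' by (auto simp: I_def W_def intro!: finite_PiE)
  let ?H = "higher_exps V i k"
  obtain A where A: "A \<ge> 0" "\<forall>p :: nat \<Rightarrow> real. (\<forall>l<n. \<bar>p l\<bar> \<le> 1) \<longrightarrow>
    (\<exists>h. split_coeffs V i j k F A p h)"
    using taylor_split[OF F ij] unfolding V_def by blast
  obtain AP where AP: "AP \<ge> 0" "\<forall>p :: nat \<Rightarrow> real. (\<forall>l<n. \<bar>p l\<bar> \<le> 1) \<longrightarrow>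
    (\<exists>h. taylor_coeffs V j D P AP p h)"
    using taylor_expansion_form[OF P ij(2)] unfolding V_def by blast
  let ?E = "PiE V (\<lambda>_. {..D})"
  have finE: "finite ?E" using V by (intro finite_PiE) auto
  have mon_ext: "mon_val V' (e(n := 0)) z = mon_val V e z" for e z
    unfolding mon_val_def V'_def using V by (simp add: prod.insert, intro prod.cong) auto
  have mon_coords: "mon_val V e (local_coords n F p u) = mon_val V e (\<lambda>l. u l - p l)" for e p u
    using V by (intro mon_val_cong) (auto simp: local_coords_def)
  \<comment> \<open>Labels of the terms in z_i = z_n / a - \<Sum> (h_e / a) z^e, the Taylor
    expansion solved for z_i with a the derivative at \<open>p\<close>: \<open>None\<close> is the
    term z_n, and \<open>Some e\<close> is a Taylor term, which has exponent 0 at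
    \<open>n\<close>.\<close>
  define ex :: "(nat \<Rightarrow> nat) option \<Rightarrow> nat \<Rightarrow> nat" where
    "ex g = (case g of None \<Rightarrow> (\<lambda>l\<in>V'. if l = n then 1 else 0) | Some e \<Rightarrow> e(n := 0))" for g
  define G where "G = insert None (Some ` ?H)"
  have G: "finite G" using V by (simp add: G_def finite_higher_exps)
  have exG: "2 \<le> (\<Sum>l\<in>V'. ex g l) \<or> ((\<Sum>l\<in>V'. ex g l) = 1 \<and> ex g i = 0)" if "g \<in> G" for g
  proof (cases g)
    case None
    have "(\<Sum>l\<in>V'. ex g l) = (\<Sum>l\<in>V'. if l = n then 1 else 0)"
      unfolding ex_def None by (intro sum.cong) auto
    also have "\<dots> = 1" using V' by (simp add: V'_def)
    finally show ?thesis using None V V' by (auto simp: ex_def)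
  next
    case (Some e)
    hence e: "e \<in> ?H" using that by (auto simp: G_def)
    have s: "(\<Sum>l\<in>V'. ex g l) = (\<Sum>l\<in>V. e l)"
      unfolding ex_def Some V'_def using V by (simp, intro sum.cong) auto
    have ei: "ex g i = e i" using V by (auto simp: ex_def Some)
    have split: "(\<Sum>l\<in>V. e l) = e i + (\<Sum>l\<in>V - {i}. e l)" by (rule sum.remove[OF V(1,2)])
    have "(\<exists>l\<in>V - {i}. e l > 0) \<or> e i \<ge> 2"
      using e exponent_cases[of e V k i] V(2) unfolding higher_exps_def by blast
    thus ?thesis
    proof
      assume "\<exists>l\<in>V - {i}. e l > 0"
      hence "(\<Sum>l\<in>V - {i}. e l) \<noteq> 0" using V by (auto simp: sum_eq_0_iff)
      thus ?thesis unfolding s ei split by linarith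
    next
      assume "e i \<ge> 2"
      thus ?thesis unfolding s ei split by linarith
    qed
  qed
  \<comment> \<open>The coefficients are 1 / a and - h_e / a with |a| \<ge> c and |h_e| \<le>
    A.\<close>
  define A' where "A' = max 1 A / c"
  have A': "A' \<ge> 0" using c by (simp add: A'_def)
  let ?P = "\<lambda>e K. \<forall>X r h. 0 < r \<and> r \<le> 1 \<and> (\<forall>z\<in>X. \<forall>l\<in>V'. \<bar>z l\<bar> \<le> C * r) \<and> (\<forall>g\<in>G. \<bar>h g\<bar> \<le> A') \<and>
     (\<forall>z\<in>X. z i = (\<Sum>g\<in>G. h g * mon_val V' (ex g) z)) \<longrightarrow>
     (\<exists>c. (\<forall>e'\<in>I. \<bar>c e'\<bar> \<le> K) \<and>
        (\<forall>z\<in>X. \<bar>mon_val V' e z - (\<Sum>e'\<in>I. c e' * mon_val W e' z)\<bar> \<le> K * r ^ N))"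
  \<comment> \<open>The elimination constants are fixed here, before \<open>p\<close>,
    \<open>X\<close> and \<open>r\<close> appear; one \<open>B0\<close> for all patches depends on
    this order.\<close>
  have "\<forall>e\<in>?E. \<exists>K. K \<ge> 0 \<and> ?P (e(n := 0)) K"
  proof
    fix e
    show "\<exists>K. K \<ge> 0 \<and> ?P (e(n := 0)) K"
      using eliminate_coordinate[where ex = ex and N = N and e = "e(n := 0)", OF V'(1,2) G exG C A']
      unfolding V'(3) I_def by blast
  qed
  from bchoice[OF this] obtain K where K': "\<forall>e\<in>?E. K e \<ge> 0 \<and> ?P (e(n := 0)) (K e)" by (elim exE)
  have K: "K e \<ge> 0" "?P (e(n := 0)) (K e)" if "e \<in> ?E" for e
    using bspec[OF K' that] by (rule conjunct1, rule conjunct2)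
  let ?K = "\<Sum>e\<in>?E. AP * K e"
  show ?thesis
  proof (intro exI[of _ ?K] conjI allI impI)
    show "0 \<le> ?K" using AP(1) K(1) by (intro sum_nonneg mult_nonneg_nonneg)
    fix p :: "nat \<Rightarrow> real" and X and r :: real
    assume hyp: "(\<forall>l<n. \<bar>p l\<bar> \<le> 1) \<and> c \<le> \<bar>eval p (partial_deriv i F)\<bar> \<and> 0 < r \<and> r \<le> 1 \<and>
      (\<forall>u\<in>X. u j = p j \<and> (\<forall>l<n. \<bar>u l - p l\<bar> \<le> C * r) \<and> \<bar>eval u F - eval p F\<bar> \<le> C * r)"
    have p1: "\<forall>l<n. \<bar>p l\<bar> \<le> 1" using hyp by (rule conjunct1)
    from A(2)[THEN spec, THEN mp, OF p1] obtain h where h: "\<forall>e\<in>?H. \<bar>h e\<bar> \<le> A"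
      "\<forall>u. u j = p j \<longrightarrow> eval u F - eval p F = eval p (partial_deriv i F) * (u i - p i) +
        (\<Sum>e\<in>?H. h e * mon_val V e (\<lambda>l. u l - p l))"
      by (elim exE conjE)
    from AP(2)[THEN spec, THEN mp, OF p1] obtain q where q: "\<forall>e\<in>?E. \<bar>q e\<bar> \<le> AP"
      "\<forall>u. u j = p j \<longrightarrow> eval u P = (\<Sum>e\<in>?E. q e * (\<Prod>l\<in>V. (u l - p l) ^ e l))"
      by (elim exE conjE)
    define a where "a = eval p (partial_deriv i F)"
    have a: "c \<le> \<bar>a\<bar>" "a \<noteq> 0" using hyp c by (auto simp: a_def)
    define hG where "hG g = (case g of None \<Rightarrow> 1 / a | Some e \<Rightarrow> - h e / a)" for g
    have hG: "\<forall>g\<in>G. \<bar>hG g\<bar> \<le> A'"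
    proof
      fix g assume "g \<in> G"
      then consider "g = None" | e where "g = Some e" "e \<in> ?H" by (auto simp: G_def)
      hence "\<bar>hG g\<bar> * \<bar>a\<bar> \<le> max 1 A"
      proof cases
        case 1
        thus ?thesis using a(2) by (simp add: hG_def)
      next
        case 2
        have "\<bar>h e\<bar> \<le> A" using h(1) 2(2) by blast
        thus ?thesis using a(2) 2(1) by (simp add: hG_def)
      qed
      also have "\<dots> = A' * c" using c by (simp add: A'_def)
      also have "\<dots> \<le> A' * \<bar>a\<bar>" using a A' by (intro mult_left_mono) auto
      finally show "\<bar>hG g\<bar> \<le> A'" using a by simp
    qed
    let ?X = "local_coords n F p ` X"
    have bound: "\<forall>z\<in>?X. \<forall>l\<in>V'. \<bar>z l\<bar> \<le> C * r"
    proof (intro ballI)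
      fix z l assume "z \<in> ?X" "l \<in> V'"
      then obtain u where u: "u \<in> X" "z = local_coords n F p u" by auto
      have "\<bar>u l - p l\<bar> \<le> C * r" if "l < n" using hyp u(1) that by blast
      moreover have "\<bar>eval u F - eval p F\<bar> \<le> C * r" using hyp u(1) by blast
      moreover have "l < n \<or> l = n" using \<open>l \<in> V'\<close> by (auto simp: V'_def V_def)
      ultimately show "\<bar>z l\<bar> \<le> C * r" unfolding u(2) local_coords_def by auto
    qed
    have rel: "\<forall>z\<in>?X. z i = (\<Sum>g\<in>G. hG g * mon_val V' (ex g) z)"
    proof
      fix z assume "z \<in> ?X"
      then obtain u where u: "u \<in> X" "z = local_coords n F p u" by auto
      have zi: "z i = u i - p i" using ij by (simp add: u local_coords_def)
      have zn: "z n = eval u F - eval p F" by (simp add: u local_coords_def)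
      have "(\<Sum>g\<in>G. hG g * mon_val V' (ex g) z) = 1 / a * z n + (\<Sum>e\<in>?H. - h e / a * mon_val V e (\<lambda>l. u l - p l))"
      proof -
        have "(\<Sum>g\<in>G. hG g * mon_val V' (ex g) z) = hG None * mon_val V' (ex None) z +
            (\<Sum>g\<in>Some ` ?H. hG g * mon_val V' (ex g) z)"
          unfolding G_def using V by (intro sum.insert) (auto simp: finite_higher_exps)
        moreover have "(\<Sum>g\<in>Some ` ?H. hG g * mon_val V' (ex g) z) = (\<Sum>e\<in>?H. - h e / a * mon_val V e (\<lambda>l. u l - p l))"
          by (subst sum.reindex) (auto simp: hG_def ex_def mon_ext u mon_coords)
        moreover have "mon_val V' (ex None) z = z n"
          unfolding ex_def option.case using V' by (intro mon_val_delta) (auto simp: V'_def)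
        ultimately show ?thesis by (simp add: hG_def)
      qed
      also have "\<dots> = (z n - (\<Sum>e\<in>?H. h e * mon_val V e (\<lambda>l. u l - p l))) / a"
        by (simp add: diff_divide_distrib sum_divide_distrib sum_negf)
      also have "\<dots> = z i"
      proof -
        have "u j = p j" using hyp u(1) by blast
        from h(2)[THEN spec[of _ u], THEN mp, OF this]
        have "z n - (\<Sum>e\<in>?H. h e * mon_val V e (\<lambda>l. u l - p l)) = a * (u i - p i)"
          unfolding zn a_def by simp
        thus ?thesis using a(2) by (simp add: zi)
      qed
      finally show "z i = (\<Sum>g\<in>G. hG g * mon_val V' (ex g) z)" by simp
    qed
    have "\<exists>b. (\<forall>e'\<in>I. \<bar>b e'\<bar> \<le> K e) \<and>
        (\<forall>z\<in>?X. \<bar>mon_val V' (e(n := 0)) z - (\<Sum>e'\<in>I. b e' * mon_val W e' z)\<bar> \<le> K e * r ^ N)" if "e \<in> ?E" for e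
    proof (rule K(2)[OF that, THEN spec[of _ ?X], THEN spec[of _ r], THEN spec[of _ hG], THEN mp], intro conjI)
      show "0 < r" "r \<le> 1" using hyp by auto
    qed (fact bound hG rel)+
    hence "\<forall>e\<in>?E. \<exists>b. (\<forall>e'\<in>I. \<bar>b e'\<bar> \<le> K e) \<and>
        (\<forall>z\<in>?X. \<bar>mon_val V' (e(n := 0)) z - (\<Sum>e'\<in>I. b e' * mon_val W e' z)\<bar> \<le> K e * r ^ N)"
      by (rule ballI)
    from bchoice[OF this] obtain b where b: "\<And>e e'. e \<in> ?E \<Longrightarrow> e' \<in> I \<Longrightarrow> \<bar>b e e'\<bar> \<le> K e"
      "\<And>e z. e \<in> ?E \<Longrightarrow> z \<in> ?X \<Longrightarrow> \<bar>mon_val V' (e(n := 0)) z - (\<Sum>e'\<in>I. b e e' * mon_val W e' z)\<bar> \<le> K e * r ^ N"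
      by blast
    define b' where "b' e' = (\<Sum>e\<in>?E. q e * b e e')" for e'
    have "\<bar>b' e'\<bar> \<le> ?K" if "e' \<in> I" for e'
      unfolding b'_def
    proof (rule order.trans[OF sum_abs], rule sum_mono)
      fix e assume "e \<in> ?E"
      thus "\<bar>q e * b e e'\<bar> \<le> AP * K e"
        unfolding abs_mult by (intro mult_mono bspec[OF q(1)] b(1) that AP(1) abs_ge_zero)
    qed
    moreover have "\<bar>eval u P - (\<Sum>e'\<in>I. b' e' * mon_val W e' (local_coords n F p u))\<bar> \<le> ?K * r ^ N"
      if u: "u \<in> X" for u
    proof -
      let ?z = "local_coords n F p u"
      have z: "?z \<in> ?X" using u by blast
      have "eval u P = (\<Sum>e\<in>?E. q e * mon_val V' (e(n := 0)) ?z)"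
      proof -
        have "u j = p j" using hyp u by blast
        from q(2)[THEN spec[of _ u], THEN mp, OF this] show ?thesis
          by (simp only: mon_ext mon_coords) (simp only: mon_val_def)
      qed
      moreover have "(\<Sum>e'\<in>I. b' e' * mon_val W e' ?z) = (\<Sum>e\<in>?E. q e * (\<Sum>e'\<in>I. b e e' * mon_val W e' ?z))"
        unfolding b'_def sum_distrib_right sum_distrib_left by (subst sum.swap) (simp add: mult_ac)
      ultimately have "eval u P - (\<Sum>e'\<in>I. b' e' * mon_val W e' ?z) =
        (\<Sum>e\<in>?E. q e * (mon_val V' (e(n := 0)) ?z - (\<Sum>e'\<in>I. b e e' * mon_val W e' ?z)))"
        by (simp only: right_diff_distrib sum_subtractf)
      moreover have "\<bar>\<Sum>e\<in>?E. q e * (mon_val V' (e(n := 0)) ?z - (\<Sum>e'\<in>I. b e e' * mon_val W e' ?z))\<bar>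
        \<le> (\<Sum>e\<in>?E. AP * (K e * r ^ N))"
      proof (rule order.trans[OF sum_abs], rule sum_mono)
        fix e assume "e \<in> ?E"
        thus "\<bar>q e * (mon_val V' (e(n := 0)) ?z - (\<Sum>e'\<in>I. b e e' * mon_val W e' ?z))\<bar> \<le> AP * (K e * r ^ N)"
          unfolding abs_mult by (intro mult_mono bspec[OF q(1)] b(2) z AP(1) abs_ge_zero)
      qed
      ultimately show ?thesis by (simp only: sum_distrib_right mult.assoc)
    qed
    ultimately show "\<exists>b. (\<forall>e\<in>I. \<bar>b e\<bar> \<le> ?K) \<and>
       (\<forall>u\<in>X. \<bar>eval u P - (\<Sum>e\<in>I. b e * mon_val W e (local_coords n F p u))\<bar> \<le> ?K * r ^ N)"
      by blast
  qed
qed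

section \<open>Pigeonhole for real linear forms\<close>

text \<open>Dirichlet's argument: there are more vectors in {0..H}^J than cells for the tuple of
  values, so two vectors share a cell, and their difference is the required one.\<close>

lemma small_linear_forms:
  fixes L :: "'e \<Rightarrow> 'm \<Rightarrow> real" and Q :: "'e \<Rightarrow> nat" and K :: real and H :: nat
  assumes fin: "finite J" "finite I" and K: "K > 0" and H: "H > 0"
    and L: "\<And>e m. e \<in> I \<Longrightarrow> m \<in> J \<Longrightarrow> \<bar>L e m\<bar> \<le> K"
    and Q: "\<And>e. e \<in> I \<Longrightarrow> Q e > 0" and less: "(\<Prod>e\<in>I. Q e) < (H + 1) ^ card J"
  shows "\<exists>a :: 'm \<Rightarrow> int. (\<exists>m\<in>J. a m \<noteq> 0) \<and> (\<forall>m\<in>J. \<bar>a m\<bar> \<le> int H) \<and>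
     (\<forall>e\<in>I. \<bar>\<Sum>m\<in>J. of_int (a m) * L e m\<bar> \<le> 4 * card J * K * H / Q e)"
proof -
  have "J \<noteq> {}"
  proof
    assume "J = {}"
    with less have "(\<Prod>e\<in>I. Q e) = 0" by simp
    thus False using Q fin by force
  qed
  hence cJ: "card J > 0" using fin by (simp add: card_gt_0_iff)
  \<comment> \<open>Every value lies in [-W/4, W/4]. After the shift by W/4 the values fill only the
    lower half of [0, W], so the floor stays strictly below \<open>Q e\<close> and the endpoint
    causes no trouble.\<close>
  define W where "W = 4 * card J * K * H"
  have W: "W > 0" using cJ K H by (simp add: W_def)
  define S where "S b e = (\<Sum>m\<in>J. of_int (b m) * L e m)" for b :: "'m \<Rightarrow> int" and e
  define cell where "cell b = (\<lambda>e\<in>I. \<lfloor>(S b e + W / 4) * Q e / W\<rfloor>)" for b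
  let ?A = "PiE J (\<lambda>_. {0..int H})" and ?B = "PiE I (\<lambda>e. {0..<int (Q e)})"
  have S: "\<bar>S b e\<bar> \<le> W / 4" if "b \<in> ?A" "e \<in> I" for b e
  proof -
    have "\<bar>S b e\<bar> \<le> (\<Sum>m\<in>J. \<bar>of_int (b m) * L e m\<bar>)" unfolding S_def by (rule sum_abs)
    also have "\<dots> \<le> (\<Sum>m\<in>J. real H * K)"
    proof (intro sum_mono)
      fix m assume m: "m \<in> J"
      have "\<bar>b m\<bar> \<le> int H" using PiE_mem[OF that(1) m] by simp
      hence "\<bar>real_of_int (b m)\<bar> \<le> real H" by linarith
      thus "\<bar>of_int (b m) * L e m\<bar> \<le> real H * K"
        unfolding abs_mult using L[OF that(2) m] K by (intro mult_mono) auto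
    qed
    finally show ?thesis by (simp add: W_def mult_ac)
  qed
  have "cell b \<in> ?B" if b: "b \<in> ?A" for b
    unfolding cell_def
  proof (rule restrict_PiE_iff[THEN iffD2], rule ballI)
    fix e assume e: "e \<in> I"
    have "0 \<le> (S b e + W / 4) * Q e / W" using S[OF b e] W by (simp add: abs_le_iff)
    moreover have "(S b e + W / 4) * Q e / W < Q e"
    proof -
      have "(S b e + W / 4) * Q e < W * Q e"
        using S[OF b e] W Q[OF e] by (intro mult_strict_right_mono) auto
      thus ?thesis using W by (simp add: field_simps)
    qed
    ultimately show "\<lfloor>(S b e + W / 4) * Q e / W\<rfloor> \<in> {0..<int (Q e)}"
      by (auto simp: floor_less_iff)
  qed
  hence "cell ` ?A \<subseteq> ?B" by blast
  hence "card (cell ` ?A) \<le> card ?B" by (intro card_mono finite_PiE) (auto simp: fin)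
  also have "card ?B = (\<Prod>e\<in>I. Q e)" by (simp add: card_PiE fin)
  also have "\<dots> < card ?A" using less by (simp add: card_PiE fin nat_add_distrib)
  finally have "\<not> inj_on cell ?A" by (rule pigeonhole)
  then obtain b b' where b: "b \<in> ?A" "b' \<in> ?A" "b \<noteq> b'" "cell b = cell b'" by (auto simp: inj_on_def)
  define a where "a m = b m - b' m" for m
  have "\<exists>m\<in>J. b m \<noteq> b' m" using b(1-3) by (meson PiE_ext)
  hence "\<exists>m\<in>J. a m \<noteq> 0" by (simp add: a_def)
  moreover have "\<bar>a m\<bar> \<le> int H" if "m \<in> J" for m
    using PiE_mem[OF b(1) that] PiE_mem[OF b(2) that] by (auto simp: a_def)
  moreover have "\<bar>\<Sum>m\<in>J. of_int (a m) * L e m\<bar> \<le> 4 * card J * K * H / Q e" if e: "e \<in> I" for e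
  proof -
    let ?f = "\<lambda>b. (S b e + W / 4) * Q e / W"
    have "\<lfloor>?f b\<rfloor> = \<lfloor>?f b'\<rfloor>" using fun_cong[OF b(4), of e] e by (simp add: cell_def)
    hence "\<bar>?f b - ?f b'\<bar> < 1" by linarith
    moreover have "?f b - ?f b' = (S b e - S b' e) * Q e / W"
      by (simp add: diff_divide_distrib[symmetric] left_diff_distrib[symmetric])
    ultimately have "\<bar>S b e - S b' e\<bar> * Q e / W < 1"
      using W by (simp add: abs_mult)
    hence "\<bar>S b e - S b' e\<bar> \<le> W / Q e" using W Q[OF e] by (simp add: field_simps)
    moreover have "(\<Sum>m\<in>J. of_int (a m) * L e m) = S b e - S b' e"
      by (simp add: S_def a_def left_diff_distrib sum_subtractf)
    ultimately show ?thesis by (simp add: W_def)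
  qed
  ultimately show ?thesis by blast
qed

section \<open>Counting monomials\<close>

definition monoms :: "nat \<Rightarrow> nat \<Rightarrow> monomial set" where
  "monoms n D = {m. keys m \<subseteq> {..<n} \<and> mon_degree m = D}"

text \<open>Transports the stars-and-bars count for lists of given length and sum to
  monomials.\<close>

lemma bij_betw_monoms:
  "bij_betw (\<lambda>m. map (lookup m) [0..<n]) (monoms n D) {xs. length xs = n \<and> sum_list xs = D}"
proof (rule bij_betwI[where g = Poly_Mapping.nth])
  show "(\<lambda>m. map (lookup m) [0..<n]) \<in> monoms n D \<rightarrow> {xs. length xs = n \<and> sum_list xs = D}"
    by (auto simp: monoms_def mon_degree_lessThan sum_list_sum_nth atLeast0LessThan)
  have lk: "lookup (Poly_Mapping.nth xs) l = (if l < length xs then xs ! l else 0)" for xs :: "nat list" and l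
    by (simp add: nth_default_def)
  have ks: "keys (Poly_Mapping.nth xs) \<subseteq> {..<length xs}" for xs :: "nat list"
  proof
    fix l assume "l \<in> keys (Poly_Mapping.nth xs)"
    thus "l \<in> {..<length xs}"
      unfolding in_keys_iff lk by (simp split: if_splits)
  qed
  show "Poly_Mapping.nth \<in> {xs. length xs = n \<and> sum_list xs = D} \<rightarrow> monoms n D"
  proof
    fix xs :: "nat list" assume "xs \<in> {xs. length xs = n \<and> sum_list xs = D}"
    hence xs: "length xs = n" "sum_list xs = D" by auto
    have "mon_degree (Poly_Mapping.nth xs) = (\<Sum>l<length xs. xs ! l)"
      unfolding mon_degree_lessThan[OF ks] lk by (intro sum.cong) auto
    also have "\<dots> = D" using xs by (simp add: sum_list_sum_nth atLeast0LessThan)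
    finally show "Poly_Mapping.nth xs \<in> monoms n D"
      using ks[of xs] xs unfolding monoms_def by blast
  qed
  show "Poly_Mapping.nth (map (lookup m) [0..<n]) = m" if "m \<in> monoms n D" for m
  proof (rule poly_mapping_eqI)
    fix l
    show "lookup (Poly_Mapping.nth (map (lookup m) [0..<n])) l = lookup m l"
      using that unfolding lk monoms_def by (auto simp: in_keys_iff subset_iff)
  qed
  show "map (lookup (Poly_Mapping.nth xs)) [0..<n] = xs"
    if "xs \<in> {xs. length xs = n \<and> sum_list xs = D}" for xs :: "nat list"
    using that by (intro nth_equalityI) (auto simp: lk simp del: lookup_nth)
qed

lemma card_monoms: "card (monoms n D) = (D + n - 1) choose D"
  using bij_betw_same_card[OF bij_betw_monoms, of n D] card_length_sum_list[of n D] by simp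

lemma finite_monoms: 
  assumes "n > 0"
  shows "finite (monoms n D)"
proof (rule card_ge_0_finite)
  show "card (monoms n D) > 0" using assms by (simp add: card_monoms)
qed

section \<open>Estimates for the two sides of the box count\<close>

lemma power_div_fact_le_binomial: "real D ^ v / fact v \<le> real ((D + v) choose v)"
proof (induction v)
  case (Suc v)
  have "Suc (D + v) * ((D + v) choose v) = (Suc (D + v) choose Suc v) * Suc v"
    by (rule Suc_times_binomial_eq)
  hence "real (Suc (D + v)) * real ((D + v) choose v) = real (Suc (D + v) choose Suc v) * real (Suc v)"
    by (simp only: of_nat_mult[symmetric])
  hence eq: "real (Suc (D + v) choose Suc v) = real (Suc (D + v)) * real ((D + v) choose v) / real (Suc v)"
    by (simp add: field_simps)
  have "real D ^ Suc v / fact (Suc v) = real D * (real D ^ v / fact v) / real (Suc v)"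
    by (simp add: mult_ac)
  also have "\<dots> \<le> real (Suc (D + v)) * real ((D + v) choose v) / real (Suc v)"
    by (intro divide_right_mono mult_mono Suc.IH) auto
  finally show ?case unfolding eq[symmetric] by simp
qed auto

lemma card_monoms_ge:
  assumes "n > 0"
  shows "real (card (monoms n D)) \<ge> real D ^ (n - 1) / fact (n - 1)"
proof -
  have "(D + n - 1) choose D = (D + (n - 1)) choose (n - 1)"
    using binomial_symmetric[of D "D + (n - 1)"] assms by simp
  thus ?thesis using power_div_fact_le_binomial[of D "n - 1"] by (simp add: card_monoms)
qed

text \<open>Comparison of a sum with an integral, in telescoping form: Bernoulli's inequality bounds
  (Q + 1) \<omega> s^Q by the increment of s^(Q+1) over a step \<omega>.\<close>

lemma sum_positive_part_power:
  fixes \<omega> S :: real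
  assumes "\<omega> > 0" "Q > 0"
  shows "(\<Sum>t<N. max 0 (S - real t * \<omega>) ^ Q) \<le> max 0 (S + \<omega>) ^ Suc Q / (real (Suc Q) * \<omega>)"
proof -
  have step: "real (Suc Q) * \<omega> * max 0 s ^ Q \<le> max 0 (s + \<omega>) ^ Suc Q - max 0 s ^ Suc Q" for s
  proof (cases "s \<le> 0")
    case True
    thus ?thesis using assms by (simp add: max_def zero_power)
  next
    case False
    hence s: "s > 0" by simp
    have "0 \<le> \<omega> / s" using s assms by simp
    hence "-1 \<le> \<omega> / s" by linarith
    hence "1 + real (Suc Q) * (\<omega> / s) \<le> (1 + \<omega> / s) ^ Suc Q"
      by (rule Bernoulli_inequality)
    hence "s ^ Suc Q * (1 + real (Suc Q) * (\<omega> / s)) \<le> s ^ Suc Q * (1 + \<omega> / s) ^ Suc Q"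
      using s by (intro mult_left_mono) auto
    also have "\<dots> = (s * (1 + \<omega> / s)) ^ Suc Q" by (simp only: power_mult_distrib)
    also have "s * (1 + \<omega> / s) = s + \<omega>" using s by (simp add: distrib_left)
    also have "s ^ Suc Q * (1 + real (Suc Q) * (\<omega> / s)) = s ^ Suc Q + real (Suc Q) * \<omega> * s ^ Q"
      using s by (simp add: distrib_left del: of_nat_Suc)
    finally have "real (Suc Q) * \<omega> * s ^ Q \<le> (s + \<omega>) ^ Suc Q - s ^ Suc Q" by linarith
    moreover have "max 0 s = s" "max 0 (s + \<omega>) = s + \<omega>" using s assms by auto
    ultimately show ?thesis by (simp only:)
  qed
  have "(\<Sum>t<N. real (Suc Q) * \<omega> * max 0 (S - real t * \<omega>) ^ Q) \<le>
     max 0 (S + \<omega>) ^ Suc Q - max 0 (S + \<omega> - real N * \<omega>) ^ Suc Q"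
  proof (induction N)
    case (Suc N)
    have eqs: "S + \<omega> - real (Suc N) * \<omega> = S - real N * \<omega>" "S + \<omega> - real N * \<omega> = (S - real N * \<omega>) + \<omega>"
      by (simp_all add: algebra_simps)
    show ?case
      unfolding sum.lessThan_Suc eqs(1)
      using Suc.IH[unfolded eqs(2)] step[of "S - real N * \<omega>"] by linarith
  qed simp
  also have "\<dots> \<le> max 0 (S + \<omega>) ^ Suc Q" by simp
  finally have "(real (Suc Q) * \<omega>) * (\<Sum>t<N. max 0 (S - real t * \<omega>) ^ Q) \<le> max 0 (S + \<omega>) ^ Suc Q"
    by (simp only: sum_distrib_left)
  moreover have "real (Suc Q) * \<omega> > 0" using assms by simp
  ultimately show ?thesis by (simp only: pos_le_divide_eq mult.commute)
qed

lemma sum_PiE_insert: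
  assumes "x \<notin> V"
  shows "(\<Sum>e\<in>PiE (insert x V) B. f e) = (\<Sum>t\<in>B x. \<Sum>e\<in>PiE V B. f (e(x := t)))"
proof -
  have "(\<Sum>e\<in>PiE (insert x V) B. f e) = (\<Sum>(t, e)\<in>B x \<times> PiE V B. f (e(x := t)))"
    unfolding PiE_insert_eq by (subst sum.reindex[OF inj_combinator[OF assms]]) (auto intro: sum.cong)
  thus ?thesis by (simp add: sum.cartesian_product)
qed

text \<open>The right side is the integral of the same positive part over the orthant, with T raised
  by the sum of the weights. Summing out one coordinate raises the power by one and divides by its
  weight; the shift of T is lower order for large T.\<close>

lemma sum_positive_part_box:
  fixes \<omega> :: "'i \<Rightarrow> real" and T :: real
  assumes "finite V" "\<And>l. l \<in> V \<Longrightarrow> \<omega> l > 0" "q > 0"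
  shows "(\<Sum>e\<in>PiE V (\<lambda>_. {..<N}). max 0 (T - (\<Sum>l\<in>V. real (e l) * \<omega> l)) ^ q) \<le>
    fact q / fact (q + card V) * max 0 (T + (\<Sum>l\<in>V. \<omega> l)) ^ (q + card V) / (\<Prod>l\<in>V. \<omega> l)"
  using assms(1,2)
proof (induction V arbitrary: T rule: finite_induct)
  case (insert x V)
  let ?c = "fact q / fact (q + card V) / (\<Prod>l\<in>V. \<omega> l) :: real"
  have P: "(\<Prod>l\<in>V. \<omega> l) > 0" using insert by (intro prod_pos) auto
  have x: "\<omega> x > 0" using insert by auto
  have "(\<Sum>e\<in>PiE (insert x V) (\<lambda>_. {..<N}). max 0 (T - (\<Sum>l\<in>insert x V. real (e l) * \<omega> l)) ^ q) =
    (\<Sum>t<N. \<Sum>e\<in>PiE V (\<lambda>_. {..<N}). max 0 (T - (\<Sum>l\<in>insert x V. real ((e(x := t)) l) * \<omega> l)) ^ q)"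
    by (rule sum_PiE_insert) (fact insert)
  also have "\<dots> = (\<Sum>t<N. \<Sum>e\<in>PiE V (\<lambda>_. {..<N}). max 0 ((T - real t * \<omega> x) - (\<Sum>l\<in>V. real (e l) * \<omega> l)) ^ q)"
  proof (intro sum.cong refl)
    fix t and e :: "'i \<Rightarrow> nat"
    have "(\<Sum>l\<in>V. real ((e(x := t)) l) * \<omega> l) = (\<Sum>l\<in>V. real (e l) * \<omega> l)"
      using insert by (intro sum.cong) auto
    hence "(\<Sum>l\<in>insert x V. real ((e(x := t)) l) * \<omega> l) = real t * \<omega> x + (\<Sum>l\<in>V. real (e l) * \<omega> l)"
      using insert by simp
    thus "max 0 (T - (\<Sum>l\<in>insert x V. real ((e(x := t)) l) * \<omega> l)) ^ q =
      max 0 ((T - real t * \<omega> x) - (\<Sum>l\<in>V. real (e l) * \<omega> l)) ^ q" by (simp add: algebra_simps)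
  qed
  also have "\<dots> \<le> (\<Sum>t<N. ?c * max 0 ((T + (\<Sum>l\<in>V. \<omega> l)) - real t * \<omega> x) ^ (q + card V))"
  proof (intro sum_mono)
    fix t
    have "(\<Sum>e\<in>PiE V (\<lambda>_. {..<N}). max 0 ((T - real t * \<omega> x) - (\<Sum>l\<in>V. real (e l) * \<omega> l)) ^ q) \<le>
      fact q / fact (q + card V) * max 0 ((T - real t * \<omega> x) + (\<Sum>l\<in>V. \<omega> l)) ^ (q + card V) / (\<Prod>l\<in>V. \<omega> l)"
      by (rule insert.IH) (use insert in auto)
    thus "(\<Sum>e\<in>PiE V (\<lambda>_. {..<N}). max 0 ((T - real t * \<omega> x) - (\<Sum>l\<in>V. real (e l) * \<omega> l)) ^ q) \<le>
       ?c * max 0 ((T + (\<Sum>l\<in>V. \<omega> l)) - real t * \<omega> x) ^ (q + card V)"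
      by (simp add: algebra_simps)
  qed
  also have "\<dots> = ?c * (\<Sum>t<N. max 0 ((T + (\<Sum>l\<in>V. \<omega> l)) - real t * \<omega> x) ^ (q + card V))"
    by (simp only: sum_distrib_left)
  also have "\<dots> \<le> ?c * (max 0 ((T + (\<Sum>l\<in>V. \<omega> l)) + \<omega> x) ^ Suc (q + card V) / (real (Suc (q + card V)) * \<omega> x))"
    using x P assms(3) by (intro mult_left_mono sum_positive_part_power) auto
  also have "(T + (\<Sum>l\<in>V. \<omega> l)) + \<omega> x = T + (\<Sum>l\<in>insert x V. \<omega> l)" using insert by simp
  finally show ?case using insert by (simp add: mult_ac)
qed simp

text \<open>With \<open>T = n D / (n - 1)\<close> the leading terms in \<open>D\<close> on both sides agree exactly when
  \<open>P = (n / (n - 1))\<^sup>n\<^sup>-\<^sup>1\<close>.\<close>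

lemma eventually_degree_inequality:
  fixes P \<sigma> :: real and n :: nat
  assumes n: "n \<ge> 2" and P: "P > (real n / (real n - 1)) ^ (n - 1)"
  shows "eventually (\<lambda>D. (real n * real D / (real n - 1) + \<sigma>) ^ n / (fact n * P) <
           real D ^ (n - 1) / fact (n - 1) * (real n * real D / (real n - 1) - real D - 1)) sequentially"
proof -
  define \<tau> where "\<tau> = real n / (real n - 1)"
  have \<tau>: "\<tau> > 0" using n by (simp add: \<tau>_def)
  hence P0: "P > 0" using P by (metis \<tau>_def less_trans zero_less_power)
  \<comment> \<open>The difference of the two sides divided by D^n. It converges, so it suffices
    that its limit is positive.\<close>
  have "(\<lambda>D. (1 / (real n - 1) - 1 / real D) / fact (n - 1) - (\<tau> + \<sigma> / real D) ^ n / (fact n * P))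
     \<longlonglongrightarrow> (1 / (real n - 1) - 0) / fact (n - 1) - (\<tau> + 0) ^ n / (fact n * P)"
    using P0 by (intro tendsto_intros lim_const_over_n) auto
  moreover have "\<tau> ^ n / (fact n * P) < 1 / (real n - 1) / fact (n - 1)"
  proof -
    have n': "n = Suc (n - 1)" using n by simp
    have "\<tau> ^ n = \<tau> * \<tau> ^ (n - 1)" by (subst n') simp
    also have "\<dots> < \<tau> * P"
      using P \<tau> unfolding \<tau>_def[symmetric] by (intro mult_strict_left_mono)
    finally have "\<tau> ^ n / (fact n * P) < \<tau> * P / (fact n * P)"
      using P0 by (intro divide_strict_right_mono) auto
    also have "\<dots> = \<tau> / fact n" using P0 by simp
    also have "\<dots> = \<tau> / (real n * fact (n - 1))" using n by (simp add: fact_reduce)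
    also have "\<dots> = 1 / (real n - 1) / fact (n - 1)" using n by (simp add: \<tau>_def)
    finally show ?thesis .
  qed
  ultimately have "eventually (\<lambda>D. 0 < (1 / (real n - 1) - 1 / real D) / fact (n - 1) - (\<tau> + \<sigma> / real D) ^ n / (fact n * P)) sequentially"
    by (intro order_tendstoD(1)) auto
  with eventually_gt_at_top[of 0] show ?thesis
  proof eventually_elim
    case (elim D)
    have D: "real D > 0" using elim by simp
    have n': "n = Suc (n - 1)" using n by simp
    have T: "real n * real D / (real n - 1) = real D * \<tau>" by (simp add: \<tau>_def)
    have "\<tau> - 1 = 1 / (real n - 1)" using n by (simp add: \<tau>_def field_simps)
    hence "\<tau> = 1 + 1 / (real n - 1)" by linarith
    hence 1: "real D * \<tau> - real D - 1 = real D * (1 / (real n - 1) - 1 / real D)"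
      using D by (simp add: right_diff_distrib distrib_left)
    have 2: "real D * \<tau> + \<sigma> = real D * (\<tau> + \<sigma> / real D)" using D by (simp add: field_simps)
    have 3: "real D ^ n = real D ^ (n - 1) * real D" by (subst n') simp
    have "real D ^ n * ((\<tau> + \<sigma> / real D) ^ n / (fact n * P)) < real D ^ n * ((1 / (real n - 1) - 1 / real D) / fact (n - 1))"
      using elim D by (intro mult_strict_left_mono) auto
    thus ?case unfolding T 1 2 power_mult_distrib by (simp add: 3 mult_ac)
  qed
qed

text \<open>The pigeonhole is applied to the coefficients c_{m,e} with about B^(T - wt e) cells for
  the exponent \<open>e\<close>. A sum of weight wt e is then O(H B^(wt e - T)), its monomial
  contributes B^(-wt e), and every term becomes O(H B^(-T)) with H about B^(T-D-1).\<close>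

lemma small_combination:
  fixes J :: "'m set" and W :: "'i set" and \<omega> :: "'i \<Rightarrow> real" and K C T :: real and D N :: nat
  assumes fin: "finite J" "finite W" and \<omega>: "\<And>l. l \<in> W \<Longrightarrow> \<omega> l > 0" and K: "K > 0" and C: "C \<ge> 1"
  defines "I \<equiv> PiE W (\<lambda>_. {..<N})" and "wt \<equiv> \<lambda>e. \<Sum>l\<in>W. real (e l) * \<omega> l"
  assumes less: "(\<Sum>e\<in>I. max 0 (T - wt e)) < card J * (T - D - 1)"
  shows "\<exists>B0\<ge>1. \<forall>B\<ge>B0. \<forall>(X :: 'x set) \<zeta> f c.
     (\<forall>x\<in>X. \<forall>l\<in>W. \<bar>\<zeta> x l\<bar> \<le> C * B powr - \<omega> l) \<and> (\<forall>m\<in>J. \<forall>e\<in>I. \<bar>c m e\<bar> \<le> K) \<and>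
     (\<forall>x\<in>X. \<forall>m\<in>J. \<bar>f x m - (\<Sum>e\<in>I. c m e * mon_val W e (\<zeta> x))\<bar> \<le> K * B powr - T) \<longrightarrow>
     (\<exists>a :: 'm \<Rightarrow> int. (\<exists>m\<in>J. a m \<noteq> 0) \<and> (\<forall>m\<in>J. real_of_int \<bar>a m\<bar> \<le> B powr (T - D - 1)) \<and>
        (\<forall>x\<in>X. \<bar>\<Sum>m\<in>J. of_int (a m) * f x m\<bar> < B powr - D))"
proof -
  have finI: "finite I" unfolding I_def using fin by (intro finite_PiE) auto
  define S where "S = (\<Sum>e\<in>I. max 0 (T - wt e))"
  \<comment> \<open>The saving in the exponent of B: there are about B^(card J (T-D-1)) coefficient
    vectors and about B^S cells.\<close>
  define \<Delta> where "\<Delta> = card J * (T - D - 1) - S"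
  have \<Delta>: "\<Delta> > 0" using less by (simp add: \<Delta>_def S_def)
  have S0: "S \<ge> 0" unfolding S_def by (intro sum_nonneg) auto
  have "card J * (T - D - 1) > 0" using S0 \<Delta> by (simp add: \<Delta>_def)
  hence TD: "T - D - 1 > 0" by (simp add: zero_less_mult_iff)
  define C' where "C' = C ^ (card W * N)"
  have C': "C' \<ge> 1" using C by (simp add: C'_def)
  define Z where "Z = (4 * card I * C' + 1) * card J * K"
  have Z: "Z \<ge> 0" using K C' unfolding Z_def by (intro mult_nonneg_nonneg add_nonneg_nonneg) auto
  \<comment> \<open>B > Z lets one factor B absorb all constants; the second bound gives 2^(card I)
    \<le> B^\<Delta>, which pays for rounding every \<open>Q e\<close> up.\<close>
  define B0 where "B0 = max (Z + 1) ((2 ^ card I) powr (1 / \<Delta>))"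
  have "B0 \<ge> 1" using Z by (simp add: B0_def)
  show ?thesis
  proof (intro exI[of _ B0] conjI allI impI)
    show "B0 \<ge> 1" by fact
    fix B :: real and X :: "'x set" and \<zeta> f and c :: "'m \<Rightarrow> ('i \<Rightarrow> nat) \<Rightarrow> real"
    assume B: "B \<ge> B0" and hyp: "(\<forall>x\<in>X. \<forall>l\<in>W. \<bar>\<zeta> x l\<bar> \<le> C * B powr - \<omega> l) \<and> (\<forall>m\<in>J. \<forall>e\<in>I. \<bar>c m e\<bar> \<le> K) \<and>
      (\<forall>x\<in>X. \<forall>m\<in>J. \<bar>f x m - (\<Sum>e\<in>I. c m e * mon_val W e (\<zeta> x))\<bar> \<le> K * B powr - T)"
    have B1: "B \<ge> 1" "B > Z" using B \<open>B0 \<ge> 1\<close> by (auto simp: B0_def)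
    define H where "H = nat \<lfloor>B powr (T - D - 1)\<rfloor>"
    have "B powr (T - D - 1) \<ge> 1" using B1 TD by (intro ge_one_powr_ge_zero) auto
    hence H: "H > 0" "real H \<le> B powr (T - D - 1)"
      unfolding H_def by linarith+
    \<comment> \<open>For weights at least T the monomial itself is already O(B^(-T)), and a single
      cell is enough.\<close>
    define Q where "Q e = nat \<lceil>B powr max 0 (T - wt e)\<rceil>" for e
    have ge1: "B powr max 0 (T - wt e) \<ge> 1" for e using B1 by (intro ge_one_powr_ge_zero) auto
    have Q: "Q e > 0" "B powr max 0 (T - wt e) \<le> Q e" "Q e \<le> 2 * B powr max 0 (T - wt e)" for e
      using ge1[of e] unfolding Q_def by linarith+
    have "(2 ^ card I :: real) = ((2 ^ card I) powr (1 / \<Delta>)) powr \<Delta>"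
      using \<Delta> by (simp add: powr_powr)
    also have "\<dots> \<le> B powr \<Delta>" using B \<Delta> by (intro powr_mono2) (auto simp: B0_def)
    finally have two: "2 ^ card I \<le> B powr \<Delta>" .
    have cJ: "card J > 0" using \<open>card J * (T - D - 1) > 0\<close> by (auto simp: zero_less_mult_iff)
    have "real (\<Prod>e\<in>I. Q e) \<le> (\<Prod>e\<in>I. 2 * B powr max 0 (T - wt e))"
      unfolding of_nat_prod using Q by (intro prod_mono) auto
    also have "\<dots> = 2 ^ card I * B powr S"
      using B1 by (simp add: prod.distrib S_def powr_sum finI)
    also have "\<dots> \<le> B powr \<Delta> * B powr S" using two by (rule mult_right_mono) simp
    also have "B powr \<Delta> * B powr S = (B powr (T - D - 1)) ^ card J"
      using B1 by (simp add: powr_add[symmetric] \<Delta>_def powr_powr powr_realpow[symmetric] mult.commute)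
    also have "\<dots> < real (H + 1) ^ card J"
    proof (rule power_strict_mono)
      show "B powr (T - D - 1) < real (H + 1)" unfolding H_def by linarith
    qed (use cJ in auto)
    finally have strict: "(\<Prod>e\<in>I. Q e) < (H + 1) ^ card J"
      by (simp only: of_nat_power[symmetric] of_nat_less_iff)
    obtain a :: "'m \<Rightarrow> int" where a: "\<exists>m\<in>J. a m \<noteq> 0" "\<And>m. m \<in> J \<Longrightarrow> \<bar>a m\<bar> \<le> int H"
      "\<And>e. e \<in> I \<Longrightarrow> \<bar>\<Sum>m\<in>J. of_int (a m) * c m e\<bar> \<le> 4 * card J * K * H / Q e"
    proof -
      have "\<exists>a :: 'm \<Rightarrow> int. (\<exists>m\<in>J. a m \<noteq> 0) \<and> (\<forall>m\<in>J. \<bar>a m\<bar> \<le> int H) \<and>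
         (\<forall>e\<in>I. \<bar>\<Sum>m\<in>J. of_int (a m) * c m e\<bar> \<le> 4 * card J * K * H / Q e)"
        using hyp by (intro small_linear_forms fin finI K H Q strict) auto
      thus ?thesis using that by blast
    qed
    have aH: "\<bar>real_of_int (a m)\<bar> \<le> real H" if "m \<in> J" for m using a(2)[OF that] by linarith
    have "\<bar>\<Sum>m\<in>J. of_int (a m) * f x m\<bar> < B powr - D" if x: "x \<in> X" for x
    proof -
      let ?g = "\<lambda>m. \<Sum>e\<in>I. c m e * mon_val W e (\<zeta> x)"
      have mon: "\<bar>mon_val W e (\<zeta> x)\<bar> \<le> C' * B powr - wt e" if e: "e \<in> I" for e
      proof -
        have "\<bar>mon_val W e (\<zeta> x)\<bar> \<le> C ^ (\<Sum>l\<in>W. e l) * (\<Prod>l\<in>W. (B powr - \<omega> l) ^ e l)"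
          using hyp x C by (intro mon_val_bound) auto
        also have "(\<Prod>l\<in>W. (B powr - \<omega> l) ^ e l) = (\<Prod>l\<in>W. B powr - (real (e l) * \<omega> l))"
          using B1 by (intro prod.cong) (auto simp: powr_realpow[symmetric] powr_powr mult.commute)
        also have "\<dots> = B powr - wt e"
          using B1 by (simp add: wt_def powr_sum[symmetric] fin sum_negf)
        also have "C ^ (\<Sum>l\<in>W. e l) \<le> C'"
          unfolding C'_def
        proof (rule power_increasing[OF _ C])
          have "(\<Sum>l\<in>W. e l) \<le> (\<Sum>l\<in>W. N)" using e by (intro sum_mono) (auto simp: I_def PiE_iff)
          thus "(\<Sum>l\<in>W. e l) \<le> card W * N" by simp
        qed
        finally show ?thesis by (simp add: mult_right_mono)
      qed
      have main: "\<bar>\<Sum>m\<in>J. of_int (a m) * ?g m\<bar> \<le> card I * (4 * card J * K * H * C' * B powr - T)"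
      proof -
        have "(\<Sum>m\<in>J. of_int (a m) * ?g m) = (\<Sum>e\<in>I. (\<Sum>m\<in>J. of_int (a m) * c m e) * mon_val W e (\<zeta> x))"
          unfolding sum_distrib_left sum_distrib_right by (subst sum.swap) (simp add: mult_ac)
        also have "\<bar>\<dots>\<bar> \<le> (\<Sum>e\<in>I. 4 * card J * K * H * C' * B powr - T)"
        proof (intro order.trans[OF sum_abs] sum_mono)
          fix e assume e: "e \<in> I"
          have "B powr (T - wt e) \<le> B powr max 0 (T - wt e)" using B1 by (intro powr_mono) auto
          hence Qe: "B powr (T - wt e) \<le> Q e" using Q(2)[of e] by linarith
          have p: "B powr (T - wt e) > 0" using B1 by simp
          have "\<bar>(\<Sum>m\<in>J. of_int (a m) * c m e) * mon_val W e (\<zeta> x)\<bar> \<le>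
            (4 * card J * K * H / Q e) * (C' * B powr - wt e)"
            unfolding abs_mult using a(3)[OF e] mon[OF e] K C' by (intro mult_mono) auto
          also have "\<dots> \<le> (4 * card J * K * H / B powr (T - wt e)) * (C' * B powr - wt e)"
            using Qe p K C' Q(1)[of e] by (intro mult_right_mono divide_left_mono mult_pos_pos) auto
          also have "\<dots> = 4 * card J * K * H * C' * (B powr - wt e / B powr (T - wt e))" by simp
          also have "B powr - wt e / B powr (T - wt e) = B powr - T"
            by (simp add: powr_diff[symmetric])
          finally show "\<bar>(\<Sum>m\<in>J. of_int (a m) * c m e) * mon_val W e (\<zeta> x)\<bar> \<le> 4 * card J * K * H * C' * B powr - T" .
        qed
        finally show ?thesis by simp
      qed
      have "\<bar>(\<Sum>m\<in>J. of_int (a m) * f x m) - (\<Sum>m\<in>J. of_int (a m) * ?g m)\<bar> \<le> card J * (H * (K * B powr - T))"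
      proof -
        have "(\<Sum>m\<in>J. of_int (a m) * f x m) - (\<Sum>m\<in>J. of_int (a m) * ?g m) = (\<Sum>m\<in>J. of_int (a m) * (f x m - ?g m))"
          by (simp add: sum_subtractf right_diff_distrib)
        also have "\<bar>\<dots>\<bar> \<le> (\<Sum>m\<in>J. real H * (K * B powr - T))"
          unfolding abs_mult using hyp x
          by (intro order.trans[OF sum_abs] sum_mono) (auto simp: abs_mult intro!: mult_mono aH)
        finally show ?thesis by simp
      qed
      hence "\<bar>\<Sum>m\<in>J. of_int (a m) * f x m\<bar> \<le> card I * (4 * card J * K * H * C' * B powr - T) + card J * (H * (K * B powr - T))"
        using main by linarith
      also have "\<dots> = Z * (H * B powr - T)" by (simp add: Z_def algebra_simps)
      also have "\<dots> \<le> Z * (B powr (T - D - 1) * B powr - T)"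
        using Z H by (intro mult_left_mono mult_right_mono) auto
      also have "B powr (T - D - 1) * B powr - T = B powr (- D - 1)"
        by (simp add: powr_add[symmetric])
      also have "Z * B powr (- D - 1) < B * B powr (- D - 1)"
        using B1 by (intro mult_strict_right_mono) auto
      also have "B * B powr (- D - 1) = B powr - D"
        using B1 by (simp add: powr_diff)
      finally show ?thesis .
    qed
    moreover have "real_of_int \<bar>a m\<bar> \<le> B powr (T - D - 1)" if "m \<in> J" for m
      using aH[OF that] H(2) by simp
    ultimately show "\<exists>a :: 'm \<Rightarrow> int. (\<exists>m\<in>J. a m \<noteq> 0) \<and> (\<forall>m\<in>J. real_of_int \<bar>a m\<bar> \<le> B powr (T - D - 1)) \<and>
        (\<forall>x\<in>X. \<bar>\<Sum>m\<in>J. of_int (a m) * f x m\<bar> < B powr - D)"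
      using a(1) by blast
  qed
qed

section \<open>Forms with coprime coefficients\<close>

abbreviation mon_eval :: "nat \<Rightarrow> (nat \<Rightarrow> 'a::comm_ring_1) \<Rightarrow> monomial \<Rightarrow> 'a" where
  "mon_eval n x m \<equiv> (\<Prod>l<n. x l ^ lookup m l)"

abbreviation primitive_form :: "nat \<Rightarrow> nat \<Rightarrow> real \<Rightarrow> int_mpoly \<Rightarrow> bool" where
  "primitive_form n D H A \<equiv> A \<in> forms n D \<and> coprime_coeffs A \<and> (\<forall>m. real_of_int \<bar>lookup A m\<bar> \<le> H)"

text \<open>Dividing by the gcd of the coefficients keeps the zeros and can only shrink the
  coefficients.\<close>

lemma exists_primitive_form:
  fixes a :: "monomial \<Rightarrow> int"
  assumes n: "n > 0" and a: "\<exists>m\<in>monoms n D. a m \<noteq> 0" "\<And>m. m \<in> monoms n D \<Longrightarrow> real_of_int \<bar>a m\<bar> \<le> H"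
  shows "\<exists>A\<in>forms n D. coprime_coeffs A \<and> (\<forall>m. real_of_int \<bar>lookup A m\<bar> \<le> H) \<and>
    (\<forall>x :: nat \<Rightarrow> int. (\<Sum>m\<in>monoms n D. a m * mon_eval n x m) = 0 \<longrightarrow> eval x A = 0)"
proof -
  note fin = finite_monoms[OF n, of D]
  define g where "g = Gcd (a ` monoms n D)"
  define b where "b m = (if m \<in> monoms n D then a m div g else 0)" for m
  define A where "A = Abs_poly_mapping b"
  have "finite {m. b m \<noteq> 0}" by (rule finite_subset[OF _ fin]) (auto simp: b_def)
  hence lookup: "lookup A = b" unfolding A_def by (rule lookup_Abs_poly_mapping)
  have g: "a m = g * b m" if "m \<in> monoms n D" for m
    using that by (simp add: b_def g_def)
  obtain m0 where m0: "m0 \<in> monoms n D" "a m0 \<noteq> 0" using a by blast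
  have g0: "g \<noteq> 0" using g[OF m0(1)] m0(2) by auto
  have sub: "keys A \<subseteq> monoms n D"
  proof
    fix m assume "m \<in> keys A"
    hence "b m \<noteq> 0" by (simp add: in_keys_iff lookup)
    thus "m \<in> monoms n D" by (auto simp: b_def split: if_splits)
  qed
  have "b m0 \<noteq> 0" using g[OF m0(1)] m0(2) by auto
  hence "A \<noteq> 0" using lookup by auto
  hence form: "A \<in> forms n D"
    using sub by (auto simp: forms_def int_polys_def homogeneous_def monoms_def)
  define d where "d = Gcd (lookup A ` keys A)"
  have "g * d dvd a m" if m: "m \<in> monoms n D" for m
  proof -
    have "d dvd b m"
    proof (cases "m \<in> keys A")
      case True
      thus ?thesis unfolding d_def lookup by (intro Gcd_dvd) auto
    next
      case False
      thus ?thesis by (simp add: in_keys_iff lookup)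
    qed
    thus ?thesis using g[OF m] by simp
  qed
  \<comment> \<open>A common divisor \<open>d\<close> of the quotients would make g d divide every
    coefficient, hence \<open>g\<close>.\<close>
  hence "g * d dvd g" unfolding g_def by (intro Gcd_greatest) auto
  hence "d dvd 1" using g0 dvd_times_left_cancel_iff[of g d 1] by simp
  hence "coprime_coeffs A" unfolding coprime_coeffs_def d_def[symmetric]
    using Gcd_int_greater_eq_0[of "lookup A ` keys A"]
    by (simp add: d_def[symmetric])
  moreover have "real_of_int \<bar>lookup A m\<bar> \<le> H" for m
  proof (cases "m \<in> monoms n D")
    case True
    have "\<bar>b m\<bar> * 1 \<le> \<bar>b m\<bar> * \<bar>g\<bar>" using g0 by (intro mult_left_mono) auto
    also have "\<dots> = \<bar>a m\<bar>" using g[OF True] by (simp add: abs_mult mult.commute)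
    finally show ?thesis using a(2)[OF True] unfolding lookup by linarith
  next
    case False
    have "0 \<le> H" using a(2)[OF m0(1)] by (rule order.trans[rotated]) simp
    thus ?thesis using False by (simp add: lookup b_def)
  qed
  moreover have "eval x A = 0" if "(\<Sum>m\<in>monoms n D. a m * mon_eval n x m) = 0" for x :: "nat \<Rightarrow> int"
  proof -
    have "(\<Sum>m\<in>monoms n D. a m * mon_eval n x m) = g * (\<Sum>m\<in>monoms n D. b m * mon_eval n x m)"
      unfolding sum_distrib_left by (intro sum.cong refl) (simp add: g)
    moreover have "(\<Sum>m\<in>monoms n D. b m * mon_eval n x m) = eval x A"
      using eval_lessThan[OF forms_int_polys[OF form] sub fin, of x] by (simp add: lookup)
    ultimately show ?thesis using that g0 by simp
  qed
  ultimately show ?thesis using form by blast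
qed

lemma line_form:
  fixes p q :: int
  assumes n: "n \<ge> 2" and D: "D > 0" and H: "real_of_int \<bar>p\<bar> \<le> H" "real_of_int \<bar>q\<bar> \<le> H" "1 \<le> H"
  shows "\<exists>A\<in>forms n D. coprime_coeffs A \<and> (\<forall>m. real_of_int \<bar>lookup A m\<bar> \<le> H) \<and>
    (\<forall>x :: nat \<Rightarrow> int. x 0 = p \<and> x 1 = q \<longrightarrow> eval x A = 0)"
proof -
  define m0 :: monomial where "m0 = single 0 D"
  define m1 :: monomial where "m1 = single 1 1 + single 0 (D - 1)"
  have l0: "lookup m0 l = (if l = 0 then D else 0)" for l
    by (simp add: m0_def lookup_single when_def)
  have l1: "lookup m1 l = (if l = 0 then D - 1 else if l = 1 then 1 else 0)" for l
    by (simp add: m1_def lookup_add lookup_single when_def)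
  have "lookup m0 1 \<noteq> lookup m1 1" unfolding l0 l1 by simp
  hence ne: "m0 \<noteq> m1" by auto
  have ks: "keys m0 \<subseteq> {..<n}" "keys m1 \<subseteq> {..<n}"
    using n by (auto simp: in_keys_iff l0 l1 split: if_splits)
  have two: "{0, 1} \<subseteq> {..<n}" using n by auto
  have prod2: "(\<Prod>l<n. f l) = f 0 * f 1" if "\<And>l. l \<noteq> 0 \<Longrightarrow> l \<noteq> 1 \<Longrightarrow> f l = 1" for f :: "nat \<Rightarrow> int"
  proof -
    have "(\<Prod>l<n. f l) = (\<Prod>l\<in>{0, 1}. f l)"
      by (rule prod.mono_neutral_right) (use two that in auto)
    thus ?thesis by simp
  qed
  have sum2: "(\<Sum>l<n. f l) = f 0 + f 1" if "\<And>l. l \<noteq> 0 \<Longrightarrow> l \<noteq> 1 \<Longrightarrow> f l = 0" for f :: "nat \<Rightarrow> nat"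
  proof -
    have "(\<Sum>l<n. f l) = (\<Sum>l\<in>{0, 1}. f l)"
      by (rule sum.mono_neutral_right) (use two that in auto)
    thus ?thesis by simp
  qed
  have "mon_degree m0 = D" "mon_degree m1 = D"
    unfolding mon_degree_lessThan[OF ks(1)] mon_degree_lessThan[OF ks(2)] using D n
    by (simp_all add: sum2 l0 l1)
  hence mem: "m0 \<in> monoms n D" "m1 \<in> monoms n D" using ks by (auto simp: monoms_def)
  \<comment> \<open>The form (p x_1 - q x_0) x_0^(D-1). For p = q = 0 it would be the zero
    polynomial, so x_0^D is taken instead.\<close>
  define a where "a m = (if m = m1 then p else if m = m0 then (if p = 0 \<and> q = 0 then 1 else - q) else 0)" for m
  have zero: "(\<Sum>m\<in>monoms n D. a m * mon_eval n x m) = 0" if x: "x 0 = p" "x 1 = q" for x :: "nat \<Rightarrow> int"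
  proof -
    have "(\<Sum>m\<in>monoms n D. a m * mon_eval n x m) = (\<Sum>m\<in>{m0, m1}. a m * mon_eval n x m)"
      using mem n by (intro sum.mono_neutral_right finite_monoms) (auto simp: a_def)
    also have "\<dots> = a m0 * mon_eval n x m0 + a m1 * mon_eval n x m1" using ne by simp
    also have "mon_eval n x m0 = p ^ D" using x by (subst prod2) (auto simp: l0)
    also have "mon_eval n x m1 = p ^ (D - 1) * q" using x by (subst prod2) (auto simp: l1)
    also have "a m0 * p ^ D + a m1 * (p ^ (D - 1) * q) = 0"
      using D ne by (cases D) (auto simp: a_def)
    finally show ?thesis .
  qed
  have "\<exists>m\<in>monoms n D. a m \<noteq> 0"
    using mem ne by (cases "p = 0") (auto simp: a_def intro: bexI[of _ m0] bexI[of _ m1])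
  moreover have "real_of_int \<bar>a m\<bar> \<le> H" for m using H by (auto simp: a_def)
  moreover have "n > 0" using n by simp
  ultimately obtain A where "A \<in> forms n D" "coprime_coeffs A" "\<forall>m. real_of_int \<bar>lookup A m\<bar> \<le> H"
    "\<forall>x :: nat \<Rightarrow> int. (\<Sum>m\<in>monoms n D. a m * mon_eval n x m) = 0 \<longrightarrow> eval x A = 0"
    using exists_primitive_form[of n D a H] by blast
  thus ?thesis using zero by (intro bexI[of _ A]) auto
qed

text \<open>One form for each possible pair (x_0, x_1). This serves where B^2 is affordable: for n
  large compared with k, and for B below a fixed threshold.\<close>

lemma quadratic_cover:
  assumes n: "n \<ge> 2" and D: "D > 0" and B: "B \<ge> 1"
  shows "\<exists>\<A>. finite \<A> \<and> real (card \<A>) \<le> 9 * B ^ 2 \<and>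
    (\<forall>A\<in>\<A>. primitive_form n D B A) \<and>
    (\<forall>x :: nat \<Rightarrow> int. (\<forall>l<n. real_of_int \<bar>x l\<bar> \<le> B) \<longrightarrow> (\<exists>A\<in>\<A>. eval x A = 0))"
proof -
  define R where "R = {- \<lfloor>B\<rfloor>..\<lfloor>B\<rfloor>}"
  have R: "r \<in> R \<longleftrightarrow> real_of_int \<bar>r\<bar> \<le> B" for r
  proof -
    have "r \<in> R \<longleftrightarrow> \<bar>r\<bar> \<le> \<lfloor>B\<rfloor>" unfolding R_def by auto
    also have "\<dots> \<longleftrightarrow> real_of_int \<bar>r\<bar> \<le> B" by (rule le_floor_iff)
    finally show ?thesis .
  qed
  have "\<forall>pq\<in>R \<times> R. \<exists>A. primitive_form n D B A \<and>
    (\<forall>x :: nat \<Rightarrow> int. x 0 = fst pq \<and> x 1 = snd pq \<longrightarrow> eval x A = 0)"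
  proof
    fix pq assume "pq \<in> R \<times> R"
    hence "real_of_int \<bar>fst pq\<bar> \<le> B" "real_of_int \<bar>snd pq\<bar> \<le> B"
      using R[of "fst pq"] R[of "snd pq"] by (simp_all add: mem_Times_iff)
    from line_form[OF n D this B] obtain A where "A \<in> forms n D" "coprime_coeffs A \<and>
      (\<forall>m. real_of_int \<bar>lookup A m\<bar> \<le> B) \<and>
      (\<forall>x :: nat \<Rightarrow> int. x 0 = fst pq \<and> x 1 = snd pq \<longrightarrow> eval x A = 0)" by (elim bexE)
    thus "\<exists>A. primitive_form n D B A \<and>
      (\<forall>x :: nat \<Rightarrow> int. x 0 = fst pq \<and> x 1 = snd pq \<longrightarrow> eval x A = 0)"
      by blast
  qed
  from bchoice[OF this] obtain f where f: "\<forall>pq\<in>R \<times> R. primitive_form n D B (f pq) \<and>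
    (\<forall>x :: nat \<Rightarrow> int. x 0 = fst pq \<and> x 1 = snd pq \<longrightarrow> eval x (f pq) = 0)" by (elim exE)
  have fin: "finite (R \<times> R)" by (simp add: R_def)
  show ?thesis
  proof (intro exI[of _ "f ` (R \<times> R)"] conjI allI impI)
    show "finite (f ` (R \<times> R))" using fin by simp
    have "card (f ` (R \<times> R)) \<le> card R * card R"
      using card_image_le[OF fin, of f] by (simp add: card_cartesian_product)
    moreover have "real (card R) \<le> 3 * B"
    proof -
      have "real (card R) = 2 * real_of_int \<lfloor>B\<rfloor> + 1" using B by (simp add: R_def)
      thus ?thesis using B of_int_floor_le[of B] by linarith
    qed
    ultimately show "real (card (f ` (R \<times> R))) \<le> 9 * B ^ 2"
    proof -
      assume 1: "card (f ` (R \<times> R)) \<le> card R * card R" and 2: "real (card R) \<le> 3 * B"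
      have "real (card (f ` (R \<times> R))) \<le> real (card R) * real (card R)"
        using 1 by (simp only: of_nat_mult[symmetric] of_nat_le_iff)
      also have "\<dots> \<le> (3 * B) * (3 * B)" using 2 by (intro mult_mono) auto
      finally show ?thesis by (simp add: power2_eq_square)
    qed
    show "\<forall>A\<in>f ` (R \<times> R). primitive_form n D B A"
    proof
      fix A assume "A \<in> f ` (R \<times> R)"
      then obtain pq where "pq \<in> R \<times> R" "A = f pq" by blast
      with bspec[OF f this(1)] show "primitive_form n D B A"
        by simp
    qed
    fix x :: "nat \<Rightarrow> int" assume x: "\<forall>l<n. real_of_int \<bar>x l\<bar> \<le> B"
    have "0 < n" "1 < n" using n by auto
    hence "x 0 \<in> R" "x 1 \<in> R" using x R[of "x 0"] R[of "x 1"] by blast+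
    hence "(x 0, x 1) \<in> R \<times> R" by simp
    from bspec[OF f this] have "eval x (f (x 0, x 1)) = 0" by simp
    thus "\<exists>A\<in>f ` (R \<times> R). eval x A = 0" using \<open>(x 0, x 1) \<in> R \<times> R\<close> by blast
  qed
qed

lemma eval_single_monoms:
  assumes "m \<in> monoms n D"
  shows "eval x (single m 1) = mon_eval n x m" "single m 1 \<in> forms n D"
proof -
  have k: "keys m \<subseteq> {..<n}" using assms by (simp add: monoms_def)
  show "eval x (single m 1) = mon_eval n x m"
    unfolding eval_single prod_keys_lessThan[OF k] by simp
  have "single m (1::int) \<noteq> 0" by (metis lookup_single_eq lookup_zero zero_neq_one)
  thus "single m 1 \<in> forms n D"
    using assms by (auto simp: forms_def int_polys_def homogeneous_def monoms_def split: if_splits)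
qed

lemma mon_eval_divide:
  fixes x :: "nat \<Rightarrow> int"
  assumes "m \<in> monoms n D" "x j \<noteq> 0"
  shows "real_of_int (mon_eval n x m) = real_of_int (x j) ^ D * mon_eval n (\<lambda>l. real_of_int (x l) / real_of_int (x j)) m"
proof -
  have "D = (\<Sum>l<n. lookup m l)" using assms mon_degree_lessThan[of m n] by (simp add: monoms_def)
  hence "real_of_int (x j) ^ D = (\<Prod>l<n. real_of_int (x j) ^ lookup m l)" by (simp add: power_sum)
  hence "real_of_int (x j) ^ D * mon_eval n (\<lambda>l. real_of_int (x l) / real_of_int (x j)) m =
    (\<Prod>l<n. (real_of_int (x j) * (real_of_int (x l) / real_of_int (x j))) ^ lookup m l)"
    by (simp only: prod.distrib[symmetric] power_mult_distrib)
  thus ?thesis using assms(2) by simp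
qed

section \<open>Forms vanishing on patches\<close>

definition aff_point :: "nat \<Rightarrow> (nat \<Rightarrow> int) \<Rightarrow> nat \<Rightarrow> real" where
  "aff_point j x = (\<lambda>l. real_of_int (x l) / real_of_int (x j))"

abbreviation vanishing_form :: "nat \<Rightarrow> nat \<Rightarrow> real \<Rightarrow> (nat \<Rightarrow> int) set \<Rightarrow> bool" where
  "vanishing_form n D H X \<equiv> \<exists>A\<in>forms n D. coprime_coeffs A \<and> (\<forall>m. real_of_int \<bar>lookup A m\<bar> \<le> H) \<and>
     (\<forall>x\<in>X. eval x A = 0)"

abbreviation near_point where
  "near_point n F i j c C \<alpha> \<beta> B p X \<equiv> (\<forall>l<n. \<bar>p l\<bar> \<le> 1) \<and> p j = 1 \<and> c \<le> \<bar>eval p (partial_deriv i F)\<bar> \<and>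
     (\<forall>x\<in>X. x j \<noteq> 0 \<and> real_of_int \<bar>x j\<bar> \<le> B \<and> (\<forall>l<n. \<bar>aff_point j x l - p l\<bar> \<le> C * B powr - \<alpha>) \<and>
        \<bar>eval (aff_point j x) F - eval p F\<bar> \<le> C * B powr - \<beta>)"

abbreviation degree_bound :: "nat \<Rightarrow> real \<Rightarrow> real \<Rightarrow> real \<Rightarrow> nat \<Rightarrow> bool" where
  "degree_bound n \<alpha> \<beta> T D \<equiv> (T + (real (n - 2) * \<alpha> + \<beta>)) ^ n / (fact n * (\<alpha> ^ (n - 2) * \<beta>)) <
      real D ^ (n - 1) / fact (n - 1) * (T - D - 1)"

lemma form_vanishing_near_point:
  fixes \<alpha> \<beta> T c C :: real and n k D i j :: nat
  assumes n: "n \<ge> 2" and F: "F \<in> forms n k" "k > 0" and ij: "i < n" "j < n" "i \<noteq> j"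
    and c: "c > 0" and C: "C \<ge> 1" and \<alpha>: "0 < \<alpha>" "\<alpha> \<le> \<beta>" and T: "T \<ge> 0"
    and ineq: "degree_bound n \<alpha> \<beta> T D"
  shows "\<exists>B0\<ge>1. \<forall>B\<ge>B0. \<forall>(p :: nat \<Rightarrow> real) X. near_point n F i j c C \<alpha> \<beta> B p X \<longrightarrow>
     vanishing_form n D (B powr (T - D - 1)) X"
proof -
  \<comment> \<open>Truncation at order N leaves an error of size B^(-\<alpha> N), and \<alpha> N
    \<ge> T.\<close>
  define N where "N = nat \<lceil>T / \<alpha>\<rceil>"
  have "T / \<alpha> \<le> N" unfolding N_def by linarith
  hence N: "T \<le> \<alpha> * N" using \<alpha> by (simp add: field_simps)
  define W where "W = insert n ({..<n} - {i, j})"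
  define I where "I = PiE W (\<lambda>_. {..<N})"
  define J where "J = monoms n D"
  \<comment> \<open>The coordinate with index \<open>n\<close>, the displacement of F, is smaller
    than the others and has the weight \<beta>.\<close>
  define \<omega> where "\<omega> l = (if l = n then \<beta> else \<alpha>)" for l :: nat
  have n0: "n > 0" using n by simp
  have finW: "finite W" and finJ: "finite J" using n0 by (auto simp: W_def J_def finite_monoms)
  have cardV: "card ({..<n} - {i, j}) = n - 2" using ij by (subst card_Diff_subset) auto
  hence cardW: "card W = n - 1" using n by (simp add: W_def)
  have sumW: "(\<Sum>l\<in>W. \<omega> l) = real (n - 2) * \<alpha> + \<beta>"
  proof -
    have "(\<Sum>l\<in>{..<n} - {i, j}. \<omega> l) = (\<Sum>l\<in>{..<n} - {i, j}. \<alpha>)" by (intro sum.cong) (auto simp: \<omega>_def)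
    thus ?thesis using cardV by (simp add: W_def \<omega>_def)
  qed
  have prodW: "(\<Prod>l\<in>W. \<omega> l) = \<alpha> ^ (n - 2) * \<beta>"
  proof -
    have "(\<Prod>l\<in>{..<n} - {i, j}. \<omega> l) = (\<Prod>l\<in>{..<n} - {i, j}. \<alpha>)" by (intro prod.cong) (auto simp: \<omega>_def)
    thus ?thesis using cardV by (simp add: W_def \<omega>_def)
  qed
  have \<omega>: "\<omega> l > 0" for l using \<alpha> by (simp add: \<omega>_def)
  let ?expand = "\<lambda>m K. \<forall>(p :: nat \<Rightarrow> real) X r. (\<forall>l<n. \<bar>p l\<bar> \<le> 1) \<and> c \<le> \<bar>eval p (partial_deriv i F)\<bar> \<and> 0 < r \<and> r \<le> 1 \<and>
    (\<forall>u\<in>X. u j = p j \<and> (\<forall>l<n. \<bar>u l - p l\<bar> \<le> C * r) \<and> \<bar>eval u F - eval p F\<bar> \<le> C * r) \<longrightarrow>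
    (\<exists>b. (\<forall>e\<in>I. \<bar>b e\<bar> \<le> K) \<and>
       (\<forall>u\<in>X. \<bar>eval u (single m 1) - (\<Sum>e\<in>I. b e * mon_val W e (local_coords n F p u))\<bar> \<le> K * r ^ N))"
  have "\<forall>m\<in>J. \<exists>K. K \<ge> 0 \<and> ?expand m K"
  proof
    fix m assume "m \<in> J"
    hence P: "single m 1 \<in> forms n D" unfolding J_def by (rule eval_single_monoms)
    have "C \<ge> 0" using C by simp
    from local_expansion[OF F P ij c this, where N = N]
    show "\<exists>K. K \<ge> 0 \<and> ?expand m K"
      unfolding I_def W_def .
  qed
  from bchoice[OF this] obtain \<kappa> where \<kappa>': "\<forall>m\<in>J. \<kappa> m \<ge> 0 \<and> ?expand m (\<kappa> m)"
    by (elim exE)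
  have \<kappa>0: "\<kappa> m \<ge> 0" if "m \<in> J" for m using bspec[OF \<kappa>' that] by (rule conjunct1)
  note \<kappa> = bspec[OF \<kappa>', THEN conjunct2, THEN spec, THEN spec, THEN spec, THEN mp]
  define K where "K = (\<Sum>m\<in>J. \<kappa> m) + 1"
  have \<kappa>K: "\<kappa> m \<le> K" if "m \<in> J" for m
    using member_le_sum[of m J \<kappa>] \<kappa>0 that finJ by (simp add: K_def)
  have K: "K > 0" using sum_nonneg[of J \<kappa>] \<kappa>0 by (simp add: K_def)
  define wt where "wt e = (\<Sum>l\<in>W. real (e l) * \<omega> l)" for e :: "nat \<Rightarrow> nat"
  have less: "(\<Sum>e\<in>I. max 0 (T - wt e)) < card J * (T - D - 1)"
  proof -
    \<comment> \<open>The box bound with q = 1: the n - 1 coordinates of \<open>W\<close> raise the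
      power to n, matching the growth D^n of the right side.\<close>
    have "(\<Sum>e\<in>I. max 0 (T - wt e)) \<le> fact 1 / fact (1 + card W) * max 0 (T + (\<Sum>l\<in>W. \<omega> l)) ^ (1 + card W) / (\<Prod>l\<in>W. \<omega> l)"
      using sum_positive_part_box[of W \<omega> 1 T N] finW \<omega> by (simp add: I_def wt_def)
    also have "1 + card W = n" using n cardW by simp
    also have "max 0 (T + (\<Sum>l\<in>W. \<omega> l)) = T + (real (n - 2) * \<alpha> + \<beta>)"
      using T \<alpha> unfolding sumW by (intro max_absorb2 add_nonneg_nonneg mult_nonneg_nonneg) auto
    also have "fact 1 / fact n * (T + (real (n - 2) * \<alpha> + \<beta>)) ^ n / (\<Prod>l\<in>W. \<omega> l) =
      (T + (real (n - 2) * \<alpha> + \<beta>)) ^ n / (fact n * (\<alpha> ^ (n - 2) * \<beta>))"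
      unfolding prodW by simp
    also note ineq
    also have "real D ^ (n - 1) / fact (n - 1) * (T - D - 1) \<le> card J * (T - D - 1)"
    proof (rule mult_right_mono)
      show "real D ^ (n - 1) / fact (n - 1) \<le> card J" using card_monoms_ge[OF n0, of D] by (simp add: J_def)
      have "0 \<le> (T + (real (n - 2) * \<alpha> + \<beta>)) ^ n / (fact n * (\<alpha> ^ (n - 2) * \<beta>))"
        using T \<alpha> by (intro divide_nonneg_nonneg mult_nonneg_nonneg zero_le_power add_nonneg_nonneg) auto
      with ineq have "0 < real D ^ (n - 1) / fact (n - 1) * (T - D - 1)" by linarith
      moreover have "0 \<le> real D ^ (n - 1) / fact (n - 1)" by simp
      ultimately show "0 \<le> T - D - 1" by (metis less_eq_real_def zero_less_mult_pos2 zero_less_mult_iff)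
    qed
    finally show ?thesis .
  qed
  obtain B0 where B0: "B0 \<ge> 1" "\<forall>B\<ge>B0. \<forall>(X :: (nat \<Rightarrow> int) set) \<zeta> f b.
     (\<forall>x\<in>X. \<forall>l\<in>W. \<bar>\<zeta> x l\<bar> \<le> C * B powr - \<omega> l) \<and> (\<forall>m\<in>J. \<forall>e\<in>I. \<bar>b m e\<bar> \<le> K) \<and>
     (\<forall>x\<in>X. \<forall>m\<in>J. \<bar>f x m - (\<Sum>e\<in>I. b m e * mon_val W e (\<zeta> x))\<bar> \<le> K * B powr - T) \<longrightarrow>
     (\<exists>a :: monomial \<Rightarrow> int. (\<exists>m\<in>J. a m \<noteq> 0) \<and> (\<forall>m\<in>J. real_of_int \<bar>a m\<bar> \<le> B powr (T - D - 1)) \<and>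
        (\<forall>x\<in>X. \<bar>\<Sum>m\<in>J. of_int (a m) * f x m\<bar> < B powr - D))"
    using small_combination[OF finJ finW \<omega> K C less[unfolded I_def wt_def]] unfolding I_def[symmetric] by blast
  show ?thesis
  proof (intro exI[of _ B0] conjI B0(1) allI impI)
    fix B :: real and p :: "nat \<Rightarrow> real" and X :: "(nat \<Rightarrow> int) set"
    assume B: "B \<ge> B0" and hyp: "near_point n F i j c C \<alpha> \<beta> B p X"
    have B1: "B \<ge> 1" using B B0 by simp
    let ?r = "B powr - \<alpha>"
    have r: "0 < ?r" "?r \<le> 1" "B powr - \<beta> \<le> ?r"
      using B1 \<alpha> powr_mono[of "- \<alpha>" 0 B] powr_mono[of "- \<beta>" "- \<alpha>" B] by auto
    have rN: "?r ^ N \<le> B powr - T"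
      using B1 N by (simp add: powr_realpow[symmetric] powr_powr powr_mono)
    have x0: "x j \<noteq> 0" "real_of_int \<bar>x j\<bar> \<le> B" "\<And>l. l < n \<Longrightarrow> \<bar>aff_point j x l - p l\<bar> \<le> C * ?r"
        "\<bar>eval (aff_point j x) F - eval p F\<bar> \<le> C * B powr - \<beta>" if "x \<in> X" for x
      using hyp that by blast+
    have cond: "(\<forall>l<n. \<bar>p l\<bar> \<le> 1) \<and> c \<le> \<bar>eval p (partial_deriv i F)\<bar> \<and> 0 < ?r \<and> ?r \<le> 1 \<and>
      (\<forall>u\<in>aff_point j ` X. u j = p j \<and> (\<forall>l<n. \<bar>u l - p l\<bar> \<le> C * ?r) \<and> \<bar>eval u F - eval p F\<bar> \<le> C * ?r)"
    proof (intro conjI ballI)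
      show "\<forall>l<n. \<bar>p l\<bar> \<le> 1" "c \<le> \<bar>eval p (partial_deriv i F)\<bar>" using hyp by blast+
      show "0 < ?r" "?r \<le> 1" by (fact r)+
      fix u assume "u \<in> aff_point j ` X"
      then obtain x where x: "x \<in> X" "u = aff_point j x" by auto
      show "u j = p j" using x0(1)[OF x(1)] hyp by (simp add: x aff_point_def)
      show "\<forall>l<n. \<bar>u l - p l\<bar> \<le> C * ?r" using x0(3)[OF x(1)] by (simp add: x)
      have "C * B powr - \<beta> \<le> C * ?r" using C r by (intro mult_left_mono) auto
      thus "\<bar>eval u F - eval p F\<bar> \<le> C * ?r" using x0(4)[OF x(1)] unfolding x(2) by linarith
    qed
    have "\<forall>m\<in>J. \<exists>b. (\<forall>e\<in>I. \<bar>b e\<bar> \<le> \<kappa> m) \<and>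
       (\<forall>u\<in>aff_point j ` X. \<bar>eval u (single m 1) - (\<Sum>e\<in>I. b e * mon_val W e (local_coords n F p u))\<bar> \<le> \<kappa> m * ?r ^ N)"
      by (rule ballI, rule \<kappa>[OF _ cond])
    from bchoice[OF this] obtain b where b: "\<forall>m\<in>J. (\<forall>e\<in>I. \<bar>b m e\<bar> \<le> \<kappa> m) \<and>
       (\<forall>u\<in>aff_point j ` X. \<bar>eval u (single m 1) - (\<Sum>e\<in>I. b m e * mon_val W e (local_coords n F p u))\<bar> \<le> \<kappa> m * ?r ^ N)"
      by (elim exE)
    let ?\<zeta> = "\<lambda>x. local_coords n F p (aff_point j x)" and ?f = "\<lambda>x m. mon_eval n (aff_point j x) m"
    have "(\<forall>x\<in>X. \<forall>l\<in>W. \<bar>?\<zeta> x l\<bar> \<le> C * B powr - \<omega> l) \<and> (\<forall>m\<in>J. \<forall>e\<in>I. \<bar>b m e\<bar> \<le> K) \<and>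
     (\<forall>x\<in>X. \<forall>m\<in>J. \<bar>?f x m - (\<Sum>e\<in>I. b m e * mon_val W e (?\<zeta> x))\<bar> \<le> K * B powr - T)"
    proof (intro conjI ballI)
      fix x l assume x: "x \<in> X" and l: "l \<in> W"
      show "\<bar>?\<zeta> x l\<bar> \<le> C * B powr - \<omega> l"
      proof (cases "l = n")
        case True
        thus ?thesis using x0(4)[OF x] by (simp add: local_coords_def \<omega>_def)
      next
        case False
        thus ?thesis using x0(3)[OF x, of l] l by (simp add: local_coords_def \<omega>_def W_def)
      qed
    next
      fix m e assume m: "m \<in> J" and e: "e \<in> I"
      have "\<bar>b m e\<bar> \<le> \<kappa> m" using bspec[OF bspec[OF b m, THEN conjunct1] e] .
      thus "\<bar>b m e\<bar> \<le> K" using \<kappa>K[OF m] by linarith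
    next
      fix x m assume x: "x \<in> X" and m: "m \<in> J"
      have "\<bar>eval (aff_point j x) (single m 1) - (\<Sum>e\<in>I. b m e * mon_val W e (?\<zeta> x))\<bar> \<le> \<kappa> m * ?r ^ N"
        using bspec[OF bspec[OF b m, THEN conjunct2] imageI[OF x]] .
      also have "\<dots> \<le> K * B powr - T" using \<kappa>K[OF m] K rN by (intro mult_mono) auto
      finally show "\<bar>?f x m - (\<Sum>e\<in>I. b m e * mon_val W e (?\<zeta> x))\<bar> \<le> K * B powr - T"
        using eval_single_monoms(1)[of m n D "aff_point j x"] m by (simp add: J_def)
    qed
    from B0(2)[THEN spec[of _ B], THEN mp, OF B, THEN spec[of _ X], THEN spec[of _ ?\<zeta>], THEN spec[of _ ?f], THEN spec[of _ b], THEN mp, OF this]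
    obtain a :: "monomial \<Rightarrow> int" where a: "\<exists>m\<in>J. a m \<noteq> 0" "\<forall>m\<in>J. real_of_int \<bar>a m\<bar> \<le> B powr (T - D - 1)"
      "\<forall>x\<in>X. \<bar>\<Sum>m\<in>J. of_int (a m) * ?f x m\<bar> < B powr - D"
      by (elim exE conjE)
    have zero: "(\<Sum>m\<in>monoms n D. a m * mon_eval n x m) = 0" if x: "x \<in> X" for x
    proof -
      have xj: "real_of_int \<bar>x j\<bar> > 0" using x0(1)[OF x] by simp
      have "real_of_int (\<Sum>m\<in>J. a m * mon_eval n x m) = (\<Sum>m\<in>J. of_int (a m) * (real_of_int (x j) ^ D * ?f x m))"
        unfolding of_int_sum
      proof (rule sum.cong[OF refl])
        fix m assume "m \<in> J"
        hence "m \<in> monoms n D" by (simp add: J_def)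
        from mon_eval_divide[where x = x and j = j, OF this x0(1)[OF x]]
        show "real_of_int (a m * mon_eval n x m) = of_int (a m) * (real_of_int (x j) ^ D * ?f x m)"
          by (simp only: of_int_mult aff_point_def)
      qed
      also have "\<dots> = real_of_int (x j) ^ D * (\<Sum>m\<in>J. of_int (a m) * ?f x m)"
        unfolding sum_distrib_left by (intro sum.cong refl) (simp only: mult.left_commute)
      finally have "\<bar>real_of_int (\<Sum>m\<in>J. a m * mon_eval n x m)\<bar> =
        real_of_int \<bar>x j\<bar> ^ D * \<bar>\<Sum>m\<in>J. of_int (a m) * ?f x m\<bar>"
        by (simp add: abs_mult power_abs)
      also have "\<dots> < real_of_int \<bar>x j\<bar> ^ D * B powr - D"
        using bspec[OF a(3) x] xj by (intro mult_strict_left_mono) auto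
      also have "\<dots> \<le> B ^ D * B powr - D" using x0(2)[OF x] by (intro mult_right_mono power_mono) auto
      also have "\<dots> = 1" using B1 by (simp add: powr_minus powr_realpow)
      \<comment> \<open>An integer of absolute value less than 1 is 0.\<close>
      finally have "\<bar>\<Sum>m\<in>J. a m * mon_eval n x m\<bar> < 1" by linarith
      thus ?thesis by (simp add: J_def)
    qed
    have "\<exists>m\<in>monoms n D. a m \<noteq> 0" using a(1) by (simp add: J_def)
    moreover have "real_of_int \<bar>a m\<bar> \<le> B powr (T - D - 1)" if "m \<in> monoms n D" for m
      using a(2) that by (simp add: J_def)
    ultimately obtain A where A: "A \<in> forms n D" "coprime_coeffs A" "\<forall>m. real_of_int \<bar>lookup A m\<bar> \<le> B powr (T - D - 1)"
      "\<forall>x :: nat \<Rightarrow> int. (\<Sum>m\<in>monoms n D. a m * mon_eval n x m) = 0 \<longrightarrow> eval x A = 0"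
      using exists_primitive_form[OF n0, of D a "B powr (T - D - 1)"] by blast
    show "vanishing_form n D (B powr (T - D - 1)) X"
      using A zero by (intro bexI[of _ A]) auto
  qed
qed

text \<open>Coordinate \<open>i\<close> is confined only to a cell of constant side \<rho>, because
  F and the other coordinates determine its finer position. This is why n - 2 rather than n - 1
  coordinates enter the number of patches.\<close>

abbreviation on_patch where
  "on_patch n F i j c C \<alpha> \<beta> \<rho> B X \<equiv> X \<noteq> {} \<and>
     (\<forall>x\<in>X. x j \<noteq> 0 \<and> real_of_int \<bar>x j\<bar> \<le> B \<and> (\<forall>l<n. \<bar>aff_point j x l\<bar> \<le> 1) \<and>
        c \<le> \<bar>eval (aff_point j x) (partial_deriv i F)\<bar> \<and> \<bar>eval (aff_point j x) F\<bar> \<le> C * B powr - \<beta>) \<and>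
     (\<forall>x\<in>X. \<forall>y\<in>X. \<forall>l<n. \<bar>aff_point j x l - aff_point j y l\<bar> \<le> (if l = i then \<rho> else B powr - \<alpha>))"

text \<open>Any point of the patch serves as the centre \<open>p\<close>; the bound for the
  dependent coordinate then improves the side \<rho> to O(B^(-\<alpha>)).\<close>

lemma form_vanishing_on_patch:
  fixes \<alpha> \<beta> T c C :: real and n k D i j :: nat
  assumes n: "n \<ge> 2" and F: "F \<in> forms n k" "k > 0" and ij: "i < n" "j < n" "i \<noteq> j"
    and c: "c > 0" and C: "C \<ge> 1" and \<alpha>: "0 < \<alpha>" "\<alpha> \<le> \<beta>" and T: "T \<ge> 0"
    and ineq: "degree_bound n \<alpha> \<beta> T D"
  shows "\<exists>\<rho> B0. 0 < \<rho> \<and> \<rho> \<le> 1 \<and> 1 \<le> B0 \<and> (\<forall>B\<ge>B0. \<forall>X. on_patch n F i j c C \<alpha> \<beta> \<rho> B X \<longrightarrow>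
     vanishing_form n D (B powr (T - D - 1)) X)"
proof -
  \<comment> \<open>Two values of F on the patch, each at most C B^(-\<beta>) in size, differ by at
    most twice that.\<close>
  have "2 * C \<ge> 0" using C by simp
  from dependent_coordinate_bound[OF F ij c this]
  obtain \<rho> C' where \<rho>: "0 < \<rho>" "\<rho> \<le> 1" "1 \<le> C'" "\<forall>(p :: nat \<Rightarrow> real) u r.
      (\<forall>l<n. \<bar>p l\<bar> \<le> 1) \<and> c \<le> \<bar>eval p (partial_deriv i F)\<bar> \<and> u j = p j \<and> 0 < r \<and>
      (\<forall>l<n. l \<noteq> i \<longrightarrow> \<bar>u l - p l\<bar> \<le> r) \<and> \<bar>u i - p i\<bar> \<le> \<rho> \<and> \<bar>eval u F - eval p F\<bar> \<le> 2 * C * r \<longrightarrow>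
      \<bar>u i - p i\<bar> \<le> C' * r"
    by (elim exE conjE)
  define C2 where "C2 = max C' (2 * C)"
  have C2: "C2 \<ge> 1" "C' \<le> C2" "2 * C \<le> C2" using \<rho> by (auto simp: C2_def)
  from form_vanishing_near_point[OF n F ij c C2(1) \<alpha> T ineq]
  obtain B0 where B0: "B0 \<ge> 1" "\<forall>B\<ge>B0. \<forall>(p :: nat \<Rightarrow> real) X. near_point n F i j c C2 \<alpha> \<beta> B p X \<longrightarrow>
     vanishing_form n D (B powr (T - D - 1)) X"
    by (elim exE conjE)
  show ?thesis
  proof (rule exI[of _ \<rho>], rule exI[of _ B0], intro conjI \<rho>(1,2) B0(1) allI impI)
    fix B :: real and X :: "(nat \<Rightarrow> int) set"
    assume B: "B \<ge> B0" and hyp: "on_patch n F i j c C \<alpha> \<beta> \<rho> B X"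
    have B1: "B \<ge> 1" using B B0 by simp
    have pts: "x j \<noteq> 0" "real_of_int \<bar>x j\<bar> \<le> B" "\<forall>l<n. \<bar>aff_point j x l\<bar> \<le> 1"
      "c \<le> \<bar>eval (aff_point j x) (partial_deriv i F)\<bar>" "\<bar>eval (aff_point j x) F\<bar> \<le> C * B powr - \<beta>" if "x \<in> X" for x
      using hyp that by blast+
    have close: "\<bar>aff_point j x l - aff_point j y l\<bar> \<le> (if l = i then \<rho> else B powr - \<alpha>)"
      if "x \<in> X" "y \<in> X" "l < n" for x y l
      using hyp that by blast
    obtain x0 where x0: "x0 \<in> X" using hyp by blast
    let ?p = "aff_point j x0" and ?r = "B powr - \<alpha>"
    have r: "0 < ?r" "B powr - \<beta> \<le> ?r" using B1 \<alpha> by (auto intro: powr_mono)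
    have one: "aff_point j x j = 1" if "x \<in> X" for x using pts(1)[OF that] by (simp add: aff_point_def)
    have diff: "\<bar>eval (aff_point j x) F - eval ?p F\<bar> \<le> 2 * C * B powr - \<beta>" if "x \<in> X" for x
      using pts(5)[OF that] pts(5)[OF x0] by linarith
    have "near_point n F i j c C2 \<alpha> \<beta> B ?p X"
    proof (intro conjI ballI)
      show "\<forall>l<n. \<bar>?p l\<bar> \<le> 1" "?p j = 1" "c \<le> \<bar>eval ?p (partial_deriv i F)\<bar>"
        by (fact pts(3)[OF x0] one[OF x0] pts(4)[OF x0])+
      fix x assume x: "x \<in> X"
      show "x j \<noteq> 0" "real_of_int \<bar>x j\<bar> \<le> B" by (fact pts(1,2)[OF x])+
      have "2 * C * B powr - \<beta> \<le> C2 * B powr - \<beta>" using C2(3) by (rule mult_right_mono) simp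
      thus "\<bar>eval (aff_point j x) F - eval ?p F\<bar> \<le> C2 * B powr - \<beta>" using diff[OF x] by linarith
      have off: "\<bar>aff_point j x l - ?p l\<bar> \<le> ?r" if "l < n" "l \<noteq> i" for l
        using close[OF x x0 that(1)] that(2) by simp
      have "2 * C * B powr - \<beta> \<le> 2 * C * ?r" using r C by (intro mult_left_mono) auto
      hence "\<bar>eval (aff_point j x) F - eval ?p F\<bar> \<le> 2 * C * ?r" using diff[OF x] by linarith
      moreover have "\<bar>aff_point j x i - ?p i\<bar> \<le> \<rho>" using close[OF x x0 ij(1)] by simp
      moreover have "aff_point j x j = ?p j" using one[OF x] one[OF x0] by simp
      ultimately have i: "\<bar>aff_point j x i - ?p i\<bar> \<le> C' * ?r"
        using pts(3,4)[OF x0] off r(1)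
        by (intro \<rho>(4)[THEN spec[of _ ?p], THEN spec[of _ "aff_point j x"], THEN spec[of _ ?r], THEN mp] conjI allI impI) simp_all
      show "\<forall>l<n. \<bar>aff_point j x l - ?p l\<bar> \<le> C2 * ?r"
      proof (intro allI impI)
        fix l assume l: "l < n"
        have 1: "C' * ?r \<le> C2 * ?r" "1 * ?r \<le> C2 * ?r" using C2 r by (intro mult_right_mono; simp)+
        show "\<bar>aff_point j x l - ?p l\<bar> \<le> C2 * ?r"
        proof (cases "l = i")
          case True
          show ?thesis unfolding True using i 1 by linarith
        next
          case False
          thus ?thesis using off[OF l] 1 by linarith
        qed
      qed
    qed
    from B0(2)[THEN spec[of _ B], THEN mp, OF B, THEN spec[of _ ?p], THEN spec[of _ X], THEN mp, OF this]
    show "vanishing_form n D (B powr (T - D - 1)) X" .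
  qed
qed

lemma gradient_lower_bound_uniform:
  assumes F: "F \<in> forms n k" "nonsingular n F" and n: "n > 0"
  obtains c where "c > 0" "\<And>j (u :: nat \<Rightarrow> real). j < n \<Longrightarrow> u j = 1 \<Longrightarrow> \<forall>l<n. \<bar>u l\<bar> \<le> 1 \<Longrightarrow> \<bar>eval u F\<bar> < c \<Longrightarrow>
    \<exists>i<n. i \<noteq> j \<and> c \<le> \<bar>eval u (partial_deriv i F)\<bar>"
proof -
  have "\<forall>j\<in>{..<n}. \<exists>c. c > 0 \<and> (\<forall>u :: nat \<Rightarrow> real. u j = 1 \<and> (\<forall>l<n. \<bar>u l\<bar> \<le> 1) \<longrightarrow>
           c \<le> \<bar>eval u F\<bar> \<or> (\<exists>i<n. i \<noteq> j \<and> c \<le> \<bar>eval u (partial_deriv i F)\<bar>))"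
    using gradient_lower_bound[OF F] by simp
  from bchoice[OF this] obtain c where c: "\<forall>j\<in>{..<n}. c j > 0 \<and> (\<forall>u :: nat \<Rightarrow> real. u j = 1 \<and> (\<forall>l<n. \<bar>u l\<bar> \<le> 1) \<longrightarrow>
           c j \<le> \<bar>eval u F\<bar> \<or> (\<exists>i<n. i \<noteq> j \<and> c j \<le> \<bar>eval u (partial_deriv i F)\<bar>))" by (elim exE)
  define c0 where "c0 = Min (c ` {..<n})"
  have "{..<n} \<noteq> {}" using n by auto
  hence "c0 \<in> c ` {..<n}" unfolding c0_def by (intro Min_in) auto
  hence "c0 > 0" using c by auto
  moreover have "\<exists>i<n. i \<noteq> j \<and> c0 \<le> \<bar>eval u (partial_deriv i F)\<bar>"
    if "j < n" "u j = 1" "\<forall>l<n. \<bar>u l\<bar> \<le> 1" "\<bar>eval u F\<bar> < c0" for j and u :: "nat \<Rightarrow> real"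
  proof -
    have le: "c0 \<le> c j" unfolding c0_def using that(1) by (intro Min_le) auto
    have "j \<in> {..<n}" using that(1) by simp
    from bspec[OF c this, THEN conjunct2, THEN spec[of _ u]] that(2,3)
    have "c j \<le> \<bar>eval u F\<bar> \<or> (\<exists>i<n. i \<noteq> j \<and> c j \<le> \<bar>eval u (partial_deriv i F)\<bar>)" by blast
    moreover have "\<not> c j \<le> \<bar>eval u F\<bar>" using that(4) le by linarith
    ultimately obtain i where "i < n" "i \<noteq> j" "c j \<le> \<bar>eval u (partial_deriv i F)\<bar>" by blast
    thus ?thesis using le by (intro exI[of _ i]) auto
  qed
  ultimately show ?thesis using that by blast
qed

section \<open>From integer vectors to affine points and grid cells\<close>

lemma S_set_max_coordinate:
  assumes x: "x \<in> S_set \<gamma> n F B" and n: "n > 0"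
  obtains j where "j < n" "\<forall>l<n. \<bar>x l\<bar> \<le> \<bar>x j\<bar>" "B / 2 < real_of_int \<bar>x j\<bar>" "real_of_int \<bar>x j\<bar> \<le> B"
proof -
  let ?M = "Max ((\<lambda>i. \<bar>x i\<bar>) ` {..<n})"
  have "{..<n} \<noteq> {}" using n by auto
  hence "?M \<in> (\<lambda>i. \<bar>x i\<bar>) ` {..<n}" by (intro Max_in) auto
  then obtain j where j: "j < n" "?M = \<bar>x j\<bar>" by auto
  have "\<forall>l<n. \<bar>x l\<bar> \<le> \<bar>x j\<bar>" unfolding j(2)[symmetric] by (auto intro!: Max_ge)
  thus ?thesis using that[of j] j x by (auto simp: S_set_def)
qed

text \<open>The lower bound |x_j| > B / 2 is what makes the normalized value of F small; it is the
  origin of the factor 2^k.\<close>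

lemma S_set_affine:
  assumes x: "x \<in> S_set \<gamma> n F B" and F: "F \<in> forms n k" and B: "B \<ge> 1" and j: "j < n"
    and max: "\<forall>l<n. \<bar>x l\<bar> \<le> \<bar>x j\<bar>" "B / 2 < real_of_int \<bar>x j\<bar>"
  shows "x j \<noteq> 0" "aff_point j x j = 1" "\<forall>l<n. \<bar>aff_point j x l\<bar> \<le> 1"
    "\<bar>eval (aff_point j x) F\<bar> \<le> 2 ^ k * B powr - (real k - \<gamma>)"
proof -
  show x0: "x j \<noteq> 0" using max(2) B by auto
  thus "aff_point j x j = 1" by (simp add: aff_point_def)
  show "\<forall>l<n. \<bar>aff_point j x l\<bar> \<le> 1"
  proof (intro allI impI)
    fix l assume "l < n"
    hence "\<bar>x l\<bar> \<le> \<bar>x j\<bar>" using max(1) by blast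
    hence "real_of_int \<bar>x l\<bar> \<le> real_of_int \<bar>x j\<bar>" by linarith
    thus "\<bar>aff_point j x l\<bar> \<le> 1" using x0 by (simp add: aff_point_def)
  qed
  have "aff_point j x = (\<lambda>l. (1 / real_of_int (x j)) * real_of_int (x l))" by (simp add: aff_point_def)
  hence "eval (aff_point j x) F = (1 / real_of_int (x j)) ^ k * real_of_int (eval x F)"
    by (simp only: eval_scale[OF F] eval_of_int)
  hence "\<bar>eval (aff_point j x) F\<bar> = real_of_int \<bar>eval x F\<bar> / real_of_int \<bar>x j\<bar> ^ k"
    by (simp add: abs_mult power_abs power_divide)
  also have "\<dots> \<le> B powr \<gamma> / (B / 2) ^ k"
  proof (rule frac_le)
    show "real_of_int \<bar>eval x F\<bar> \<le> B powr \<gamma>" using x by (simp add: S_set_def)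
    show "(B / 2) ^ k \<le> real_of_int \<bar>x j\<bar> ^ k" using max(2) B by (intro power_mono) auto
  qed (use B in auto)
  also have "\<dots> = 2 ^ k * B powr - (real k - \<gamma>)"
    using B by (simp add: power_divide powr_diff powr_realpow[symmetric])
  finally show "\<bar>eval (aff_point j x) F\<bar> \<le> 2 ^ k * B powr - (real k - \<gamma>)" .
qed

lemma floor_grid:
  fixes s u :: real
  assumes "0 < s" "s \<le> 1" "\<bar>u\<bar> \<le> 1"
  shows "\<lfloor>u / s\<rfloor> \<in> {- \<lceil>1 / s\<rceil>..\<lceil>1 / s\<rceil>}" "real (card {- \<lceil>1 / s\<rceil>..\<lceil>1 / s\<rceil>}) \<le> 5 / s"
proof -
  have u: "- (1 / s) \<le> u / s" "u / s \<le> 1 / s" using assms by (auto simp: field_simps)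
  have s: "1 \<le> 1 / s" using assms by simp
  show "\<lfloor>u / s\<rfloor> \<in> {- \<lceil>1 / s\<rceil>..\<lceil>1 / s\<rceil>}" using u by (simp, linarith)
  have "real (card {- \<lceil>1 / s\<rceil>..\<lceil>1 / s\<rceil>}) = 2 * real_of_int \<lceil>1 / s\<rceil> + 1"
    using s by simp
  \<comment> \<open>The ceiling is at most 1/s + 1, and 3 \<le> 3/s because s \<le> 1.\<close>
  also have "\<dots> \<le> 5 * (1 / s)" using s by linarith
  finally show "real (card {- \<lceil>1 / s\<rceil>..\<lceil>1 / s\<rceil>}) \<le> 5 / s" by simp
qed

lemma same_floor_close:
  fixes s u v :: real
  assumes "0 < s" "\<lfloor>u / s\<rfloor> = \<lfloor>v / s\<rfloor>"
  shows "\<bar>u - v\<bar> \<le> s"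
proof -
  have "\<bar>u / s - v / s\<bar> < 1" using assms(2) by linarith
  hence "\<bar>u - v\<bar> / s < 1" using assms(1) by (simp add: diff_divide_distrib[symmetric])
  thus ?thesis using assms(1) by (simp add: field_simps)
qed

text \<open>Each point selects a chart \<open>j\<close>, a direction \<open>i\<close> with large
  derivative, and a grid cell; the patches are the fibres of this labelling. A pair (i, j) has at
  most 5/\<rho> cells in direction \<open>i\<close> and 5 B^\<alpha> in each of the n - 2
  others.\<close>

lemma patch_cover:
  fixes \<alpha> \<gamma> T :: real and n k D :: nat
  assumes n: "n \<ge> 2" and F: "F \<in> forms n k" "k > 0" "nonsingular n F"
    and \<alpha>: "0 < \<alpha>" "\<alpha> \<le> real k - \<gamma>" and T: "T \<ge> 0"
    and ineq: "degree_bound n \<alpha> (real k - \<gamma>) T D"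
  shows "\<exists>B0 K. 1 \<le> B0 \<and> 0 \<le> K \<and> (\<forall>B\<ge>B0. \<exists>\<A>. finite \<A> \<and> real (card \<A>) \<le> K * B powr (real (n - 2) * \<alpha>) \<and>
    (\<forall>A\<in>\<A>. primitive_form n D (B powr (T - D - 1)) A) \<and>
    (\<forall>x\<in>S_set \<gamma> n F B. \<exists>A\<in>\<A>. eval x A = 0))"
proof -
  define \<beta> where "\<beta> = real k - \<gamma>"
  note \<alpha>\<beta> = \<alpha>[folded \<beta>_def] and ineq' = ineq[folded \<beta>_def]
  have \<beta>: "\<beta> > 0" using \<alpha>\<beta> by simp
  have n0: "n > 0" using n by simp
  obtain c where c: "c > 0" "\<And>j (u :: nat \<Rightarrow> real). j < n \<Longrightarrow> u j = 1 \<Longrightarrow> \<forall>l<n. \<bar>u l\<bar> \<le> 1 \<Longrightarrow> \<bar>eval u F\<bar> < c \<Longrightarrow>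
    \<exists>i<n. i \<noteq> j \<and> c \<le> \<bar>eval u (partial_deriv i F)\<bar>"
    by (rule gradient_lower_bound_uniform[OF F(1,3) n0]) blast
  define Pairs where "Pairs = {(i, j). i < n \<and> j < n \<and> i \<noteq> j}"
  have Pairs: "finite Pairs" "card Pairs \<le> n * n"
  proof -
    have sub: "Pairs \<subseteq> {..<n} \<times> {..<n}" by (auto simp: Pairs_def)
    show "finite Pairs" by (rule finite_subset[OF sub]) simp
    have "card Pairs \<le> card ({..<n} \<times> {..<n})" by (rule card_mono[OF _ sub]) simp
    thus "card Pairs \<le> n * n" by (simp add: card_cartesian_product)
  qed
  let ?pt = "\<lambda>B ij x. x (snd ij) \<noteq> 0 \<and> real_of_int \<bar>x (snd ij)\<bar> \<le> B \<and>
      (\<forall>l<n. \<bar>aff_point (snd ij) x l\<bar> \<le> 1) \<and> c \<le> \<bar>eval (aff_point (snd ij) x) (partial_deriv (fst ij) F)\<bar> \<and>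
      \<bar>eval (aff_point (snd ij) x) F\<bar> \<le> 2 ^ k * B powr - \<beta>"
  let ?ok = "\<lambda>ij. on_patch n F (fst ij) (snd ij) c (2 ^ k) \<alpha> \<beta>"
  let ?form = "\<lambda>B X A. primitive_form n D (B powr (T - D - 1)) A \<and>
        (\<forall>x\<in>X. eval x A = 0)"
  have ex: "\<exists>\<rho> B0. 0 < \<rho> \<and> \<rho> \<le> 1 \<and> 1 \<le> B0 \<and> (\<forall>B\<ge>B0. \<forall>X. on_patch n F i j c (2 ^ k) \<alpha> \<beta> \<rho> B X \<longrightarrow> (\<exists>A. ?form B X A))"
    if "i < n" "j < n" "i \<noteq> j" for i j
    using form_vanishing_on_patch[OF n F(1,2) that c(1) _ \<alpha>\<beta> T ineq', of "2 ^ k"] unfolding Bex_def by simp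
  have "\<forall>ij\<in>Pairs. \<exists>\<rho>. 0 < \<rho> \<and> \<rho> \<le> 1 \<and> (\<exists>B0. 1 \<le> B0 \<and> (\<forall>B\<ge>B0. \<forall>X. ?ok ij \<rho> B X \<longrightarrow> (\<exists>A. ?form B X A)))"
  proof
    fix ij assume "ij \<in> Pairs"
    hence "fst ij < n" "snd ij < n" "fst ij \<noteq> snd ij" by (auto simp: Pairs_def)
    from ex[OF this] show "\<exists>\<rho>. 0 < \<rho> \<and> \<rho> \<le> 1 \<and> (\<exists>B0. 1 \<le> B0 \<and> (\<forall>B\<ge>B0. \<forall>X. ?ok ij \<rho> B X \<longrightarrow> (\<exists>A. ?form B X A)))"
      by (elim exE conjE) (intro exI conjI)
  qed
  from bchoice[OF this] obtain \<rho> where \<rho>: "\<forall>ij\<in>Pairs. 0 < \<rho> ij \<and> \<rho> ij \<le> 1 \<and>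
      (\<exists>B0. 1 \<le> B0 \<and> (\<forall>B\<ge>B0. \<forall>X. ?ok ij (\<rho> ij) B X \<longrightarrow> (\<exists>A. ?form B X A)))"
    by (elim exE)
  hence "\<forall>ij\<in>Pairs. \<exists>B0. 1 \<le> B0 \<and> (\<forall>B\<ge>B0. \<forall>X. ?ok ij (\<rho> ij) B X \<longrightarrow> (\<exists>A. ?form B X A))"
    by (intro ballI) (drule (1) bspec, elim conjE)
  from bchoice[OF this] obtain b where b: "\<forall>ij\<in>Pairs. 1 \<le> b ij \<and>
      (\<forall>B\<ge>b ij. \<forall>X. ?ok ij (\<rho> ij) B X \<longrightarrow> (\<exists>A. ?form B X A))"
    by (elim exE)
  have \<rho>01: "0 < \<rho> ij" "\<rho> ij \<le> 1" if "ij \<in> Pairs" for ij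
    by (rule conjunct1[OF bspec[OF \<rho> that]], rule conjunct1[OF conjunct2[OF bspec[OF \<rho> that]]])
  have b1: "1 \<le> b ij" if "ij \<in> Pairs" for ij using bspec[OF b that] by (rule conjunct1)
  \<comment> \<open>Exceeds all thresholds of the pairs at once; the last summand forces 2^k
    B^(-\<beta>) < c, so that |F| is too small to account for the lower bound and a derivative
    must.\<close>
  define B1 where "B1 = (\<Sum>ij\<in>Pairs. b ij) + 1 + (2 ^ k / c + 1) powr (1 / \<beta>)"
  have B1: "1 \<le> B1" unfolding B1_def using b1 by (intro order.trans[OF _ add_increasing2] add_increasing sum_nonneg) fastforce+
  have B1b: "b ij \<le> B1" if "ij \<in> Pairs" for ij
  proof -
    have "b ij \<le> (\<Sum>ij\<in>Pairs. b ij)"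
      by (rule member_le_sum[OF that _ Pairs(1)]) (use b1 in fastforce)
    moreover have "0 \<le> (2 ^ k / c + 1) powr (1 / \<beta>)" by simp
    ultimately show ?thesis unfolding B1_def by linarith
  qed
  have B1c: "2 ^ k * B powr - \<beta> < c" if "B \<ge> B1" for B
  proof -
    have pos: "2 ^ k / c + 1 > 0" using c(1) by (simp add: add_pos_pos)
    have "0 \<le> (\<Sum>ij\<in>Pairs. b ij)" using b1 by (intro sum_nonneg) fastforce
    hence "(2 ^ k / c + 1) powr (1 / \<beta>) \<le> B" using that unfolding B1_def by linarith
    hence "((2 ^ k / c + 1) powr (1 / \<beta>)) powr \<beta> \<le> B powr \<beta>" using \<beta> by (intro powr_mono2) auto
    hence "2 ^ k / c + 1 \<le> B powr \<beta>" using \<beta> pos by (simp add: powr_powr)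
    hence "2 ^ k / c < B powr \<beta>" by linarith
    moreover have "B powr \<beta> > 0" using that B1 by simp
    ultimately show ?thesis using c(1) by (simp add: powr_minus field_simps)
  qed
  define K where "K = (\<Sum>ij\<in>Pairs. 5 / \<rho> ij * 5 ^ (n - 2))"
  have K: "0 \<le> K" unfolding K_def using \<rho>01(1) by (intro sum_nonneg mult_nonneg_nonneg) (auto intro: less_imp_le)
  show ?thesis
  proof (rule exI[of _ B1], rule exI[of _ K], intro conjI B1 K allI impI)
    fix B :: real assume B: "B \<ge> B1"
    have Bge1: "B \<ge> 1" using B B1 by simp
    let ?S = "S_set \<gamma> n F B" and ?r = "B powr - \<alpha>"
    have r: "0 < ?r" "?r \<le> 1" using Bge1 \<alpha>(1) powr_mono[of "- \<alpha>" 0 B] by auto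
    have "\<forall>x\<in>?S. \<exists>ij. ij \<in> Pairs \<and> ?pt B ij x"
    proof
      fix x assume x: "x \<in> ?S"
      obtain j where j: "j < n" "\<forall>l<n. \<bar>x l\<bar> \<le> \<bar>x j\<bar>" "B / 2 < real_of_int \<bar>x j\<bar>" "real_of_int \<bar>x j\<bar> \<le> B"
        using S_set_max_coordinate[OF x n0] .
      note u = S_set_affine[OF x F(1) Bge1 j(1-3), folded \<beta>_def]
      have "\<bar>eval (aff_point j x) F\<bar> < c" using u(4) B1c[OF B] by linarith
      from c(2)[OF j(1) u(2,3) this] obtain i where "i < n" "i \<noteq> j" "c \<le> \<bar>eval (aff_point j x) (partial_deriv i F)\<bar>"
        by (elim exE conjE)
      thus "\<exists>ij. ij \<in> Pairs \<and> ?pt B ij x"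
        using u j by (intro exI[of _ "(i, j)"]) (simp add: Pairs_def)
    qed
    from bchoice[OF this] obtain q where q: "\<forall>x\<in>?S. q x \<in> Pairs \<and> ?pt B (q x) x"
      by (elim exE)
    define side where "side ij l = (if l = fst ij then \<rho> ij else ?r)" for ij and l :: nat
    define cell where "cell ij x = (\<lambda>l\<in>{..<n} - {snd ij}. \<lfloor>aff_point (snd ij) x l / side ij l\<rfloor>)" for ij x
    define grid where "grid ij = PiE ({..<n} - {snd ij}) (\<lambda>l. {- \<lceil>1 / side ij l\<rceil>..\<lceil>1 / side ij l\<rceil>})" for ij
    define label where "label x = (q x, cell (q x) x)" for x
    have side: "0 < side ij l" "side ij l \<le> 1" if "ij \<in> Pairs" for ij l
      using \<rho>01[OF that] r by (auto simp: side_def)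
    have card_grid: "real (card (grid ij)) \<le> 5 / \<rho> ij * 5 ^ (n - 2) * B powr (real (n - 2) * \<alpha>)" if ij: "ij \<in> Pairs" for ij
    proof -
      let ?V = "{..<n} - {snd ij}"
      have V: "finite ?V" "fst ij \<in> ?V" using ij by (auto simp: Pairs_def)
      have cV: "card (?V - {fst ij}) = n - 2" using ij by (auto simp: Pairs_def card_Diff_subset)
      have "real (card (grid ij)) = (\<Prod>l\<in>?V. real (card {- \<lceil>1 / side ij l\<rceil>..\<lceil>1 / side ij l\<rceil>}))"
        unfolding grid_def by (subst card_PiE) (simp_all del: card_atLeastAtMost_int)
      also have "\<dots> \<le> (\<Prod>l\<in>?V. 5 / side ij l)"
        using side[OF ij] floor_grid(2)[of _ 0] by (intro prod_mono conjI) (simp_all del: card_atLeastAtMost_int)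
      also have "\<dots> = 5 / \<rho> ij * (\<Prod>l\<in>?V - {fst ij}. 5 / side ij l)"
        unfolding prod.remove[OF V] by (simp add: side_def)
      also have "(\<Prod>l\<in>?V - {fst ij}. 5 / side ij l) = (\<Prod>l\<in>?V - {fst ij}. 5 * B powr \<alpha>)"
        by (intro prod.cong refl) (simp add: side_def powr_minus divide_inverse)
      also have "\<dots> = 5 ^ (n - 2) * B powr (real (n - 2) * \<alpha>)"
        using Bge1 unfolding prod_constant cV by (simp add: power_mult_distrib powr_realpow[symmetric] powr_powr mult.commute)
      finally show ?thesis by (simp only: mult.assoc)
    qed
    have fin_grid: "finite (grid ij)" for ij unfolding grid_def by (intro finite_PiE) auto
    let ?\<Lambda> = "SIGMA ij:Pairs. grid ij"
    have fin: "finite ?\<Lambda>" using Pairs fin_grid by (intro finite_SigmaI)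
    have lab: "label ` ?S \<subseteq> ?\<Lambda>"
    proof
      fix \<xi> assume "\<xi> \<in> label ` ?S"
      then obtain x where x: "x \<in> ?S" "\<xi> = label x" by blast
      note qx = bspec[OF q x(1)]
      have P: "q x \<in> Pairs" using qx by (rule conjunct1)
      have "\<forall>l<n. \<bar>aff_point (snd (q x)) x l\<bar> \<le> 1" using qx by (elim conjE)
      hence "cell (q x) x \<in> grid (q x)"
        unfolding cell_def grid_def restrict_PiE_iff by (intro ballI floor_grid(1) side P) simp
      thus "\<xi> \<in> ?\<Lambda>" using P x by (simp add: label_def)
    qed
    \<comment> \<open>Only labels that occur are used, so every fibre is non-empty and can supply a
      centre.\<close>
    have "\<forall>\<xi>\<in>label ` ?S. \<exists>A. ?form B {x \<in> ?S. label x = \<xi>} A"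
    proof
      fix \<xi> assume \<xi>: "\<xi> \<in> label ` ?S"
      let ?X = "{x \<in> ?S. label x = \<xi>}" and ?ij = "fst \<xi>"
      have P: "?ij \<in> Pairs" using \<xi> lab by auto
      have pts: "?pt B ?ij x" if "x \<in> ?X" for x
      proof -
        have x: "x \<in> ?S" "q x = ?ij" using that by (auto simp: label_def)
        from bspec[OF q x(1), THEN conjunct2] show ?thesis unfolding x(2) .
      qed
      have close: "\<bar>aff_point (snd ?ij) x l - aff_point (snd ?ij) y l\<bar> \<le> (if l = fst ?ij then \<rho> ?ij else ?r)"
        if "x \<in> ?X" "y \<in> ?X" "l < n" for x y l
      \<comment> \<open>The coordinate of the chart is 1 at every point and has no place in the
        grid.\<close>
      proof (cases "l = snd ?ij")
        case True
        have "x (snd ?ij) \<noteq> 0" "y (snd ?ij) \<noteq> 0" 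
          by (rule conjunct1[OF pts[OF that(1)]], rule conjunct1[OF pts[OF that(2)]])
        hence "aff_point (snd ?ij) x l - aff_point (snd ?ij) y l = 0" unfolding True by (simp add: aff_point_def)
        thus ?thesis using \<rho>01[OF P] r by simp
      next
        case False
        have "cell ?ij x = cell ?ij y" using that(1,2) by (auto simp: label_def)
        from fun_cong[OF this, of l] have "\<lfloor>aff_point (snd ?ij) x l / side ?ij l\<rfloor> = \<lfloor>aff_point (snd ?ij) y l / side ?ij l\<rfloor>"
          using False that(3) by (simp add: cell_def)
        from same_floor_close[OF side(1)[OF P] this] show ?thesis by (simp add: side_def)
      qed
      have "?X \<noteq> {}" using \<xi> by blast
      hence ok: "?ok ?ij (\<rho> ?ij) B ?X"
        using pts close by (intro conjI[of "?X \<noteq> {}"] conjI[of "\<forall>x\<in>?X. _ x"] ballI allI impI)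
      have "b ?ij \<le> B" using B1b[OF P] B by linarith
      from bspec[OF b P, THEN conjunct2, THEN spec[of _ B], THEN mp, OF this, THEN spec[of _ ?X], THEN mp, OF ok]
      show "\<exists>A. ?form B ?X A" .
    qed
    from bchoice[OF this] obtain f where f: "\<forall>\<xi>\<in>label ` ?S. ?form B {x \<in> ?S. label x = \<xi>} (f \<xi>)" by (elim exE)
    show "\<exists>\<A>. finite \<A> \<and> real (card \<A>) \<le> K * B powr (real (n - 2) * \<alpha>) \<and>
      (\<forall>A\<in>\<A>. primitive_form n D (B powr (T - D - 1)) A) \<and>
      (\<forall>x\<in>S_set \<gamma> n F B. \<exists>A\<in>\<A>. eval x A = 0)"
    proof (intro exI[of _ "f ` label ` ?S"] conjI ballI)
      have finL: "finite (label ` ?S)" by (rule finite_subset[OF lab fin])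
      thus "finite (f ` label ` ?S)" by (rule finite_imageI)
      have "card (f ` label ` ?S) \<le> card (label ` ?S)" by (rule card_image_le[OF finL])
      also have "\<dots> \<le> card ?\<Lambda>" by (rule card_mono[OF fin lab])
      also have "card ?\<Lambda> = (\<Sum>ij\<in>Pairs. card (grid ij))" using Pairs fin_grid by (intro card_SigmaI) auto
      finally have "real (card (f ` label ` ?S)) \<le> real (\<Sum>ij\<in>Pairs. card (grid ij))" by (simp only: of_nat_le_iff)
      also have "\<dots> = (\<Sum>ij\<in>Pairs. real (card (grid ij)))" by simp
      also have "\<dots> \<le> (\<Sum>ij\<in>Pairs. 5 / \<rho> ij * 5 ^ (n - 2) * B powr (real (n - 2) * \<alpha>))"
        by (rule sum_mono) (rule card_grid)
      also have "\<dots> = K * B powr (real (n - 2) * \<alpha>)" unfolding K_def sum_distrib_right ..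
      finally show "real (card (f ` label ` ?S)) \<le> K * B powr (real (n - 2) * \<alpha>)" .
    next
      fix A assume "A \<in> f ` label ` ?S"
      then obtain \<xi> where \<xi>: "\<xi> \<in> label ` ?S" "A = f \<xi>" by blast
      from bspec[OF f \<xi>(1)] show "A \<in> forms n D" "coprime_coeffs A" "\<forall>m. real_of_int \<bar>lookup A m\<bar> \<le> B powr (T - D - 1)"
        unfolding \<xi>(2) by simp_all
    next
      fix x assume x: "x \<in> ?S"
      have l: "label x \<in> label ` ?S" using x by (rule imageI)
      from bspec[OF f l] have "\<forall>y\<in>{y \<in> ?S. label y = label x}. eval y (f (label x)) = 0" by (elim conjE)
      hence "eval x (f (label x)) = 0" using x by blast
      thus "\<exists>A\<in>f ` label ` ?S. eval x A = 0" using l by blast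
    qed
  qed
qed

section \<open>The exponent\<close>

text \<open>The critical value \<open>\<alpha>0\<close> satisfies (n - 2) \<alpha>0 = \<theta> and
  \<alpha>0^(n-2) \<beta> = \<tau>^(n-1). Since \<beta> > \<tau>, it is below \<beta>, so there is
  room to increase it a little.\<close>

lemma exponent_choice:
  fixes k n :: nat and \<gamma> \<epsilon> :: real
  assumes n: "n \<ge> 3" and \<gamma>: "\<gamma> < real k - real n / (real n - 1)" and \<epsilon>: "\<epsilon> > 0"
  shows "\<exists>\<alpha>>0. \<alpha> \<le> real k - \<gamma> \<and> real (n - 2) * \<alpha> \<le> theta n k \<gamma> + \<epsilon> \<and>
    (real n / (real n - 1)) ^ (n - 1) < \<alpha> ^ (n - 2) * (real k - \<gamma>)"
proof -
  define \<beta> where "\<beta> = real k - \<gamma>"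
  define \<tau> where "\<tau> = real n / (real n - 1)"
  define s where "s = real n - 2"
  define \<alpha>0 where "\<alpha>0 = \<tau> powr ((real n - 1) / s) * \<beta> powr (- 1 / s)"
  have s: "s > 0" "real (n - 2) = s" using n by (auto simp: s_def of_nat_diff)
  have \<tau>: "\<tau> > 1" using n by (simp add: \<tau>_def)
  have \<beta>: "\<beta> > \<tau>" using \<gamma> by (simp add: \<beta>_def \<tau>_def)
  have \<beta>0: "\<beta> > 0" using \<tau> \<beta> by linarith
  have \<alpha>0: "\<alpha>0 > 0" using \<tau> \<beta>0 by (simp add: \<alpha>0_def)
  have theta: "theta n k \<gamma> = s * \<alpha>0"
    by (simp add: theta_def \<alpha>0_def s_def \<tau>_def \<beta>_def)
  have pow: "\<alpha>0 ^ (n - 2) * \<beta> = \<tau> ^ (n - 1)"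
  proof -
    have "\<alpha>0 ^ (n - 2) = \<alpha>0 powr s" using \<alpha>0 s(2) powr_realpow[of \<alpha>0 "n - 2"] by simp
    also have "\<dots> = (\<tau> powr ((real n - 1) / s)) powr s * (\<beta> powr (- 1 / s)) powr s"
      unfolding \<alpha>0_def by (rule powr_mult)
    also have "\<dots> = \<tau> powr (real n - 1) * \<beta> powr - 1" using s by (simp add: powr_powr)
    also have "\<tau> powr (real n - 1) = \<tau> ^ (n - 1)"
      using \<tau> n powr_realpow[of \<tau> "n - 1"] by (simp add: of_nat_diff)
    also have "\<beta> powr - 1 = 1 / \<beta>" using \<beta>0 by (simp add: powr_minus divide_inverse)
    finally show ?thesis using \<beta>0 by simp
  qed
  have "\<alpha>0 < \<beta>"
  proof (rule ccontr)
    assume "\<not> \<alpha>0 < \<beta>"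
    hence "\<beta> ^ (n - 2) \<le> \<alpha>0 ^ (n - 2)" using \<beta>0 by (intro power_mono) auto
    hence "\<beta> ^ (n - 2) * \<beta> \<le> \<tau> ^ (n - 1)" unfolding pow[symmetric] using \<beta>0 by (intro mult_right_mono) auto
    moreover have "n - 1 = Suc (n - 2)" using n by simp
    ultimately have "\<beta> ^ (n - 1) \<le> \<tau> ^ (n - 1)" by (simp add: mult.commute)
    moreover have "\<tau> ^ (n - 1) < \<beta> ^ (n - 1)" using \<beta> \<tau> n by (intro power_strict_mono) auto
    ultimately show False by simp
  qed
  \<comment> \<open>The gain \<epsilon> / s costs exactly \<epsilon> after multiplication by n - 2;
    the minimum keeps \<alpha> \<le> \<beta>.\<close>
  define \<alpha> where "\<alpha> = min \<beta> (\<alpha>0 + \<epsilon> / s)"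
  have gt: "\<alpha>0 < \<alpha>" using \<open>\<alpha>0 < \<beta>\<close> \<epsilon> s by (simp add: \<alpha>_def)
  have "s * \<alpha> \<le> s * (\<alpha>0 + \<epsilon> / s)" using s by (intro mult_left_mono) (auto simp: \<alpha>_def)
  also have "\<dots> = theta n k \<gamma> + \<epsilon>" using s unfolding theta by (simp add: distrib_left)
  finally have "real (n - 2) * \<alpha> \<le> theta n k \<gamma> + \<epsilon>" using s by simp
  moreover have "\<tau> ^ (n - 1) < \<alpha> ^ (n - 2) * \<beta>"
    unfolding pow[symmetric] using gt \<alpha>0 \<beta>0 n by (intro mult_strict_right_mono power_strict_mono) auto
  moreover have "\<alpha> > 0" "\<alpha> \<le> \<beta>" using gt \<alpha>0 by (auto simp: \<alpha>_def)
  ultimately show ?thesis unfolding \<beta>_def \<tau>_def by blast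
qed

lemma theta_nonneg: "n \<ge> 2 \<Longrightarrow> theta n k \<gamma> \<ge> 0"
  by (simp add: theta_def)

text \<open>Since 1 < k - \<gamma> \<le> k, the last factor of \<theta> is at least 1 / k, the
  middle one is at least 1, and n - 2 \<ge> 2 k.\<close>

lemma theta_ge_2:
  fixes k n :: nat and \<gamma> :: real
  assumes n: "n \<ge> 2 * k + 2" and k: "k > 0" and \<gamma>: "0 \<le> \<gamma>" "\<gamma> < real k - real n / (real n - 1)"
  shows "theta n k \<gamma> \<ge> 2"
proof -
  have rn: "real n - 2 \<ge> 2 * real k" using n by linarith
  have k1: "real k \<ge> 1" using k by simp
  have "real n / (real n - 1) \<ge> 1" using rn k1 by simp
  hence \<beta>: "real k - \<gamma> > 1" "real k - \<gamma> \<le> real k" using \<gamma> by linarith+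
  have a: "(real n / (real n - 1)) powr ((real n - 1) / (real n - 2)) \<ge> 1"
    using \<open>real n / (real n - 1) \<ge> 1\<close> rn k1 by (intro ge_one_powr_ge_zero) auto
  have "1 / real k \<le> 1 / (real k - \<gamma>)" using \<beta> by (intro divide_left_mono) auto
  also have "\<dots> = (real k - \<gamma>) powr - 1" using \<beta> by (simp add: powr_minus divide_inverse)
  also have "\<dots> \<le> (real k - \<gamma>) powr (- 1 / (real n - 2))"
    using \<beta> rn k1 by (intro powr_mono) auto
  finally have b: "1 / real k \<le> (real k - \<gamma>) powr (- 1 / (real n - 2))" .
  have "(2 * real k * 1) * (1 / real k) \<le> theta n k \<gamma>"
    unfolding theta_def using a b rn k1 by (intro mult_mono) auto
  thus ?thesis using k1 by simp
qed

lemma S_set_bound: 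
  assumes "x \<in> S_set \<gamma> n F B" "l < n"
  shows "real_of_int \<bar>x l\<bar> \<le> B"
proof -
  have "\<bar>x l\<bar> \<le> Max ((\<lambda>i. \<bar>x i\<bar>) ` {..<n})" using assms(2) by (intro Max_ge) auto
  moreover have "real_of_int (Max ((\<lambda>i. \<bar>x i\<bar>) ` {..<n})) \<le> B" using assms(1) by (simp add: S_set_def)
  ultimately show ?thesis by linarith
qed

theorem theorem2p1:
  fixes k :: nat and \<gamma> \<epsilon> :: real
  assumes "k \<ge> 3" and "\<gamma> \<ge> 0" and "\<epsilon> > 0"
  shows "\<exists>(D::nat) (c::real) (C::real). D > 0 \<and>
    (\<forall>(n::nat) (F::int_mpoly).
       n \<ge> 3 \<and> \<gamma> < real k - real n / (real n - 1) \<and> F \<in> forms n k \<and> nonsingular n F \<longrightarrow>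
       (\<exists>K::real. \<forall>B::real. B \<ge> 1 \<longrightarrow>
          (\<exists>\<A> :: int_mpoly set.
             finite \<A> \<and> real (card \<A>) \<le> K * B powr (theta n k \<gamma> + \<epsilon>) \<and>
             (\<forall>A\<in>\<A>. A \<in> forms n D \<and> coprime_coeffs A \<and>
                (\<forall>m. real_of_int \<bar>Poly_Mapping.lookup A m\<bar> \<le> C * B powr c)) \<and>
             (\<forall>x\<in>S_set \<gamma> n F B. \<exists>A\<in>\<A>. eval x A = 0))))"
proof -
  \<comment> \<open>For each n, \<alpha> is fixed first and then D is taken large. Stating the
    existence of \<alpha> inside the eventual property lets finitely many n share one D.\<close>
  define good where "good n \<alpha> D \<longleftrightarrow> \<alpha> > 0 \<and> \<alpha> \<le> real k - \<gamma> \<and> real (n - 2) * \<alpha> \<le> theta n k \<gamma> + \<epsilon> \<and>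
    degree_bound n \<alpha> (real k - \<gamma>) (real n * real D / (real n - 1)) D" for n \<alpha> and D :: nat
  have "eventually (\<lambda>D. \<gamma> < real k - real n / (real n - 1) \<longrightarrow> (\<exists>\<alpha>. good n \<alpha> D)) sequentially"
    if "n \<in> {3..<2 * k + 2}" for n
  proof (cases "\<gamma> < real k - real n / (real n - 1)")
    case True
    have n: "n \<ge> 3" using that by simp
    obtain \<alpha> where \<alpha>: "\<alpha> > 0" "\<alpha> \<le> real k - \<gamma>" "real (n - 2) * \<alpha> \<le> theta n k \<gamma> + \<epsilon>"
      "(real n / (real n - 1)) ^ (n - 1) < \<alpha> ^ (n - 2) * (real k - \<gamma>)"
      using exponent_choice[OF n True assms(3)] by blast
    have "n \<ge> 2" using n by simp
    from eventually_degree_inequality[OF this \<alpha>(4), of "real (n - 2) * \<alpha> + (real k - \<gamma>)"]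
    show ?thesis by eventually_elim (use \<alpha>(1-3) in \<open>auto simp: good_def intro!: exI[of _ \<alpha>]\<close>)
  qed simp
  hence "eventually (\<lambda>D. \<forall>n\<in>{3..<2 * k + 2}. \<gamma> < real k - real n / (real n - 1) \<longrightarrow> (\<exists>\<alpha>. good n \<alpha> D)) sequentially"
    by (intro eventually_ball_finite) auto
  then obtain D0 where D0: "\<forall>D\<ge>D0. \<forall>n\<in>{3..<2 * k + 2}. \<gamma> < real k - real n / (real n - 1) \<longrightarrow> (\<exists>\<alpha>. good n \<alpha> D)"
    unfolding eventually_sequentially by blast
  define D where "D = Suc D0"
  have D: "D > 0" "D \<ge> D0" by (auto simp: D_def)
  show ?thesis
  \<comment> \<open>The exponent c = D suits both families: T \<le> 2 D gives T - D - 1 \<le> D, and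
    the forms in two variables have coefficients at most B \<le> B^D. The implied constant is then
    1.\<close>
  proof (rule exI[of _ D], rule exI[of _ "real D"], rule exI[of _ 1], intro conjI D(1) allI impI)
    fix n :: nat and F :: int_mpoly
    assume hyp: "n \<ge> 3 \<and> \<gamma> < real k - real n / (real n - 1) \<and> F \<in> forms n k \<and> nonsingular n F"
    let ?goal = "\<lambda>K B. \<exists>\<A> :: int_mpoly set.
             finite \<A> \<and> real (card \<A>) \<le> K * B powr (theta n k \<gamma> + \<epsilon>) \<and>
             (\<forall>A\<in>\<A>. primitive_form n D (1 * B powr real D) A) \<and>
             (\<forall>x\<in>S_set \<gamma> n F B. \<exists>A\<in>\<A>. eval x A = 0)"
    have n: "n \<ge> 3" "n \<ge> 2" and \<gamma>: "\<gamma> < real k - real n / (real n - 1)" and F: "F \<in> forms n k" "nonsingular n F"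
      using hyp by auto
    have quad: "?goal K B" if B: "B \<ge> 1" and K: "9 * B ^ 2 \<le> K * B powr (theta n k \<gamma> + \<epsilon>)" for K B
    proof -
      obtain \<A> where \<A>: "finite \<A>" "real (card \<A>) \<le> 9 * B ^ 2"
        "\<And>A. A \<in> \<A> \<Longrightarrow> primitive_form n D B A"
        "\<And>x :: nat \<Rightarrow> int. \<forall>l<n. real_of_int \<bar>x l\<bar> \<le> B \<Longrightarrow> \<exists>A\<in>\<A>. eval x A = 0"
        using quadratic_cover[OF n(2) D(1) B] by blast
      have "B powr 1 \<le> B powr real D" using B D by (intro powr_mono) auto
      hence BD: "B \<le> 1 * B powr real D" using B by simp
      show ?thesis
      proof (intro exI[of _ \<A>] conjI ballI allI)
        show "finite \<A>" by (fact \<A>)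
        show "real (card \<A>) \<le> K * B powr (theta n k \<gamma> + \<epsilon>)" using \<A>(2) K by linarith
        show "A \<in> forms n D" "coprime_coeffs A" if "A \<in> \<A>" for A using \<A>(3)[OF that] by auto
        show "real_of_int \<bar>Poly_Mapping.lookup A m\<bar> \<le> 1 * B powr real D" if "A \<in> \<A>" for A m
          using \<A>(3)[OF that] BD order.trans by blast
        show "\<exists>A\<in>\<A>. eval x A = 0" if "x \<in> S_set \<gamma> n F B" for x
          using \<A>(4)[of x] S_set_bound[OF that] by blast
      qed
    qed
    show "\<exists>K. \<forall>B. B \<ge> 1 \<longrightarrow> ?goal K B"
    proof (cases "n < 2 * k + 2")
      case False
      have th: "theta n k \<gamma> \<ge> 2" using False assms \<gamma> by (intro theta_ge_2) auto
      have "?goal 9 B" if B: "B \<ge> 1" for B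
      proof (rule quad[OF B])
        have "B powr 2 \<le> B powr (theta n k \<gamma> + \<epsilon>)" using B th assms(3) by (intro powr_mono) auto
        thus "9 * B ^ 2 \<le> 9 * B powr (theta n k \<gamma> + \<epsilon>)" using B by simp
      qed
      thus ?thesis by blast
    next
      case True
      hence "n \<in> {3..<2 * k + 2}" using n(1) by simp
      then obtain \<alpha> where "good n \<alpha> D" using D0 D(2) \<gamma> by blast
      hence \<alpha>: "\<alpha> > 0" "\<alpha> \<le> real k - \<gamma>" "real (n - 2) * \<alpha> \<le> theta n k \<gamma> + \<epsilon>"
        and ineq: "degree_bound n \<alpha> (real k - \<gamma>) (real n * real D / (real n - 1)) D"
        by (auto simp: good_def)
      define T where "T = real n * real D / (real n - 1)"
      have T: "T \<ge> 0" "T - D - 1 \<le> real D"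
      proof -
        show "T \<ge> 0" using n by (simp add: T_def)
        have "real n * real D \<le> (2 * real D) * (real n - 1)" using n D by (simp add: algebra_simps)
        hence "T \<le> 2 * real D" using n unfolding T_def by (simp add: pos_divide_le_eq)
        thus "T - D - 1 \<le> real D" by linarith
      qed
      have "k > 0" using assms(1) by simp
      from patch_cover[OF n(2) F(1) this F(2) \<alpha>(1,2) T(1) ineq[folded T_def]]
      obtain B0 K where BK: "1 \<le> B0" "0 \<le> K" and cover: "\<And>B. B \<ge> B0 \<Longrightarrow> \<exists>\<A>. finite \<A> \<and> real (card \<A>) \<le> K * B powr (real (n - 2) * \<alpha>) \<and>
        (\<forall>A\<in>\<A>. primitive_form n D (B powr (T - D - 1)) A) \<and>
        (\<forall>x\<in>S_set \<gamma> n F B. \<exists>A\<in>\<A>. eval x A = 0)"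
        by blast
      \<comment> \<open>The added constant covers 1 \<le> B < B0, where the quadratic family has at
        most 9 B0^2 members.\<close>
      define K' where "K' = K + 9 * B0 ^ 2"
      have "?goal K' B" if B: "B \<ge> 1" for B
      proof (cases "B \<ge> B0")
        case True
        obtain \<A> where \<A>: "finite \<A>" "real (card \<A>) \<le> K * B powr (real (n - 2) * \<alpha>)"
          "\<And>A. A \<in> \<A> \<Longrightarrow> primitive_form n D (B powr (T - D - 1)) A"
          "\<And>x. x \<in> S_set \<gamma> n F B \<Longrightarrow> \<exists>A\<in>\<A>. eval x A = 0"
          using cover[OF True] by blast
        have BD: "B powr (T - D - 1) \<le> 1 * B powr real D" using B T by (simp add: powr_mono)
        have "K * B powr (real (n - 2) * \<alpha>) \<le> K' * B powr (theta n k \<gamma> + \<epsilon>)"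
          using BK B \<alpha>(3) by (intro mult_mono powr_mono) (auto simp: K'_def)
        show ?thesis
        proof (intro exI[of _ \<A>] conjI ballI allI)
          show "finite \<A>" by (fact \<A>)
          show "real (card \<A>) \<le> K' * B powr (theta n k \<gamma> + \<epsilon>)"
            using \<A>(2) \<open>K * B powr (real (n - 2) * \<alpha>) \<le> K' * B powr (theta n k \<gamma> + \<epsilon>)\<close> by linarith
          show "A \<in> forms n D" "coprime_coeffs A" if "A \<in> \<A>" for A using \<A>(3)[OF that] by auto
          show "real_of_int \<bar>Poly_Mapping.lookup A m\<bar> \<le> 1 * B powr real D" if "A \<in> \<A>" for A m
            using \<A>(3)[OF that] BD order.trans by blast
          show "\<exists>A\<in>\<A>. eval x A = 0" if "x \<in> S_set \<gamma> n F B" for x by (rule \<A>(4)[OF that])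
        qed
      next
        case False
        show ?thesis
        proof (rule quad[OF B])
          have "B ^ 2 \<le> B0 ^ 2" using False B by (intro power_mono) auto
          hence "9 * B ^ 2 \<le> K' * 1" using BK by (simp add: K'_def)
          also have "\<dots> \<le> K' * B powr (theta n k \<gamma> + \<epsilon>)"
            using BK B theta_nonneg[OF n(2), of k \<gamma>] assms(3)
            by (intro mult_left_mono ge_one_powr_ge_zero) (auto simp: K'_def)
          finally show "9 * B ^ 2 \<le> K' * B powr (theta n k \<gamma> + \<epsilon>)" .
        qed
      qed
      thus ?thesis by blast
    qed
  qed
qed

end
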